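(* For $i\in\{1,2\}$ let $G_i=F_{k_i}^{W_i}(K_{n_i})$ be a $k_i$-fan graph of $K_{n_i}$ on the set $W_i\subseteq[n_i]$, with $n_i\ge 2$ and $k_i\ge 1$, let $f_i$ be a leaf of $G_i$ whose neighbor $v_i$ satisfies $\deg_{G_i}(v_i)\ge 2$, and let $G=(G_1,f_1)*(G_2,f_2)$. Let $$t=|\{i\in\{1,2\} : \operatorname{reg}(S_{G_i\setminus v_i}/I_{G_i\setminus v_i})\ne\operatorname{reg}(S_{G_i}/I_{G_i})\}|.$$ Then: (1) If $t\le 1$, then $\operatorname{reg}(S_G/I_G)=\operatorname{reg}(S_{G_1}/I_{G_1})+\operatorname{reg}(S_{G_2}/I_{G_2})$. (2) If $t=2$ and $|W_i|=n_i-1$ for all $i\in\{1,2\}$, then $\operatorname{reg}(S_G/I_G)=\operatorname{reg}(S_{G_1}/I_{G_1})+\operatorname{reg}(S_{G_2}/I_{G_2})$. (3) If $t=2$ and $|W_i|=n_i$ for some $i\in\{1,2\}$, then $\operatorname{reg}(S_G/I_G)=\operatorname{reg}(S_{G_1}/I_{G_1})+\operatorname{reg}(S_{G_2}/I_{G_2})-1$.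
   Context: $\mathbb{K}$ is a field; $[n]=\{1,\dots,n\}$. For a finite simple graph $H$, $S_H=\mathbb{K}[x_u:u\in V(H)]$ and $I_H=(x_ux_v : \{u,v\}\in E(H))\subset S_H$ is the edge ideal. $H\setminus v$ denotes the induced subgraph of $H$ on $V(H)\setminus\{v\}$. For a finitely generated graded $S$-module $M$, $\operatorname{reg}(M)=\max\{j-i : \operatorname{Tor}_i^S(M,\mathbb{K})_j\ne 0\}$ is the Castelnuovo–Mumford regularity. A leaf is a vertex of degree $1$. Fan graphs: let $K_n$ be the complete graph on $[n]$. Given $U=\{u_1,\dots,u_r\}\subseteq[n]$ (with a chosen ordering), suppose that for each $i\in[r]$ a new complete graph $K_{a_i}$ on $a_i>i$ vertices is attached to $K_n$ in such a way that $V(K_n)\cap V(K_{a_i})=\{u_1,\dots,u_i\}$ (the new vertices of different attached cliques are pairwise distinct). The resulting graph is said to be obtained by adding a fan to $K_n$ on $U$, and $\{K_{a_1},\dots,K_{a_r}\}$ is the branch of that fan on $U$. If $W\subseteq[n]$ and $W=W_1\sqcup\cdots\sqcup W_k$ is a partition into nonempty subsets, a $k$-fan graph $F_k^W(K_n)$ of $K_n$ on $W$ is a graph obtained from $K_n$ by adding a fan on each $W_i$. The $*$ operation: let $G_1,G_2$ be (vertex-disjoint) graphs, and for $i=1,2$ let $f_i$ be a leaf of $G_i$ with neighbor $v_i$, $\deg_{G_i}(v_i)\ge 2$. Then $(G_1,f_1)*(G_2,f_2)$ is the graph obtained from $G_1$ and $G_2$ by identifying the vertices $f_1$ and $f_2$.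 *)

theory Defs
  imports
    "HOL-Library.Poly_Mapping"
    "HOL-Algebra.QuotRing"
    "HOL-Algebra.Module"
    "Jordan_Normal_Form.Matrix"
begin

section \<open>Polynomial rings and graded pieces\<close>

text \<open>A monomial is a finitely supported exponent function and a polynomial a finitely supported
  function from monomials to coefficients; the product of \<^typ>\<open>('a \<Rightarrow>\<^sub>0 nat) \<Rightarrow>\<^sub>0 'k::field\<close> is
  convolution, i.e.\ polynomial multiplication.\<close>

type_synonym ('a, 'k) mpoly = "('a \<Rightarrow>\<^sub>0 nat) \<Rightarrow>\<^sub>0 'k"

definition var :: "'a \<Rightarrow> ('a, 'k::field) mpoly" where
  "var u = Poly_Mapping.single (Poly_Mapping.single u 1) 1"

definition const_coeff :: "('a, 'k::field) mpoly \<Rightarrow> 'k" where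
  "const_coeff p = Poly_Mapping.lookup p 0"

definition mon_deg :: "('a \<Rightarrow>\<^sub>0 nat) \<Rightarrow> nat" where
  "mon_deg m = (\<Sum>u\<in>Poly_Mapping.keys m. Poly_Mapping.lookup m u)"

text \<open>The polynomial ring in the variables \<open>x\<^sub>u\<close>, \<open>u \<in> V\<close>.\<close>

definition poly_ring :: "'a set \<Rightarrow> ('a, 'k::field) mpoly ring" where
  "poly_ring V = \<lparr>carrier = {p. \<forall>m\<in>Poly_Mapping.keys p. Poly_Mapping.keys m \<subseteq> V},
     monoid.mult = (*), one = 1, zero = 0, add = (+)\<rparr>"

text \<open>The homogeneous piece of degree \<open>d\<close>; it is zero for \<open>d < 0\<close>.\<close>

definition hom_piece :: "'a set \<Rightarrow> int \<Rightarrow> ('a, 'k::field) mpoly set" where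
  "hom_piece V d =
     {p \<in> carrier (poly_ring V). \<forall>m\<in>Poly_Mapping.keys p. int (mon_deg m) = d}"

text \<open>\<open>R/I\<close> as an \<open>R\<close>-module.  The multiplication and unit are part of the module
  record but play no role.\<close>

definition quot_module :: "'r ring \<Rightarrow> 'r set \<Rightarrow> ('r, 'r set) module" where
  "quot_module R I = \<lparr>carrier = carrier (R Quot I), monoid.mult = monoid.mult (R Quot I), one = one (R Quot I),
     zero = zero (R Quot I), add = add (R Quot I),
     smult = (\<lambda>r X. (I +>\<^bsub>R\<^esub> r) \<otimes>\<^bsub>R Quot I\<^esub> X)\<rparr>"

definition quot_piece :: "'a set \<Rightarrow> ('a, 'k::field) mpoly set \<Rightarrow> int \<Rightarrow> ('a, 'k) mpoly set set" where
  "quot_piece V I d = (\<lambda>p. I +>\<^bsub>poly_ring V\<^esub> p) ` hom_piece V d"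

section \<open>Graded free resolutions, Tor and regularity\<close>

text \<open>Let \<open>S\<close> be the polynomial ring on \<open>V\<close>.  A record \<open>F\<close> stands for a sequence
  \<open>\<dots> \<rightarrow> F\<^sub>2 \<rightarrow> F\<^sub>1 \<rightarrow> F\<^sub>0 \<rightarrow> M\<close> of graded free modules of finite rank:
  \<open>F\<^sub>i\<close> has \<open>frank F i\<close> basis elements, the \<open>l\<close>-th one in degree \<open>shift F i l\<close>
  (so \<open>F\<^sub>i\<close> is the direct sum of the \<open>S(-shift F i l)\<close>), the matrix \<open>dmat F i\<close> describes the
  map \<open>F\<^bsub>i+1\<^esub> \<rightarrow> F\<^sub>i\<close> on column vectors, and \<open>F\<^sub>0 \<rightarrow> M\<close> sends the \<open>l\<close>-th basis element to
  \<open>gen F l\<close>.\<close>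

record (overloaded) ('a, 'k::zero, 'm) free_seq =
  frank :: "nat \<Rightarrow> nat"
  shift :: "nat \<Rightarrow> nat \<Rightarrow> int"
  dmat :: "nat \<Rightarrow> ('a, 'k) mpoly mat"
  gen :: "nat \<Rightarrow> 'm"

definition free_mod :: "'a set \<Rightarrow> nat \<Rightarrow> ('a, 'k::field) mpoly vec set" where
  "free_mod V r = {x \<in> carrier_vec r. \<forall>l<r. x $ l \<in> carrier (poly_ring V)}"

definition augment ::
  "(('a, 'k::field) mpoly, 'm) module \<Rightarrow> ('a, 'k, 'm) free_seq \<Rightarrow> ('a, 'k) mpoly vec \<Rightarrow> 'm" where
  "augment M F x = (\<Oplus>\<^bsub>M\<^esub>l\<in>{..<frank F 0}. (x $ l) \<odot>\<^bsub>M\<^esub> gen F l)"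

text \<open>\<open>Mg d\<close> is the degree-\<open>d\<close> piece of the graded module \<open>M\<close>.  The two degree conditions say
  that all maps preserve degrees; the remaining ones say that the sequence
  \<open>\<dots> \<rightarrow> F\<^sub>1 \<rightarrow> F\<^sub>0 \<rightarrow> M \<rightarrow> 0\<close> is exact.\<close>

definition graded_free_resolution ::
  "'a set \<Rightarrow> (('a, 'k::field) mpoly, 'm) module \<Rightarrow> (int \<Rightarrow> 'm set) \<Rightarrow> ('a, 'k, 'm) free_seq \<Rightarrow> bool"
where
  "graded_free_resolution V M Mg F \<longleftrightarrow>
     (\<forall>l<frank F 0. gen F l \<in> Mg (shift F 0 l)) \<and>
     (\<forall>i. dmat F i \<in> carrier_mat (frank F i) (frank F (Suc i))) \<and>
     (\<forall>i. \<forall>r<frank F i. \<forall>c<frank F (Suc i).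
        dmat F i $$ (r, c) \<in> hom_piece V (shift F (Suc i) c - shift F i r)) \<and>
     augment M F ` free_mod V (frank F 0) = carrier M \<and>
     {x \<in> free_mod V (frank F 0). augment M F x = \<zero>\<^bsub>M\<^esub>} =
       (\<lambda>y. dmat F 0 *\<^sub>v y) ` free_mod V (frank F 1) \<and>
     (\<forall>i. {x \<in> free_mod V (frank F (Suc i)). dmat F i *\<^sub>v x = 0\<^sub>v (frank F i)} =
       (\<lambda>y. dmat F (Suc i) *\<^sub>v y) ` free_mod V (frank F (Suc (Suc i))))"

text \<open>The residue field \<open>K\<close> is \<open>S\<close> modulo the ideal of all variables, so \<open>F\<^sub>i \<otimes> K\<close> is the
  graded vector space with the same homogeneous basis as \<open>F\<^sub>i\<close>, and the differentials of
  \<open>F \<otimes> K\<close> are obtained by replacing each entry by its constant coefficient.\<close>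

definition tens_piece :: "('a, 'k::field, 'm) free_seq \<Rightarrow> nat \<Rightarrow> int \<Rightarrow> 'k vec set" where
  "tens_piece F i j =
     {x \<in> carrier_vec (frank F i). \<forall>l<frank F i. x $ l \<noteq> 0 \<longrightarrow> shift F i l = j}"

definition tens_dmat :: "('a, 'k::field, 'm) free_seq \<Rightarrow> nat \<Rightarrow> 'k mat" where
  "tens_dmat F i = map_mat const_coeff (dmat F i)"

definition tor_cycles :: "('a, 'k::field, 'm) free_seq \<Rightarrow> nat \<Rightarrow> int \<Rightarrow> 'k vec set" where
  "tor_cycles F i j = (case i of
       0 \<Rightarrow> tens_piece F 0 j
     | Suc h \<Rightarrow> {x \<in> tens_piece F i j. tens_dmat F h *\<^sub>v x = 0\<^sub>v (frank F h)})"

definition tor_boundaries :: "('a, 'k::field, 'm) free_seq \<Rightarrow> nat \<Rightarrow> int \<Rightarrow> 'k vec set" where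
  "tor_boundaries F i j = (\<lambda>y. tens_dmat F i *\<^sub>v y) ` tens_piece F (Suc i) j"

text \<open>\<open>Tor\<^sub>i(M, K)\<^sub>j \<noteq> 0\<close>: the degree-\<open>j\<close> part of the \<open>i\<close>-th homology of \<open>F \<otimes> K\<close> is nonzero for a
  graded free resolution \<open>F\<close> of \<open>M\<close>.  Up to isomorphism the homology does not depend on \<open>F\<close>, and
  every finitely generated graded module has a resolution \<open>F\<close> by modules of finite rank.\<close>

definition tor_nonzero ::
  "'a set \<Rightarrow> (('a, 'k::field) mpoly, 'm) module \<Rightarrow> (int \<Rightarrow> 'm set) \<Rightarrow> nat \<Rightarrow> int \<Rightarrow> bool" where
  "tor_nonzero V M Mg i j \<longleftrightarrow>
     (\<exists>F. graded_free_resolution V M Mg F \<and> \<not> tor_cycles F i j \<subseteq> tor_boundaries F i j)"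

definition reg :: "'a set \<Rightarrow> (('a, 'k::field) mpoly, 'm) module \<Rightarrow> (int \<Rightarrow> 'm set) \<Rightarrow> int" where
  "reg V M Mg = Max {j - int i |i j. tor_nonzero V M Mg i j}"

section \<open>Graphs and edge ideals\<close>

record 'a graph =
  verts :: "'a set"
  edges :: "'a set set"

definition vdeg :: "'a graph \<Rightarrow> 'a \<Rightarrow> nat" where
  "vdeg G u = card {e \<in> edges G. u \<in> e}"

definition leaf :: "'a graph \<Rightarrow> 'a \<Rightarrow> bool" where
  "leaf G u \<longleftrightarrow> u \<in> verts G \<and> vdeg G u = 1"

definition del_vert :: "'a graph \<Rightarrow> 'a \<Rightarrow> 'a graph" where
  "del_vert G u = \<lparr>verts = verts G - {u}, edges = {e \<in> edges G. u \<notin> e}\<rparr>"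

definition edge_ideal :: "'a graph \<Rightarrow> ('a, 'k::field) mpoly set" where
  "edge_ideal G = Idl\<^bsub>poly_ring (verts G)\<^esub> {var u * var w |u w. {u, w} \<in> edges G}"

text \<open>The regularity of \<open>S\<^sub>G/I\<^sub>G\<close> over the field \<open>'k\<close>.\<close>

definition edge_reg :: "'k::field itself \<Rightarrow> 'a graph \<Rightarrow> int" where
  "edge_reg K G =
     (let I = (edge_ideal G :: ('a, 'k) mpoly set)
      in reg (verts G) (quot_module (poly_ring (verts G)) I) (quot_piece (verts G) I))"

section \<open>Fan graphs and the gluing operation\<close>

definition complete_edges :: "'a set \<Rightarrow> 'a set set" where
  "complete_edges A = {{u, w} |u w. u \<in> A \<and> w \<in> A \<and> u \<noteq> w}"

text \<open>\<open>As\<close> lists the vertex sets of the branch of a fan on \<open>U\<close>, added to the complete graph on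
  \<open>C\<close>.  Lists are indexed from 0, so \<open>As ! i\<close> meets \<open>C\<close> in the first \<open>i + 1\<close> elements of the
  chosen ordering \<open>us\<close> of \<open>U\<close>.\<close>

definition fan_branch :: "'a set \<Rightarrow> 'a set \<Rightarrow> 'a set list \<Rightarrow> bool" where
  "fan_branch C U As \<longleftrightarrow>
     (\<exists>us. distinct us \<and> set us = U \<and> length As = length us \<and>
        (\<forall>i<length us. finite (As ! i) \<and> card (As ! i) > Suc i \<and>
           C \<inter> As ! i = set (take (Suc i) us)) \<and>
        (\<forall>i<length us. \<forall>j<length us. i \<noteq> j \<longrightarrow> (As ! i - C) \<inter> (As ! j - C) = {}))"

text \<open>\<open>G\<close> is a \<open>k\<close>-fan graph, on \<open>W \<subseteq> C\<close>, of the complete graph with vertex set \<open>C\<close>: \<open>Ws\<close> is the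
  partition of \<open>W\<close> and \<open>Bs ! i\<close> is the branch of the fan on \<open>Ws ! i\<close>.  New vertices of
  different fans are distinct.\<close>

definition fan_graph :: "nat \<Rightarrow> 'a set \<Rightarrow> 'a set \<Rightarrow> 'a graph \<Rightarrow> bool" where
  "fan_graph k W C G \<longleftrightarrow> finite C \<and> W \<subseteq> C \<and>
     (\<exists>Ws Bs. length Ws = k \<and> length Bs = k \<and>
        \<Union> (set Ws) = W \<and>
        (\<forall>i<k. Ws ! i \<noteq> {}) \<and>
        (\<forall>i<k. \<forall>j<k. i \<noteq> j \<longrightarrow> Ws ! i \<inter> Ws ! j = {}) \<and>
        (\<forall>i<k. fan_branch C (Ws ! i) (Bs ! i)) \<and>
        (\<forall>i<k. \<forall>j<k. i \<noteq> j \<longrightarrow>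
           (\<Union> (set (Bs ! i)) - C) \<inter> (\<Union> (set (Bs ! j)) - C) = {}) \<and>
        verts G = C \<union> \<Union> (set (concat Bs)) \<and>
        edges G = complete_edges C \<union> (\<Union>A\<in>set (concat Bs). complete_edges A))"

text \<open>For vertex-disjoint \<open>G\<close> and \<open>H\<close>: the union of \<open>G\<close> and \<open>H\<close> with the vertex \<open>h\<close> of \<open>H\<close>
  identified with the vertex \<open>g\<close> of \<open>G\<close>.\<close>

definition star_glue :: "'a graph \<Rightarrow> 'a \<Rightarrow> 'a graph \<Rightarrow> 'a \<Rightarrow> 'a graph" where
  "star_glue G g H h =
     (let ren = (\<lambda>u. if u = h then g else u)
      in \<lparr>verts = verts G \<union> ren ` verts H, edges = edges G \<union> (\<lambda>e. ren ` e) ` edges H\<rparr>)"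

end

theory Submission
  imports Defs "HOL-Library.Function_Algebras"
begin

text \<open>All graphs in the theorem are chordal, and for a chordal graph the regularity of \<open>S/I\<close> equals
  the induced matching number.  The graded Betti numbers of \<open>S/I\<close> vanish exactly when the Koszul
  homology of \<open>S/I\<close> does: both are compared by dimension shifting along the syzygies of an arbitrary
  resolution, and the same argument bounds the degrees of minimal generators of the syzygies, so that
  finite resolutions exist.  Koszul homology splits by multidegree into the homology of families of
  vertex sets.  Its vanishing beyond the induced matching number follows by splitting along a
  neighbour \<open>v\<close> of a simplicial vertex \<open>w\<close>, because the edge \<open>vw\<close> extends every induced matching
  avoiding the closed neighbourhood of \<open>v\<close>.  On the vertex set of an induced matching the family is
  an iterated join of two-point sets, whose homology is nonzero.

  It remains to compute induced matchings of the glued graph.  The answer depends on whether the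
  leaf \<open>f\<close> can be avoided by a maximum matching of a fan graph.  This is possible if some clique vertex
  lies on no fan, by exchanging \<open>fv\<close> for an edge at that vertex; if every clique vertex lies on a fan,
  a maximum matching avoiding \<open>f\<close> can be moved into the last clique of a fan so as to avoid \<open>v\<close>.\<close>

text \<open>\<open>tor_nonzero\<close> accepts any graded free resolution of finite ranks, so two
  things are needed: all resolutions give the same answer, and one exists. Koszul homology is the
  invariant because it is defined from the module alone; no comparison maps between resolutions and
  no double complex enter. Quotients are pairs of graded submodules of vectors indexed by
  \<open>nat\<close>, so free modules of all ranks, images and kernels share one type. Existence
  rests on the vanishing itself: the first Koszul homology of F/N controls the minimal generators of
  N, and a degree bound for it replaces Noetherianity.

  In the glued graph, an edge can touch matching edges of both sides only through f, and this does
  harm only if both v_1 and v_2 are covered. So the sum of the matching numbers is reached once one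
  side can avoid its v_i or both can avoid f. Deleting a vertex costs at most 1, hence the defect is
  at most 1. Chordality needs care at f too: after the gluing it has two nonadjacent neighbours, so
  each side must offer a simplicial vertex different from f.\<close>

abbreviation lookup where "lookup \<equiv> Poly_Mapping.lookup"
abbreviation keys where "keys \<equiv> Poly_Mapping.keys"
abbreviation single where "single \<equiv> Poly_Mapping.single"

type_synonym ('a, 'k) pieces = "int \<Rightarrow> (nat \<Rightarrow> ('a, 'k) mpoly) set"

section \<open>Homology of families of sets\<close>

locale ordered_vars =
  fixes V :: "'a set" and idx :: "'a \<Rightarrow> nat"
  assumes finite_V: "finite V" and inj_idx: "inj_on idx V"
begin

text \<open>The sign of the face \<open>\<tau>\<close> in the boundary of
  \<open>insert v \<tau>\<close>, with vertices ordered by \<open>idx\<close>.\<close>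

definition eps :: "'a \<Rightarrow> 'a set \<Rightarrow> 'b::comm_ring_1" where
  "eps v \<tau> = (-1) ^ card {u \<in> \<tau>. idx u < idx v}"

lemma eps_insert:
  assumes "finite \<tau>" "u \<notin> \<tau>"
  shows "eps v (insert u \<tau>) = (if idx u < idx v then - eps v \<tau> else (eps v \<tau> :: 'b::comm_ring_1))"
proof (cases "idx u < idx v")
  case True
  then have "{x \<in> insert u \<tau>. idx x < idx v} = insert u {x \<in> \<tau>. idx x < idx v}" by auto
  with assms True show ?thesis by (simp add: eps_def)
next
  case False
  then have "{x \<in> insert u \<tau>. idx x < idx v} = {x \<in> \<tau>. idx x < idx v}" by auto
  with False show ?thesis by (simp add: eps_def)
qed

lemma eps_square [simp]: "eps v \<tau> * eps v \<tau> = 1"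
  by (simp add: eps_def flip: power_mult_distrib)

lemma eps_square_left [simp]: "eps v \<tau> * (eps v \<tau> * x) = x"
  by (simp flip: mult.assoc)

lemma eps_empty [simp]: "eps v {} = 1"
  by (simp add: eps_def)

lemma eps_cases: "eps v \<tau> = 1 \<or> eps v \<tau> = -1"
  unfolding eps_def by (metis neg_one_even_power neg_one_odd_power)

text \<open>Removing two vertices in the two possible orders produces opposite signs; this makes the
  differential square to zero.\<close>

lemma eps_swap:
  assumes "finite \<tau>" "u \<notin> \<tau>" "v \<notin> \<tau>" "u \<in> V" "v \<in> V" "u \<noteq> v"
  shows "eps v \<tau> * eps u (insert v \<tau>) = - (eps u \<tau> * (eps v (insert u \<tau>) :: 'b::comm_ring_1))"
proof -
  have "idx u \<noteq> idx v" using assms inj_idx by (auto simp: inj_on_def)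
  then show ?thesis using assms by (auto simp: eps_insert)
qed

text \<open>The same sign rule arranged for homotopies, where one vertex is added while the
  differential removes another.\<close>

lemma eps_swap':
  assumes "finite \<tau>" "u \<notin> \<tau>" "v \<notin> \<tau>" "u \<in> V" "v \<in> V" "u \<noteq> v"
  shows "eps u (insert v \<tau>) * eps v (insert u \<tau>) = - (eps v \<tau> * (eps u \<tau> :: 'b::comm_ring_1))"
proof -
  have "idx u \<noteq> idx v" using assms inj_idx by (auto simp: inj_on_def)
  then show ?thesis using assms by (auto simp: eps_insert)
qed

text \<open>The Koszul differential with respect to multiplication by the \<open>w v\<close>; the boundary map of the
  simplex on \<open>V\<close> is the case \<open>w = 1\<close>.\<close>

definition bd :: "('a \<Rightarrow> 'b::comm_ring_1) \<Rightarrow> ('a set \<Rightarrow> 'b) \<Rightarrow> 'a set \<Rightarrow> 'b" where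
  "bd w c \<tau> = (\<Sum>v\<in>V - \<tau>. eps v \<tau> * w v * c (insert v \<tau>))"

lemma bd_bd:
  assumes "finite \<tau>"
  shows "bd w (bd w c) \<tau> = 0"
proof -
  define F where "F = (\<lambda>(v, u). eps v \<tau> * w v * (eps u (insert v \<tau>) * w u * c (insert u (insert v \<tau>))))"
  \<comment> \<open>Pairs of distinct vertices outside \<open>\<tau>\<close> are split by their
    order; exchanging the entries carries \<open>Q\<close> to \<open>P\<close> and reverses the sign
    of every term.\<close>
  define P where "P = {(v, u). v \<in> V - \<tau> \<and> u \<in> V - \<tau> \<and> idx v < idx u}"
  define Q where "Q = {(v, u). v \<in> V - \<tau> \<and> u \<in> V - \<tau> \<and> idx u < idx v}"
  have fin: "finite P" "finite Q"
    by (rule finite_subset[of _ "V \<times> V"]; use finite_V in \<open>auto simp: P_def Q_def\<close>)+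
  have "bd w (bd w c) \<tau> = (\<Sum>v\<in>V - \<tau>. \<Sum>u\<in>V - insert v \<tau>. F (v, u))"
    by (simp add: bd_def F_def sum_distrib_left)
  also have "\<dots> = sum F (SIGMA v:V - \<tau>. V - insert v \<tau>)"
    by (subst sum.Sigma) (use finite_V in auto)
  also have "(SIGMA v:V - \<tau>. V - insert v \<tau>) = P \<union> Q"
    using inj_idx by (fastforce simp: P_def Q_def inj_on_def)
  also have "sum F (P \<union> Q) = sum F P + sum F Q"
    by (rule sum.union_disjoint) (use fin in \<open>auto simp: P_def Q_def\<close>)
  also have "sum F Q = sum (F \<circ> prod.swap) P"
    unfolding comp_def
    by (rule sum.reindex_bij_betw[symmetric], rule bij_betwI[where g = prod.swap])
      (auto simp: P_def Q_def)
  also have "\<dots> = (\<Sum>p\<in>P. - F p)"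
  proof (rule sum.cong)
    fix p assume "p \<in> P"
    then obtain v u where p: "p = (v, u)" "v \<in> V" "v \<notin> \<tau>" "u \<in> V" "u \<notin> \<tau>" "v \<noteq> u" by (auto simp: P_def)
    have "(F \<circ> prod.swap) p = (eps u \<tau> * eps v (insert u \<tau>)) * (w v * w u * c (insert u (insert v \<tau>)))"
      by (simp add: F_def p insert_commute algebra_simps)
    also have "\<dots> = - (eps v \<tau> * eps u (insert v \<tau>)) * (w v * w u * c (insert u (insert v \<tau>)))"
      by (subst eps_swap) (use p assms in auto)
    also have "\<dots> = - F p" by (simp add: F_def p algebra_simps)
    finally show "(F \<circ> prod.swap) p = - F p" .
  qed simp
  finally show ?thesis by (simp add: sum_negf)
qed

lemma bd_diff: "bd w (\<lambda>\<sigma>. c \<sigma> - d \<sigma>) \<tau> = bd w c \<tau> - bd w d \<tau>"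
  by (simp add: bd_def algebra_simps sum_subtractf)

lemma bd_add: "bd w (\<lambda>\<sigma>. c \<sigma> + d \<sigma>) \<tau> = bd w c \<tau> + bd w d \<tau>"
  by (simp add: bd_def algebra_simps sum.distrib)

lemma bd_zero [simp]: "bd w (\<lambda>\<sigma>. 0) \<tau> = 0"
  by (simp add: bd_def)

text \<open>Vanishing of the \<open>i\<close>-th homology of a locally closed family \<open>U\<close> of subsets of \<open>V\<close>, with
  coefficients in \<open>'k\<close>.\<close>

definition chains :: "'a set set \<Rightarrow> nat \<Rightarrow> ('a set \<Rightarrow> 'k::zero) \<Rightarrow> bool" where
  "chains U i g \<longleftrightarrow> (\<forall>\<sigma>. g \<sigma> \<noteq> 0 \<longrightarrow> \<sigma> \<in> U \<and> card \<sigma> = i)"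

definition acyclic_at :: "'k::field itself \<Rightarrow> 'a set set \<Rightarrow> nat \<Rightarrow> bool" where
  "acyclic_at K U i \<longleftrightarrow> (\<forall>g::'a set \<Rightarrow> 'k. chains U i g \<longrightarrow> (\<forall>\<tau>\<in>U. bd (\<lambda>_. 1) g \<tau> = 0) \<longrightarrow>
     (\<exists>h. chains U (Suc i) h \<and> (\<forall>\<tau>\<in>U. bd (\<lambda>_. 1) h \<tau> = g \<tau>)))"

definition loc_closed :: "'a set set \<Rightarrow> bool" where
  "loc_closed U \<longleftrightarrow> U \<subseteq> Pow V \<and> (\<forall>\<sigma>\<in>U. \<forall>\<rho>\<in>U. \<forall>\<tau>. \<sigma> \<subseteq> \<tau> \<longrightarrow> \<tau> \<subseteq> \<rho> \<longrightarrow> \<tau> \<in> U)"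

lemma chainsD: "chains U i g \<Longrightarrow> \<sigma> \<notin> U \<Longrightarrow> g \<sigma> = 0" "chains U i g \<Longrightarrow> card \<sigma> \<noteq> i \<Longrightarrow> g \<sigma> = 0"
  by (auto simp: chains_def)

text \<open>Toggling \<open>t\<close> pairs the members of \<open>U\<close>, so adjoining
  \<open>t\<close> is a contracting homotopy: a cycle is the boundary of its cone with apex
  \<open>t\<close>.\<close>

lemma acyclic_at_cone:
  assumes U: "U \<subseteq> Pow V" and t: "t \<in> V"
    and tog: "\<And>\<sigma>. t \<notin> \<sigma> \<Longrightarrow> insert t \<sigma> \<in> U \<longleftrightarrow> \<sigma> \<in> U"
  shows "acyclic_at (K :: 'k::field itself) U i"
  unfolding acyclic_at_def
proof (intro allI impI)
  fix g :: "'a set \<Rightarrow> 'k" assume g: "chains U i g" and cyc: "\<forall>\<tau>\<in>U. bd (\<lambda>_. 1) g \<tau> = 0"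
  define h where "h \<sigma> = (if t \<in> \<sigma> \<and> \<sigma> \<in> U then eps t (\<sigma> - {t}) * g (\<sigma> - {t}) else 0)" for \<sigma>
  have finU: "finite \<sigma>" if "\<sigma> \<in> U" for \<sigma> using U that finite_V by (auto intro: finite_subset)
  have "chains U (Suc i) h"
  proof (unfold chains_def, intro allI impI)
    fix \<sigma> assume "h \<sigma> \<noteq> 0"
    then have *: "t \<in> \<sigma>" "\<sigma> \<in> U" "g (\<sigma> - {t}) \<noteq> 0" by (auto simp: h_def split: if_splits)
    then have "card (\<sigma> - {t}) = i" using g by (auto simp: chains_def)
    with * finU[of \<sigma>] show "\<sigma> \<in> U \<and> card \<sigma> = Suc i"
      by (metis card_Suc_Diff1)
  qed
  moreover have "bd (\<lambda>_. 1) h \<tau> = g \<tau>" if \<tau>: "\<tau> \<in> U" for \<tau>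
  proof (cases "t \<in> \<tau>")
    case False
    have "bd (\<lambda>_. 1) h \<tau> = (\<Sum>v\<in>V - \<tau>. if v = t then g \<tau> else 0)"
      unfolding bd_def by (rule sum.cong) (use False \<tau> tog in \<open>auto simp: h_def\<close>)
    then show ?thesis using False t finite_V by simp
  next
    case True
    define \<rho> where "\<rho> = \<tau> - {t}"
    have \<rho>: "\<tau> = insert t \<rho>" "t \<notin> \<rho>" "\<rho> \<in> U" "finite \<rho>"
      using True tog[of "\<tau> - {t}"] \<tau> finU[OF \<tau>] by (auto simp: \<rho>_def insert_absorb)
    have Vr: "V - \<rho> = insert t (V - \<tau>)" "t \<notin> V - \<tau>" using \<rho> t by auto
    have "bd (\<lambda>_. 1) h \<tau> = (\<Sum>v\<in>V - \<tau>. - (eps t \<rho> * (eps v \<rho> * g (insert v \<rho>))))"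
      unfolding bd_def
    proof (rule sum.cong)
      fix v assume v: "v \<in> V - \<tau>"
      have e: "insert v \<tau> - {t} = insert v \<rho>" using v \<rho> by auto
      have "h (insert v \<tau>) = eps t (insert v \<rho>) * g (insert v \<rho>)"
      proof (cases "insert v \<tau> \<in> U")
        case True
        then show ?thesis using \<open>t \<in> \<tau>\<close> by (simp add: h_def e)
      next
        case False
        have "insert v \<rho> \<notin> U" using tog[of "insert v \<rho>"] False v \<rho> by (auto simp: insert_commute)
        then show ?thesis using False g by (simp add: h_def chains_def) blast
      qed
      then have "eps v \<tau> * 1 * h (insert v \<tau>) = (eps v (insert t \<rho>) * eps t (insert v \<rho>)) * g (insert v \<rho>)"
        by (simp add: \<rho>(1))
      also have "\<dots> = - (eps t \<rho> * eps v \<rho>) * g (insert v \<rho>)"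
        by (subst eps_swap') (use \<rho> v t in auto)
      finally show "eps v \<tau> * 1 * h (insert v \<tau>) = - (eps t \<rho> * (eps v \<rho> * g (insert v \<rho>)))"
        by (simp add: mult.assoc)
    qed simp
    also have "\<dots> = - (eps t \<rho> * (\<Sum>v\<in>V - \<tau>. eps v \<rho> * g (insert v \<rho>)))"
      by (simp add: sum_negf sum_distrib_left)
    \<comment> \<open>This sum is the boundary of \<open>g\<close> at \<open>\<rho>\<close> without
      the term of \<open>t\<close>. That boundary vanishes because \<open>\<rho>\<close> is also a
      member, which leaves exactly \<open>g \<tau>\<close>.\<close>
    also have "(\<Sum>v\<in>V - \<tau>. eps v \<rho> * g (insert v \<rho>)) = bd (\<lambda>_. 1) g \<rho> - eps t \<rho> * g \<tau>"
      unfolding bd_def Vr(1) by (subst sum.insert) (use Vr(2) finite_V in \<open>simp_all flip: \<rho>(1)\<close>)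
    also have "bd (\<lambda>_. 1) g \<rho> = 0" using cyc \<rho> by auto
    finally show ?thesis by simp
  qed
  ultimately show "\<exists>h. chains U (Suc i) h \<and> (\<forall>\<tau>\<in>U. bd (\<lambda>_. 1) h \<tau> = g \<tau>)" by blast
qed

text \<open>Members without \<open>v\<close> span a subcomplex and members with \<open>v\<close> the
  quotient, so this is a piece of a long exact sequence, done by hand: bound the part of the cycle
  on members containing \<open>v\<close>, subtract, and bound the remainder, which lives on members
  avoiding \<open>v\<close>.\<close>

lemma acyclic_at_split:
  assumes U: "loc_closed U"
    and out: "acyclic_at (K :: 'k::field itself) {\<sigma> \<in> U. v \<notin> \<sigma>} i" and ins: "acyclic_at K {\<sigma> \<in> U. v \<in> \<sigma>} i"
  shows "acyclic_at K U i"
  unfolding acyclic_at_def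
proof (intro allI impI)
  fix g :: "'a set \<Rightarrow> 'k" assume g: "chains U i g" and cyc: "\<forall>\<tau>\<in>U. bd (\<lambda>_. 1) g \<tau> = 0"
  let ?U1 = "{\<sigma> \<in> U. v \<notin> \<sigma>}" and ?U2 = "{\<sigma> \<in> U. v \<in> \<sigma>}"
  define g2 where "g2 \<sigma> = (if v \<in> \<sigma> then g \<sigma> else 0)" for \<sigma>
  have "chains ?U2 i g2" using g by (auto simp: chains_def g2_def)
  moreover have "\<forall>\<tau>\<in>?U2. bd (\<lambda>_. 1) g2 \<tau> = 0" using cyc by (simp add: bd_def g2_def)
  ultimately obtain h2 where h2: "chains ?U2 (Suc i) h2" "\<forall>\<tau>\<in>?U2. bd (\<lambda>_. 1) h2 \<tau> = g2 \<tau>"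
    using ins unfolding acyclic_at_def by blast
  define r where "r \<sigma> = (if \<sigma> \<in> U then bd (\<lambda>_. 1) h2 \<sigma> else 0)" for \<sigma>
  define g1 where "g1 \<sigma> = g \<sigma> - r \<sigma>" for \<sigma>
  have finU: "finite \<sigma>" if "\<sigma> \<in> U" for \<sigma>
    using U that finite_V by (auto simp: loc_closed_def intro: finite_subset)
  have r_chain: "chains U i r"
  proof (unfold chains_def, intro allI impI)
    fix \<sigma> assume nz: "r \<sigma> \<noteq> 0"
    then have s: "\<sigma> \<in> U" "bd (\<lambda>_. 1) h2 \<sigma> \<noteq> 0" by (auto simp: r_def split: if_splits)
    then obtain u where u: "u \<in> V - \<sigma>" "h2 (insert u \<sigma>) \<noteq> 0"
      unfolding bd_def by (metis (no_types, lifting) mult_zero_right sum.neutral)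
    then have "card (insert u \<sigma>) = Suc i" using h2 by (auto simp: chains_def)
    with u s finU[of \<sigma>] show "\<sigma> \<in> U \<and> card \<sigma> = i" by simp
  qed
  have "chains ?U1 i g1"
  proof (unfold chains_def, intro allI impI)
    fix \<sigma> assume nz: "g1 \<sigma> \<noteq> 0"
    have "\<sigma> \<in> U \<and> card \<sigma> = i"
    proof (rule ccontr)
      assume "\<not> ?thesis"
      then have "g \<sigma> = 0" "r \<sigma> = 0" using g r_chain by (auto simp: chains_def)
      with nz show False by (simp add: g1_def)
    qed
    moreover have "v \<notin> \<sigma>"
    proof
      assume "v \<in> \<sigma>"
      then have "r \<sigma> = g \<sigma>" using calculation h2 by (auto simp: r_def g2_def)
      with nz show False by (simp add: g1_def)
    qed
    ultimately show "\<sigma> \<in> ?U1 \<and> card \<sigma> = i" by simp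
  qed
  moreover have "bd (\<lambda>_. 1) g1 \<tau> = 0" if \<tau>: "\<tau> \<in> U" for \<tau>
  proof -
    have "bd (\<lambda>_. 1) r \<tau> = bd (\<lambda>_. 1) (bd (\<lambda>_. 1) h2) \<tau>"
      unfolding bd_def[of _ _ \<tau>]
    proof (rule sum.cong)
      fix u assume u: "u \<in> V - \<tau>"
      have "r (insert u \<tau>) = bd (\<lambda>_. 1) h2 (insert u \<tau>)"
      proof (rule ccontr)
        assume ne: "r (insert u \<tau>) \<noteq> bd (\<lambda>_. 1) h2 (insert u \<tau>)"
        then have nU: "insert u \<tau> \<notin> U" by (auto simp: r_def)
        with ne have "bd (\<lambda>_. 1) h2 (insert u \<tau>) \<noteq> 0" by (auto simp: r_def)
        then obtain w where "h2 (insert w (insert u \<tau>)) \<noteq> 0"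
          unfolding bd_def by (metis (no_types, lifting) mult_zero_right sum.neutral)
        \<comment> \<open>Local closedness: \<open>insert u \<tau>\<close> lies between
          \<open>\<tau>\<close> and this member, so cutting \<open>r\<close> down to
          \<open>U\<close> loses nothing in its boundary.\<close>
        then have "insert w (insert u \<tau>) \<in> U" using h2 by (auto simp: chains_def)
        then show False using U \<tau> nU unfolding loc_closed_def by (meson subset_insertI)
      qed
      then show "eps u \<tau> * 1 * r (insert u \<tau>) = eps u \<tau> * 1 * bd (\<lambda>_. 1) h2 (insert u \<tau>)" by simp
    qed simp
    also have "\<dots> = 0" by (rule bd_bd) (use \<tau> finU in auto)
    finally show ?thesis using cyc \<tau> by (simp add: g1_def[abs_def] bd_diff)
  qed
  ultimately obtain h1 where h1: "chains ?U1 (Suc i) h1" "\<forall>\<tau>\<in>?U1. bd (\<lambda>_. 1) h1 \<tau> = g1 \<tau>"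
    using out unfolding acyclic_at_def by (metis (no_types, lifting) mem_Collect_eq)
  have "chains U (Suc i) (\<lambda>\<sigma>. h1 \<sigma> + h2 \<sigma>)"
    using h1(1) h2(1) unfolding chains_def by (metis (mono_tags, lifting) add.left_neutral mem_Collect_eq)
  moreover have "bd (\<lambda>_. 1) (\<lambda>\<sigma>. h1 \<sigma> + h2 \<sigma>) \<tau> = g \<tau>" if \<tau>: "\<tau> \<in> U" for \<tau>
  proof (cases "v \<in> \<tau>")
    case True
    have "h1 (insert u \<tau>) = 0" for u using h1(1) True by (auto simp: chains_def)
    then have "bd (\<lambda>_. 1) h1 \<tau> = 0" by (simp add: bd_def)
    then show ?thesis using True h2 \<tau> by (simp add: bd_add g2_def)
  next
    case False
    then show ?thesis using h1 \<tau> by (simp add: bd_add g1_def r_def)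
  qed
  ultimately show "\<exists>h. chains U (Suc i) h \<and> (\<forall>\<tau>\<in>U. bd (\<lambda>_. 1) h \<tau> = g \<tau>)" by blast
qed

end

section \<open>Families of vertex sets attached to a graph\<close>

definition indep :: "'a set set \<Rightarrow> 'a set \<Rightarrow> bool" where
  "indep E S \<longleftrightarrow> (\<forall>e\<in>E. \<not> e \<subseteq> S)"

text \<open>Applied with \<open>d = e\<close>, the condition makes the members of \<open>M\<close> pairwise disjoint.\<close>

definition induced_matching :: "'a set set \<Rightarrow> 'a set set \<Rightarrow> bool" where
  "induced_matching E M \<longleftrightarrow> M \<subseteq> E \<and>
     (\<forall>d\<in>E. \<forall>e\<in>M. \<forall>e'\<in>M. d \<inter> e \<noteq> {} \<longrightarrow> d \<inter> e' \<noteq> {} \<longrightarrow> e = e')"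

definition simplicial :: "'a set set \<Rightarrow> 'a set \<Rightarrow> 'a \<Rightarrow> bool" where
  "simplicial E A w \<longleftrightarrow>
     (\<forall>x\<in>A. \<forall>y\<in>A. {w, x} \<in> E \<longrightarrow> {w, y} \<in> E \<longrightarrow> x \<noteq> y \<longrightarrow> {x, y} \<in> E)"

context ordered_vars
begin

text \<open>For squarefree \<open>x\<^sup>A\<close> and \<open>P = {}\<close> these are the sets \<open>\<sigma>\<close> with \<open>x\<^bsup>A - \<sigma>\<^esup>\<close> nonzero modulo the edge
  ideal; \<open>P\<close> collects the vertices removed from \<open>A\<close> in the course of an induction.\<close>

definition fam :: "'a set set \<Rightarrow> 'a set \<Rightarrow> 'a set \<Rightarrow> 'a set set" where
  "fam E P A = {\<sigma>. P \<subseteq> \<sigma> \<and> \<sigma> \<subseteq> P \<union> A \<and> indep E (A - \<sigma>)}"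

lemma loc_closed_fam: "P \<union> A \<subseteq> V \<Longrightarrow> loc_closed (fam E P A)"
  unfolding loc_closed_def
proof (intro conjI ballI allI impI)
  fix \<sigma> \<rho> \<tau> assume *: "\<sigma> \<in> fam E P A" "\<rho> \<in> fam E P A" "\<sigma> \<subseteq> \<tau>" "\<tau> \<subseteq> \<rho>"
  then have "A - \<tau> \<subseteq> A - \<sigma>" by auto
  with * have "indep E (A - \<tau>)" unfolding fam_def indep_def by (metis (mono_tags, lifting) mem_Collect_eq order_trans)
  with * show "\<tau> \<in> fam E P A" by (auto simp: fam_def)
qed (auto simp: fam_def)

text \<open>Induction on \<open>card A\<close>, splitting at a neighbour \<open>v\<close> of a
  simplicial vertex \<open>w\<close>. The forced set \<open>P\<close> keeps the count. For members
  containing \<open>v\<close>, the vertex moves from \<open>A\<close> to \<open>P\<close> and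
  \<open>card A + card P\<close> is unchanged. Members avoiding \<open>v\<close> must contain all
  neighbours of \<open>v\<close>; these move to \<open>P\<close> while \<open>v\<close> disappears.
  The sum then drops by 1, but so does the matching bound \<open>n\<close>, and the inequality
  persists.\<close>

lemma acyclic_fam:
  assumes "\<And>e. e \<in> E \<Longrightarrow> card e = 2" "P \<inter> A = {}" "P \<union> A \<subseteq> V"
    and "\<And>B. B \<subseteq> A \<Longrightarrow> B \<noteq> {} \<Longrightarrow> \<exists>w\<in>B. simplicial E B w"
    and "\<And>M. induced_matching E M \<Longrightarrow> \<Union> M \<subseteq> A \<Longrightarrow> card M \<le> n"
    and "i + n < card A + card P"
  shows "acyclic_at (K :: 'k::field itself) (fam E P A) i"
  using assms
proof (induction "card A" arbitrary: A P n rule: less_induct)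
  case less
  note edge = less.prems(1) and PA = less.prems(2,3) and simp_ex = less.prems(4)
    and bound = less.prems(5) and deg = less.prems(6)
  have finA: "finite A" "finite P" using PA finite_V by (auto intro: finite_subset)
  show ?case
  proof (cases "A = {}")
    case True
    \<comment> \<open>The only possible member is \<open>P\<close>, and \<open>i < card P\<close>,
      so degree \<open>i\<close> carries no nonzero chain.\<close>
    have "g = (\<lambda>_. 0)" if "chains (fam E P A) i g" for g :: "'a set \<Rightarrow> 'k"
      using that deg True by (force simp: chains_def fam_def fun_eq_iff)
    then show ?thesis by (auto simp: acyclic_at_def chains_def intro!: exI[of _ "\<lambda>_. 0"])
  next
    case False
    then obtain w where w: "w \<in> A" "simplicial E A w" using simp_ex[of A] by auto
    show ?thesis
    proof (cases "\<exists>v\<in>A. {w, v} \<in> E")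
      case False
      \<comment> \<open>A vertex isolated in \<open>A\<close> does not affect independence, so the
        family is a cone with apex \<open>w\<close>.\<close>
      have iso: "w \<notin> e" if e: "e \<in> E" "e \<subseteq> A" for e
      proof
        assume "w \<in> e"
        moreover obtain x y where "e = {x, y}" "x \<noteq> y" using edge[OF e(1)] by (auto simp: card_2_iff)
        ultimately show False using e False by (auto simp: insert_commute)
      qed
      show ?thesis
      proof (rule acyclic_at_cone[where t = w])
        fix \<sigma> assume "w \<notin> \<sigma>"
        have "indep E (A - insert w \<sigma>) \<longleftrightarrow> indep E (A - \<sigma>)"
          unfolding indep_def using iso by blast
        then show "insert w \<sigma> \<in> fam E P A \<longleftrightarrow> \<sigma> \<in> fam E P A"
          using w PA by (auto simp: fam_def)
      qed (use w PA in \<open>auto simp: fam_def\<close>)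
    next
      case True
      then obtain v where v: "v \<in> A" "{w, v} \<in> E" by auto
      then have wv: "w \<noteq> v" using edge by fastforce
      define N where "N = {u \<in> A. {u, v} \<in> E}"
      have vN: "v \<notin> N" using edge by (fastforce simp: N_def)
      have NA: "N \<subseteq> A" "finite N" using finA by (auto simp: N_def)
      have wN: "w \<in> N" using w v by (simp add: N_def)
      have in_eq: "{\<sigma> \<in> fam E P A. v \<in> \<sigma>} = fam E (insert v P) (A - {v})"
      proof -
        have "A - {v} - \<sigma> = A - \<sigma>" if "v \<in> \<sigma>" for \<sigma> using that by auto
        then show ?thesis using v by (auto simp: fam_def)
      qed
      have out_eq: "{\<sigma> \<in> fam E P A. v \<notin> \<sigma>} = fam E (P \<union> N) (A - insert v N)"
      proof (rule Set.set_eqI, rule iffI)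
        fix \<sigma> assume "\<sigma> \<in> {\<sigma> \<in> fam E P A. v \<notin> \<sigma>}"
        then have s: "P \<subseteq> \<sigma>" "\<sigma> \<subseteq> P \<union> A" "indep E (A - \<sigma>)" "v \<notin> \<sigma>" by (auto simp: fam_def)
        have "N \<subseteq> \<sigma>"
        proof
          fix u assume "u \<in> N"
          then have u: "u \<in> A" "{u, v} \<in> E" by (auto simp: N_def)
          then have "\<not> {u, v} \<subseteq> A - \<sigma>" using s(3) by (auto simp: indep_def)
          with u v s(4) show "u \<in> \<sigma>" by auto
        qed
        moreover have "indep E (A - insert v N - \<sigma>)" using s unfolding indep_def by blast
        ultimately show "\<sigma> \<in> fam E (P \<union> N) (A - insert v N)" using s by (auto simp: fam_def)
      next
        fix \<sigma> assume "\<sigma> \<in> fam E (P \<union> N) (A - insert v N)"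
        then have s: "P \<union> N \<subseteq> \<sigma>" "\<sigma> \<subseteq> P \<union> N \<union> (A - insert v N)" "indep E (A - insert v N - \<sigma>)"
          by (auto simp: fam_def)
        have vs: "v \<notin> \<sigma>" using s v vN PA by blast
        have "\<not> e \<subseteq> A - \<sigma>" if e: "e \<in> E" for e
        proof
          assume sub: "e \<subseteq> A - \<sigma>"
          show False
          proof (cases "v \<in> e")
            case True
            then obtain u where "e = {u, v}" using edge[OF e] by (auto simp: card_2_iff)
            then have "u \<in> N" using sub e by (auto simp: N_def)
            then show False using sub s \<open>e = {u, v}\<close> by auto
          next
            case False
            then have "e \<subseteq> A - insert v N - \<sigma>" using sub s by auto
            then show False using s e by (auto simp: indep_def)
          qed
        qed
        then show "\<sigma> \<in> {\<sigma> \<in> fam E P A. v \<notin> \<sigma>}" using s vs NA by (auto simp: fam_def indep_def)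
      qed
      \<comment> \<open>An edge from \<open>w\<close> to a matched vertex \<open>x\<close> would
        make \<open>x\<close> adjacent to \<open>v\<close>, since \<open>w\<close> is simplicial in
        \<open>A\<close>; therefore \<open>{w, v}\<close> can be adjoined.\<close>
      have bound': "Suc (card M) \<le> n" if M: "induced_matching E M" "\<Union> M \<subseteq> A - insert v N" for M
      proof -
        have "d \<inter> e = {}" if d: "d \<in> E" "e \<in> M" "d \<inter> {w, v} \<noteq> {}" for d e
        proof (rule ccontr)
          assume "d \<inter> e \<noteq> {}"
          then obtain x where x: "x \<in> d" "x \<in> e" by auto
          then have xA: "x \<in> A" "x \<notin> N" "x \<noteq> v" using M(2) d by auto
          obtain y where y: "y \<in> d" "y \<in> {w, v}" using d by auto
          have "x \<noteq> y" using xA y wN by auto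
          then have dxy: "d = {y, x}" using x y edge[OF d(1)] by (auto simp: card_2_iff)
          show False
          proof (cases "y = v")
            case True
            then show False using dxy d xA by (auto simp: N_def insert_commute)
          next
            case False
            then have "{w, x} \<in> E" using y dxy d by auto
            then have "{x, v} \<in> E" using w v xA unfolding simplicial_def by blast
            then show False using xA by (auto simp: N_def)
          qed
        qed
        then have "induced_matching E (insert {w, v} M)"
          using M(1) v unfolding induced_matching_def by blast
        then have "card (insert {w, v} M) \<le> n" using M(2) w v by (intro bound) auto
        moreover have "{w, v} \<notin> M" using M(2) by auto
        moreover have "finite M"
          by (rule finite_subset[of _ "Pow A"]) (use M(2) finA in auto)
        ultimately show ?thesis by simp
      qed
      \<comment> \<open>Already the empty matching extends, so \<open>n - 1\<close> below is a true
        subtraction.\<close>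
      have n: "n \<ge> 1" using bound'[of "{}"] by (auto simp: induced_matching_def)
      have card1: "card (A - {v}) + card (insert v P) = card A + card P"
      proof -
        have "v \<notin> P" using v PA by auto
        moreover have "card (A - {v}) + 1 = card A" using v finA by (metis Suc_eq_plus1 card_Suc_Diff1)
        ultimately show ?thesis using finA by simp
      qed
      have "card (insert v N) \<le> card A" using NA v finA by (intro card_mono) auto
      moreover have "card (P \<union> N) = card P + card N"
        using finA NA PA by (intro card_Un_disjoint) auto
      ultimately have card2: "Suc (card (A - insert v N) + card (P \<union> N)) = card A + card P"
        using NA vN finA v by (subst card_Diff_subset) auto
      have "acyclic_at K (fam E (insert v P) (A - {v})) i"
      proof (rule less.hyps)
        show "card (A - {v}) < card A" using v finA by (intro psubset_card_mono) auto
        show "\<exists>w\<in>B. simplicial E B w" if "B \<subseteq> A - {v}" "B \<noteq> {}" for B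
          using simp_ex[of B] that by auto
        show "card M \<le> n" if "induced_matching E M" "\<Union> M \<subseteq> A - {v}" for M
          using bound[of M] that by auto
        show "i + n < card (A - {v}) + card (insert v P)" using deg card1 by simp
      qed (use edge PA v in auto)
      moreover have "acyclic_at K (fam E (P \<union> N) (A - insert v N)) i"
      proof (rule less.hyps)
        show "card (A - insert v N) < card A" using v finA by (intro psubset_card_mono) auto
        show "\<exists>w\<in>B. simplicial E B w" if "B \<subseteq> A - insert v N" "B \<noteq> {}" for B
          using simp_ex[of B] that by auto
        show "card M \<le> n - 1" if "induced_matching E M" "\<Union> M \<subseteq> A - insert v N" for M
          using bound'[OF that] by auto
        show "i + (n - 1) < card (A - insert v N) + card (P \<union> N)" using deg card2 n by simp
      qed (use edge PA v NA in auto)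
      ultimately show ?thesis
        using acyclic_at_split[where U = "fam E P A" and K = K and v = v and i = i] loc_closed_fam[OF PA(2)]
        by (simp only: in_eq out_eq)
    qed
  qed
qed

lemma bd_uminus: "bd w (\<lambda>\<sigma>. - c \<sigma>) \<tau> = - bd w c \<tau>"
  by (simp add: bd_def sum_negf)

text \<open>Separates the coefficient on the set containing both \<open>a\<close> and
  \<open>b\<close> from the rest, which up to sign is the boundary of the link of \<open>a\<close>
  in \<open>h\<close>, restricted to sets free of \<open>a\<close> and \<open>b\<close>.\<close>

lemma bd_insert:
  assumes "finite \<tau>" "a \<notin> \<tau>" "b \<notin> \<tau>" "a \<noteq> b" "a \<in> V" "b \<in> V"
  shows "bd (\<lambda>_. 1) h (insert a \<tau>) = eps b (insert a \<tau>) * h (insert b (insert a \<tau>))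
    - eps a \<tau> * bd (\<lambda>_. 1) (\<lambda>\<sigma>. if a \<in> \<sigma> \<or> b \<in> \<sigma> then 0 else eps a \<sigma> * h (insert a \<sigma>)) \<tau>"
    (is "_ = _ - _ * bd _ ?h _")
proof -
  define R where "R = V - insert a (insert b \<tau>)"
  have R: "finite R" "V - insert a \<tau> = insert b R" "b \<notin> R" "V - \<tau> = insert a (insert b R)" "a \<notin> insert b R"
    using assms finite_V by (auto simp: R_def)
  have "bd (\<lambda>_. 1) ?h \<tau> = (\<Sum>u\<in>R. eps u \<tau> * (eps a (insert u \<tau>) * h (insert a (insert u \<tau>))))"
  proof -
    have "(\<Sum>u\<in>R. eps u \<tau> * ?h (insert u \<tau>)) = (\<Sum>u\<in>R. eps u \<tau> * (eps a (insert u \<tau>) * h (insert a (insert u \<tau>))))"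
      by (rule sum.cong) (use assms in \<open>auto simp: R_def\<close>)
    then show ?thesis by (simp add: bd_def R(4) R(1) R(3) R(5)[simplified])
  qed
  then have "eps a \<tau> * bd (\<lambda>_. 1) ?h \<tau> =
      (\<Sum>u\<in>R. (eps a \<tau> * eps u \<tau>) * (eps a (insert u \<tau>) * h (insert a (insert u \<tau>))))"
    by (simp add: sum_distrib_left mult.assoc)
  also have "\<dots> = (\<Sum>u\<in>R. - (eps u (insert a \<tau>) * h (insert u (insert a \<tau>))))"
  proof (rule sum.cong)
    fix u assume u: "u \<in> R"
    have "eps a \<tau> * eps u \<tau> = - (eps u (insert a \<tau>) * (eps a (insert u \<tau>) :: 'b))"
      using eps_swap'[of \<tau> u a, where ?'b = 'b] u assms by (auto simp: R_def)
    then show "(eps a \<tau> * eps u \<tau>) * (eps a (insert u \<tau>) * h (insert a (insert u \<tau>))) =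
        - (eps u (insert a \<tau>) * h (insert u (insert a \<tau>)))"
      by (simp add: insert_commute mult.assoc)
  qed simp
  also have "\<dots> = eps b (insert a \<tau>) * h (insert b (insert a \<tau>)) - bd (\<lambda>_. 1) h (insert a \<tau>)"
    using R by (simp add: bd_def sum_negf)
  finally show ?thesis by (simp add: algebra_simps)
qed

text \<open>An isolated edge forces each member to contain \<open>a\<close> or \<open>b\<close>, so
  members are unions of a member of the small family with \<open>{a}\<close>, \<open>{b}\<close> or
  \<open>{a, b}\<close>. These three sets have homology in degree 1 only, hence homology shifts by
  one. To descend to the small family: join a cycle with \<open>a\<close>, bound it, and take links
  in the bounding chain.\<close>

lemma acyclic_fam_remove_edge:
  assumes ab: "a \<in> A" "b \<in> A" "a \<noteq> b" "{a, b} \<in> E"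
    and iso: "\<And>e. e \<in> E \<Longrightarrow> e \<subseteq> A \<Longrightarrow> e = {a, b} \<or> e \<inter> {a, b} = {}"
    and PA: "P \<inter> A = {}" "P \<union> A \<subseteq> V"
    and ac: "acyclic_at (K :: 'k::field itself) (fam E P A) (Suc i)"
  shows "acyclic_at K (fam E P (A - {a, b})) i"
  unfolding acyclic_at_def
proof (intro allI impI)
  let ?A = "A - {a, b}"
  let ?U = "fam E P A" and ?U' = "fam E P ?A"
  fix g' :: "'a set \<Rightarrow> 'k" assume g': "chains ?U' i g'" and cyc: "\<forall>\<tau>\<in>?U'. bd (\<lambda>_. 1) g' \<tau> = 0"
  have finU: "finite \<sigma>" if "\<sigma> \<in> ?U" for \<sigma> using PA that finite_V by (auto simp: fam_def intro: finite_subset)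
  have finU': "finite \<sigma>" if "\<sigma> \<in> ?U'" for \<sigma> using PA that finite_V by (auto simp: fam_def intro: finite_subset)
  have nU': "a \<notin> \<sigma>" "b \<notin> \<sigma>" if "\<sigma> \<in> ?U'" for \<sigma> using that ab PA by (auto simp: fam_def)
  have indep_eq: "indep E (A - \<sigma>) \<longleftrightarrow> indep E (?A - \<sigma>)" if "a \<in> \<sigma> \<or> b \<in> \<sigma>" for \<sigma>
  proof
    assume *: "indep E (?A - \<sigma>)"
    show "indep E (A - \<sigma>)"
      unfolding indep_def
    proof (intro ballI notI)
      fix e assume e: "e \<in> E" "e \<subseteq> A - \<sigma>"
      then have "e \<subseteq> ?A - \<sigma>" using iso[of e] that by auto
      then show False using * e by (auto simp: indep_def)
    qed
  qed (auto simp: indep_def)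
  have mem_a: "insert a \<sigma> \<in> ?U \<longleftrightarrow> \<sigma> \<in> ?U'" and mem_b: "insert b \<sigma> \<in> ?U \<longleftrightarrow> \<sigma> \<in> ?U'"
    if "a \<notin> \<sigma>" "b \<notin> \<sigma>" for \<sigma>
  proof -
    have "?A - insert a \<sigma> = ?A - \<sigma>" "?A - insert b \<sigma> = ?A - \<sigma>" by auto
    then show "insert a \<sigma> \<in> ?U \<longleftrightarrow> \<sigma> \<in> ?U'" "insert b \<sigma> \<in> ?U \<longleftrightarrow> \<sigma> \<in> ?U'"
      using that ab PA indep_eq[of "insert a \<sigma>"] indep_eq[of "insert b \<sigma>"] by (auto simp: fam_def)
  qed
  have mem_no: "a \<in> \<tau> \<or> b \<in> \<tau>" if "\<tau> \<in> ?U" for \<tau>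
    using that ab by (auto simp: fam_def indep_def)
  \<comment> \<open>The join of \<open>g'\<close> with \<open>a\<close> is a cycle of the large
    family: removing \<open>a\<close> leads to a set free of \<open>a\<close> and \<open>b\<close>,
    which is not a member.\<close>
  define g where "g \<sigma> = (if a \<in> \<sigma> \<and> b \<notin> \<sigma> then eps a (\<sigma> - {a}) * g' (\<sigma> - {a}) else 0)" for \<sigma>
  have "chains ?U (Suc i) g"
  proof (unfold chains_def, intro allI impI)
    fix \<sigma> assume "g \<sigma> \<noteq> 0"
    then have s: "a \<in> \<sigma>" "b \<notin> \<sigma>" "g' (\<sigma> - {a}) \<noteq> 0" by (auto simp: g_def split: if_splits)
    then have "\<sigma> - {a} \<in> ?U'" "card (\<sigma> - {a}) = i" using g' by (auto simp: chains_def)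
    then show "\<sigma> \<in> ?U \<and> card \<sigma> = Suc i" using s mem_a[of "\<sigma> - {a}"] finU
      by (metis Diff_iff card_Suc_Diff1 insertI1 insert_Diff)
  qed
  moreover have "bd (\<lambda>_. 1) g \<tau> = 0" if \<tau>: "\<tau> \<in> ?U" for \<tau>
  proof (cases "b \<in> \<tau>")
    case True
    then show ?thesis by (simp add: bd_def g_def)
  next
    case False
    then obtain \<rho> where \<rho>: "\<tau> = insert a \<rho>" "a \<notin> \<rho>" "b \<notin> \<rho>" using mem_no[OF \<tau>] by (metis insertCI mk_disjoint_insert)
    have rU: "\<rho> \<in> ?U'" using mem_a[of \<rho>] \<rho> \<tau> by auto
    have eq: "(\<lambda>\<sigma>. if a \<in> \<sigma> \<or> b \<in> \<sigma> then 0 else eps a \<sigma> * g (insert a \<sigma>)) = g'"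
    proof
      fix \<sigma>
      show "(if a \<in> \<sigma> \<or> b \<in> \<sigma> then 0 else eps a \<sigma> * g (insert a \<sigma>)) = g' \<sigma>"
        using chainsD(1)[OF g', of \<sigma>] nU'[of \<sigma>] ab by (cases "\<sigma> \<in> ?U'") (auto simp: g_def)
    qed
    have "bd (\<lambda>_. 1) g (insert a \<rho>) = - eps a \<rho> * bd (\<lambda>_. 1) g' \<rho>"
      by (subst bd_insert[of _ _ b]) (use \<rho> rU finU' ab PA in \<open>auto simp: eq, auto simp: g_def\<close>)
    then show ?thesis using cyc rU \<rho> by simp
  qed
  ultimately obtain h where h: "chains ?U (Suc (Suc i)) h" "\<forall>\<tau>\<in>?U. bd (\<lambda>_. 1) h \<tau> = g \<tau>"
    using ac unfolding acyclic_at_def by blast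
  \<comment> \<open>The links of \<open>a\<close> and \<open>b\<close> in the bounding chain. In the
    sum of their boundaries the coefficients on sets containing both vertices cancel by
    \<open>eps_swap\<close>; what remains is \<open>g'\<close> up to sign.\<close>
  define ha where "ha = (\<lambda>\<sigma>. if a \<in> \<sigma> \<or> b \<in> \<sigma> then 0 else eps a \<sigma> * h (insert a \<sigma>))"
  define hb where "hb = (\<lambda>\<sigma>. if b \<in> \<sigma> \<or> a \<in> \<sigma> then 0 else eps b \<sigma> * h (insert b \<sigma>))"
  have "chains ?U' (Suc i) (\<lambda>\<sigma>. 0 - (ha \<sigma> + hb \<sigma>))"
  proof (unfold chains_def, intro allI impI)
    fix \<sigma> assume "0 - (ha \<sigma> + hb \<sigma>) \<noteq> 0"
    then have s: "a \<notin> \<sigma>" "b \<notin> \<sigma>" "h (insert a \<sigma>) \<noteq> 0 \<or> h (insert b \<sigma>) \<noteq> 0"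
      by (auto simp: ha_def hb_def split: if_splits)
    then have "\<sigma> \<in> ?U'" "card (insert a \<sigma>) = Suc (Suc i) \<or> card (insert b \<sigma>) = Suc (Suc i)"
      using h(1) mem_a mem_b by (auto simp: chains_def)
    then show "\<sigma> \<in> ?U' \<and> card \<sigma> = Suc i" using s finU' by auto
  qed
  moreover have "bd (\<lambda>_. 1) (\<lambda>\<sigma>. 0 - (ha \<sigma> + hb \<sigma>)) \<tau> = g' \<tau>" if \<tau>: "\<tau> \<in> ?U'" for \<tau>
  proof -
    note nt = nU'[OF \<tau>] finU'[OF \<tau>]
    define z where "z = h (insert a (insert b \<tau>))"
    have "eps a \<tau> * g' \<tau> = eps b (insert a \<tau>) * z - eps a \<tau> * bd (\<lambda>_. 1) ha \<tau>"
      using bd_insert[of \<tau> a b h] h(2) mem_a[of \<tau>] \<tau> nt ab PA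
      by (auto simp: ha_def z_def g_def insert_commute)
    then have "eps a \<tau> * (eps a \<tau> * g' \<tau>) = eps a \<tau> * (eps b (insert a \<tau>) * z - eps a \<tau> * bd (\<lambda>_. 1) ha \<tau>)"
      by simp
    then have 1: "g' \<tau> = eps a \<tau> * eps b (insert a \<tau>) * z - bd (\<lambda>_. 1) ha \<tau>"
      by (simp add: right_diff_distrib mult.assoc)
    have "0 = eps a (insert b \<tau>) * z - eps b \<tau> * bd (\<lambda>_. 1) hb \<tau>"
      using bd_insert[of \<tau> b a h] h(2) mem_b[of \<tau>] \<tau> nt ab PA
      by (auto simp: hb_def z_def g_def insert_commute)
    then have "eps b \<tau> * 0 = eps b \<tau> * (eps a (insert b \<tau>) * z - eps b \<tau> * bd (\<lambda>_. 1) hb \<tau>)"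
      by simp
    then have 2: "0 = eps b \<tau> * eps a (insert b \<tau>) * z - bd (\<lambda>_. 1) hb \<tau>"
      by (simp add: right_diff_distrib mult.assoc)
    have 3: "eps a \<tau> * eps b (insert a \<tau>) = - (eps b \<tau> * (eps a (insert b \<tau>) :: 'k))"
      by (rule eps_swap) (use nt ab PA in auto)
    show ?thesis using 1 2 by (simp add: bd_uminus bd_diff bd_add 3)
  qed
  ultimately show "\<exists>h. chains ?U' (Suc i) h \<and> (\<forall>\<tau>\<in>?U'. bd (\<lambda>_. 1) h \<tau> = g' \<tau>)" by blast
qed

lemma not_acyclic_matching:
  assumes edge: "\<And>e. e \<in> E \<Longrightarrow> card e = 2" and "induced_matching E M" "finite M" "\<Union> M \<subseteq> V"
  shows "\<not> acyclic_at (K :: 'k::field itself) (fam E {} (\<Union> M)) (card M)"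
  using assms(3,2,4)
proof (induction M)
  case empty
  have "fam E {} {} = {{}}" using edge by (fastforce simp: fam_def indep_def)
  \<comment> \<open>The family consisting of the empty set has a class in degree 0, since no nonzero
    chain of degree 1 exists to bound it.\<close>
  moreover have "\<not> acyclic_at K {{}} 0"
  proof
    assume "acyclic_at K {{}} 0"
    moreover have "chains {{}} 0 (\<lambda>\<sigma>. if \<sigma> = {} then 1 else 0 :: 'k)" by (auto simp: chains_def)
    moreover have "\<forall>\<tau>\<in>{{}}. bd (\<lambda>_. 1) (\<lambda>\<sigma>. if \<sigma> = {} then 1 else 0 :: 'k) \<tau> = 0" by (simp add: bd_def)
    ultimately obtain h :: "'a set \<Rightarrow> 'k" where h: "chains {{}} (Suc 0) h" "bd (\<lambda>_. 1) h {} = 1"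
      unfolding acyclic_at_def by fastforce
    have "h \<sigma> = 0" for \<sigma> using h(1) by (cases "h \<sigma> = 0") (auto simp: chains_def)
    then have "h = (\<lambda>_. 0)" by blast
    with h(2) show False by simp
  qed
  ultimately show ?case by simp
next
  case (insert e M)
  have e: "e \<in> E" using insert.prems by (auto simp: induced_matching_def)
  then obtain a b where ab: "e = {a, b}" "a \<noteq> b" using edge by (meson card_2_iff)
  have M: "induced_matching E M"
    using insert.prems(1) unfolding induced_matching_def by (meson insertCI insert_subset)
  have disj: "e \<inter> e' = {}" if "e' \<in> M" for e'
  proof (rule ccontr)
    assume "e \<inter> e' \<noteq> {}"
    moreover have "e \<inter> e \<noteq> {}" using ab by auto
    ultimately have "e = e'" using insert.prems(1) e that unfolding induced_matching_def
      by (meson insertCI)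
    then show False using that insert.hyps by auto
  qed
  have eq: "\<Union> (insert e M) - {a, b} = \<Union> M" using disj ab by auto
  have iso: "d = {a, b} \<or> d \<inter> {a, b} = {}" if d: "d \<in> E" "d \<subseteq> \<Union> (insert e M)" for d
  proof (rule ccontr)
    assume *: "\<not> ?thesis"
    then obtain x where x: "x \<in> d" "x \<notin> e"
      using edge[OF d(1)] edge[OF e] ab by (metis card_subset_eq card.infinite subsetI zero_neq_numeral)
    then obtain e' where e': "e' \<in> M" "x \<in> e'" using d by auto
    moreover have "d \<inter> e \<noteq> {}" "d \<inter> e' \<noteq> {}" using * ab x e' by auto
    ultimately have "e = e'" using d(1) insert.prems(1) unfolding induced_matching_def by (meson insertCI)
    then show False using e' insert.hyps by auto
  qed
  show ?case
  proof
    assume "acyclic_at K (fam E {} (\<Union> (insert e M))) (card (insert e M))"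
    then have "acyclic_at K (fam E {} (\<Union> (insert e M))) (Suc (card M))" using insert by simp
    then have "acyclic_at K (fam E {} (\<Union> (insert e M) - {a, b})) (card M)"
      by (rule acyclic_fam_remove_edge[rotated 7]) (use ab e insert.prems iso in auto)
    then show False unfolding eq using insert M by auto
  qed
qed

end

section \<open>Degrees of monomials and homogeneous polynomials\<close>

lemma sum_fun_apply: "(\<Sum>i\<in>S. f i) x = (\<Sum>i\<in>S. f i x :: 'b::comm_monoid_add)"
  by (induction S rule: infinite_finite_induct) auto

lemma keys_add_nat: "keys (m + m' :: 'a \<Rightarrow>\<^sub>0 nat) = keys m \<union> keys m'"
  by (auto simp: in_keys_iff lookup_add)

lemma mon_deg_superset:
  assumes "finite S" "keys m \<subseteq> S"
  shows "mon_deg m = (\<Sum>u\<in>S. lookup m u)"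
  unfolding mon_deg_def by (rule sum.mono_neutral_left) (use assms in \<open>auto simp: in_keys_iff\<close>)

lemma mon_deg_zero [simp]: "mon_deg 0 = 0"
  by (simp add: mon_deg_def)

lemma mon_deg_add: "mon_deg (m + m') = mon_deg m + mon_deg m'"
proof -
  let ?S = "keys m \<union> keys m'"
  have "mon_deg (m + m') = (\<Sum>u\<in>?S. lookup (m + m') u)"
    by (rule mon_deg_superset) (auto simp: keys_add_nat)
  also have "\<dots> = mon_deg m + mon_deg m'"
    by (simp add: lookup_add sum.distrib mon_deg_superset[of ?S])
  finally show ?thesis .
qed

lemma mon_deg_single [simp]: "mon_deg (single v n) = n"
  by (simp add: mon_deg_def)

lemma mon_deg_eq_0_iff: "mon_deg m = 0 \<longleftrightarrow> m = 0"
proof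
  assume "mon_deg m = 0"
  then have "\<forall>u\<in>keys m. lookup m u = 0" by (simp add: mon_deg_def)
  then have "lookup m u = 0" for u by (auto simp: in_keys_iff)
  then show "m = 0" by (intro poly_mapping_eqI) simp
qed simp

lemma hom_piece_iff:
  "p \<in> hom_piece V d \<longleftrightarrow> (\<forall>m\<in>keys p. keys m \<subseteq> V \<and> int (mon_deg m) = d)"
  by (auto simp: hom_piece_def poly_ring_def)

lemma poly_ring_carrier_iff:
  "p \<in> carrier (poly_ring V) \<longleftrightarrow> (\<forall>m\<in>keys p. keys m \<subseteq> V)"
  by (simp add: poly_ring_def)

lemma hom_piece_carrier: "p \<in> hom_piece V d \<Longrightarrow> p \<in> carrier (poly_ring V)"
  by (simp add: hom_piece_def)

lemma keys_minus_subset: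
  "keys (p - q :: 'a \<Rightarrow>\<^sub>0 'b::ab_group_add) \<subseteq> keys p \<union> keys q"
  by (auto simp: in_keys_iff lookup_minus)

lemma keys_uminus [simp]: "keys (- p :: 'a \<Rightarrow>\<^sub>0 'b::ab_group_add) = keys p"
  by (auto simp: in_keys_iff)

lemma hom_piece_zero [simp]: "0 \<in> hom_piece V d"
  by (simp add: hom_piece_iff)

lemma hom_piece_add: "p \<in> hom_piece V d \<Longrightarrow> q \<in> hom_piece V d \<Longrightarrow> p + q \<in> hom_piece V d"
  using keys_add[of p q] by (auto simp: hom_piece_iff)

lemma hom_piece_diff: "p \<in> hom_piece V d \<Longrightarrow> q \<in> hom_piece V d \<Longrightarrow> p - q \<in> hom_piece V d"
  using keys_minus_subset[of p q] by (auto simp: hom_piece_iff)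

lemma hom_piece_sum: "(\<And>i. i \<in> S \<Longrightarrow> f i \<in> hom_piece V d) \<Longrightarrow> sum f S \<in> hom_piece V d"
  by (induction S rule: infinite_finite_induct) (auto intro: hom_piece_add)

lemma hom_piece_mult:
  assumes "p \<in> hom_piece V d" "q \<in> hom_piece V e" "d + e = f"
  shows "p * q \<in> hom_piece V f"
  unfolding hom_piece_iff
proof
  fix m assume "m \<in> keys (p * q)"
  then obtain a b where "m = a + b" "a \<in> keys p" "b \<in> keys q"
    using keys_mult[of p q] by auto
  then show "keys m \<subseteq> V \<and> int (mon_deg m) = f"
    using assms by (auto simp: hom_piece_iff keys_add_nat mon_deg_add)
qed

lemma hom_piece_single:
  "keys m \<subseteq> V \<Longrightarrow> int (mon_deg m) = d \<Longrightarrow> single m k \<in> hom_piece V d"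
  by (simp add: hom_piece_iff)

lemma hom_piece_var: "v \<in> V \<Longrightarrow> var v \<in> hom_piece V 1"
  unfolding var_def by (rule hom_piece_single) auto

lemma hom_piece_const: "single 0 k \<in> hom_piece V 0"
  by (rule hom_piece_single) auto

lemma hom_piece_neg: "d < 0 \<Longrightarrow> p \<in> hom_piece V d \<Longrightarrow> p = 0"
  by (metis hom_piece_iff keys_eq_empty equals0I of_nat_less_0_iff)

lemma poly_mapping_sum_single:
  "(\<Sum>m\<in>keys p. single m (lookup p m)) = p"
proof (rule poly_mapping_eqI)
  fix m
  have "lookup (\<Sum>m\<in>keys p. single m (lookup p m)) m
      = (\<Sum>m'\<in>keys p. if m' = m then lookup p m else 0)"
    unfolding lookup_sum by (rule sum.cong) (auto simp: lookup_single)
  then show "lookup (\<Sum>m\<in>keys p. single m (lookup p m)) m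
      = lookup p m"
    by (simp add: in_keys_iff)
qed

text \<open>Every monomial of \<open>p\<close> is nonconstant; one of its variables is selected, and
  grouping the monomials by that variable gives the cofactors \<open>q\<close>.\<close>

lemma hom_piece_no_const:
  assumes p: "p \<in> hom_piece V d" and c: "const_coeff p = 0" and V: "finite V"
  obtains q where "\<And>v. q v \<in> hom_piece V (d - 1)" "p = (\<Sum>v\<in>V. var v * q v)"
proof -
  have nz: "\<exists>v. v \<in> keys m" if "m \<in> keys p" for m
  proof -
    have "m \<noteq> 0" using that c by (auto simp: const_coeff_def in_keys_iff)
    then show ?thesis using keys_eq_empty by blast
  qed
  define w where "w m = (SOME v. v \<in> keys m)" for m :: "'a \<Rightarrow>\<^sub>0 nat"
  have w: "w m \<in> keys m" if "m \<in> keys p" for m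
    unfolding w_def using nz[OF that] by (rule someI_ex)
  have split: "m = single (w m) 1 + (m - single (w m) 1)"
    if "m \<in> keys p" for m
    by (rule poly_mapping_eqI) (use w[OF that] in \<open>auto simp: lookup_add lookup_minus lookup_single when_def in_keys_iff\<close>)
  define q where "q v = (\<Sum>m\<in>{m \<in> keys p. w m = v}.
    single (m - single v 1) (lookup p m))" for v
  show ?thesis
  proof
    fix v
    show "q v \<in> hom_piece V (d - 1)"
      unfolding q_def
    proof (rule hom_piece_sum, rule hom_piece_single)
      fix m assume m: "m \<in> {m \<in> keys p. w m = v}"
      note s = split[of m] 
      have "mon_deg m = 1 + mon_deg (m - single v 1)"
        using m arg_cong[OF split[of m], of mon_deg] by (simp add: mon_deg_add)
      then show "int (mon_deg (m - single v 1)) = d - 1"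
        using m p by (auto simp: hom_piece_iff)
      have "keys m = {v} \<union> keys (m - single v 1)"
        using m arg_cong[OF split[of m], of keys] by (simp add: keys_add_nat)
      then show "keys (m - single v 1) \<subseteq> V"
        using m p by (auto simp: hom_piece_iff)
    qed
  next
    have "(\<Sum>v\<in>V. var v * q v) = (\<Sum>v\<in>V. \<Sum>m\<in>{m \<in> keys p. w m = v}.
        single m (lookup p m))"
    proof (rule sum.cong)
      fix v
      have "single (single v 1 + (m - single v 1)) (lookup p m)
        = single m (lookup p m)"
        if "m \<in> {m \<in> keys p. w m = v}" for m
        using split[of m] that by auto
      then show "var v * q v = (\<Sum>m\<in>{m \<in> keys p. w m = v}.
          single m (lookup p m))"
        unfolding q_def sum_distrib_left var_def mult_single by (intro sum.cong) auto
    qed simp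
    also have "\<dots> = (\<Sum>m\<in>keys p. single m (lookup p m))"
      by (rule sum.group) (use V w p in \<open>auto simp: hom_piece_iff\<close>)
    finally show "p = (\<Sum>v\<in>V. var v * q v)" by (simp add: poly_mapping_sum_single)
  qed
qed

section \<open>Koszul homology of graded modules\<close>

definition scale :: "'b::comm_ring_1 \<Rightarrow> (nat \<Rightarrow> 'b) \<Rightarrow> nat \<Rightarrow> 'b" where
  "scale p x = (\<lambda>l. p * x l)"

lemma scale_apply [simp]: "scale p x l = p * x l"
  by (simp add: scale_def)

lemma scale_1 [simp]: "scale 1 x = x" and scale_0 [simp]: "scale p 0 = 0"
  and scale_minus1: "scale (- p) x = - scale p x"
  by (auto simp: fun_eq_iff mult.assoc sum_fun_apply sum_distrib_left algebra_simps)

text \<open>Linearity is over \<open>'b\<close>, which will be the whole polynomial ring; such maps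
  commute with the Koszul differential.\<close>

definition linear_map :: "((nat \<Rightarrow> 'b::comm_ring_1) \<Rightarrow> nat \<Rightarrow> 'b) \<Rightarrow> bool" where
  "linear_map \<phi> \<longleftrightarrow> (\<forall>x y. \<phi> (x + y) = \<phi> x + \<phi> y) \<and> (\<forall>p x. \<phi> (scale p x) = scale p (\<phi> x))"

lemma linear_map_add: "linear_map \<phi> \<Longrightarrow> \<phi> (x + y) = \<phi> x + \<phi> y"
  and linear_map_scale: "linear_map \<phi> \<Longrightarrow> \<phi> (scale p x) = scale p (\<phi> x)"
  by (auto simp: linear_map_def)

lemma linear_map_diff:
  assumes "linear_map \<phi>" shows "\<phi> (x - y) = \<phi> x - \<phi> y"
  using linear_map_add[OF assms, of "x - y" y] by (simp add: algebra_simps)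

lemma linear_map_zero:
  assumes "linear_map \<phi>" shows "\<phi> 0 = 0"
  using linear_map_diff[OF assms, of 0 0] by simp

lemma linear_map_sum:
  assumes "linear_map \<phi>" shows "\<phi> (sum f S) = (\<Sum>i\<in>S. \<phi> (f i))"
  by (induction S rule: infinite_finite_induct)
    (simp_all only: sum.infinite sum.empty sum.insert not_False_eq_True linear_map_zero[OF assms] linear_map_add[OF assms])

text \<open>A graded module is given by its homogeneous pieces \<open>A d\<close>, all inside one module of vectors.\<close>

definition graded_mod :: "'a set \<Rightarrow> ('a, 'k::field) pieces \<Rightarrow> bool" where
  "graded_mod V A \<longleftrightarrow> (\<forall>d. 0 \<in> A d \<and> (\<forall>x\<in>A d. \<forall>y\<in>A d. x - y \<in> A d) \<and>
     (\<forall>v\<in>V. \<forall>x\<in>A d. scale (var v) x \<in> A (d + 1)))"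

lemma graded_mod_zero: "graded_mod V A \<Longrightarrow> 0 \<in> A d"
  and graded_mod_diff: "graded_mod V A \<Longrightarrow> x \<in> A d \<Longrightarrow> y \<in> A d \<Longrightarrow> x - y \<in> A d"
  and graded_mod_var: "graded_mod V A \<Longrightarrow> v \<in> V \<Longrightarrow> x \<in> A (d - 1) \<Longrightarrow> scale (var v) x \<in> A d"
  by (auto simp: graded_mod_def dest: spec[of _ "d - 1"])

lemma graded_mod_uminus: "graded_mod V A \<Longrightarrow> x \<in> A d \<Longrightarrow> - x \<in> A d"
  using graded_mod_diff[of V A 0 d x] graded_mod_zero by auto

lemma graded_mod_add: "graded_mod V A \<Longrightarrow> x \<in> A d \<Longrightarrow> y \<in> A d \<Longrightarrow> x + y \<in> A d"
  using graded_mod_diff[of V A x d "- y"] graded_mod_uminus[of V A y d] by auto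

lemma graded_mod_sum:
  "graded_mod V A \<Longrightarrow> (\<And>i. i \<in> S \<Longrightarrow> f i \<in> A d) \<Longrightarrow> sum f S \<in> A d"
  by (induction S rule: infinite_finite_induct) (auto intro: graded_mod_add graded_mod_zero)

text \<open>As the second argument of \<open>hk_zero\<close> this yields the Koszul homology of the
  first argument itself.\<close>

definition zero_mod :: "('a, 'k::field) pieces" where
  "zero_mod d = {0}"

lemma graded_mod_zero_mod: "graded_mod V zero_mod"
  by (simp add: graded_mod_def zero_mod_def)

text \<open>The degree \<open>d\<close> part of the product of \<open>A\<close> with the ideal of
  all variables; what it misses in \<open>A d\<close> accounts for minimal generators.\<close>

definition max_mult :: "'a set \<Rightarrow> ('a, 'k::field) pieces \<Rightarrow> ('a, 'k) pieces" where
  "max_mult V A d = {\<Sum>v\<in>V. scale (var v) (q v) |q. \<forall>v\<in>V. q v \<in> A (d - 1)}"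

context ordered_vars
begin

definition kd :: "('a set \<Rightarrow> nat \<Rightarrow> ('a, 'k::field) mpoly) \<Rightarrow> 'a set \<Rightarrow> nat \<Rightarrow> ('a, 'k) mpoly" where
  "kd c = (\<lambda>\<tau> l. bd var (\<lambda>\<sigma>. c \<sigma> l) \<tau>)"

lemma kd_eq_sum: "kd c \<tau> = (\<Sum>v\<in>V - \<tau>. scale (eps v \<tau>) (scale (var v) (c (insert v \<tau>))))"
  by (auto simp: kd_def bd_def sum_fun_apply mult.assoc)

lemma kd_diff: "kd (\<lambda>\<sigma>. c \<sigma> - d \<sigma>) = (\<lambda>\<sigma>. kd c \<sigma> - kd d \<sigma>)"
  by (auto simp: kd_def bd_diff fun_eq_iff)

lemma kd_zero [simp]: "kd (\<lambda>\<sigma>. 0) = (\<lambda>\<sigma>. 0)"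
  by (auto simp: kd_def fun_eq_iff)

lemma linear_map_kd: "linear_map \<phi> \<Longrightarrow> \<phi> (kd c \<tau>) = kd (\<lambda>\<sigma>. \<phi> (c \<sigma>)) \<tau>"
  by (simp only: kd_eq_sum linear_map_sum linear_map_scale)

text \<open>The basis element indexed by \<open>\<sigma>\<close> has degree
  \<open>card \<sigma>\<close>, so a chain of total degree \<open>j\<close> takes values in degree
  \<open>j - int i\<close>. Values elsewhere are fixed to 0, so that equality of chains is equality
  of functions.\<close>

definition kchains :: "('a, 'k::field) pieces \<Rightarrow> nat \<Rightarrow> int \<Rightarrow> ('a set \<Rightarrow> nat \<Rightarrow> ('a, 'k) mpoly) set"
  where "kchains A i j =
    {c. \<forall>\<sigma>. if \<sigma> \<subseteq> V \<and> card \<sigma> = i then c \<sigma> \<in> A (j - int i) else c \<sigma> = 0}"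

lemma kchainsI:
  "(\<And>\<sigma>. \<sigma> \<subseteq> V \<Longrightarrow> card \<sigma> = i \<Longrightarrow> c \<sigma> \<in> A (j - int i)) \<Longrightarrow>
    (\<And>\<sigma>. \<not> (\<sigma> \<subseteq> V \<and> card \<sigma> = i) \<Longrightarrow> c \<sigma> = 0) \<Longrightarrow> c \<in> kchains A i j"
  by (simp add: kchains_def)

lemma kchainsD:
  "c \<in> kchains A i j \<Longrightarrow> \<sigma> \<subseteq> V \<Longrightarrow> card \<sigma> = i \<Longrightarrow> c \<sigma> \<in> A (j - int i)"
  "c \<in> kchains A i j \<Longrightarrow> \<not> (\<sigma> \<subseteq> V \<and> card \<sigma> = i) \<Longrightarrow> c \<sigma> = 0"
  by (auto simp: kchains_def split: if_splits)

lemma kchains_mono: "(\<And>d. A d \<subseteq> B d) \<Longrightarrow> kchains A i j \<subseteq> kchains B i j"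
  unfolding kchains_def by (auto split: if_splits)

lemma kchains_diff:
  "graded_mod V A \<Longrightarrow> c \<in> kchains A i j \<Longrightarrow> d \<in> kchains A i j \<Longrightarrow> (\<lambda>\<sigma>. c \<sigma> - d \<sigma>) \<in> kchains A i j"
  unfolding kchains_def by (auto intro: graded_mod_diff)

lemma kchains_add:
  "graded_mod V A \<Longrightarrow> c \<in> kchains A i j \<Longrightarrow> d \<in> kchains A i j \<Longrightarrow> (\<lambda>\<sigma>. c \<sigma> + d \<sigma>) \<in> kchains A i j"
  unfolding kchains_def by (auto intro: graded_mod_add)

lemma kchains_zero: "graded_mod V A \<Longrightarrow> (\<lambda>\<sigma>. 0) \<in> kchains A i j"
  unfolding kchains_def by (auto intro: graded_mod_zero)

lemma kchains_zero_mod: "c \<in> kchains zero_mod i j \<longleftrightarrow> c = (\<lambda>\<sigma>. 0)"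
  unfolding kchains_def zero_mod_def by auto

lemma kd_kchains_0: "c \<in> kchains A 0 j \<Longrightarrow> kd c = (\<lambda>\<sigma>. 0)"
proof
  fix \<tau> assume c: "c \<in> kchains A 0 j"
  have "c (insert v \<tau>) = 0" if "v \<in> V" for v
  proof -
    have "insert v \<tau> \<subseteq> V \<Longrightarrow> card (insert v \<tau>) \<noteq> 0"
      using finite_V finite_subset[of "insert v \<tau>" V] by auto
    then show ?thesis using c by (auto simp: kchains_def dest: spec[of _ "insert v \<tau>"])
  qed
  then show "kd c \<tau> = 0" by (simp add: kd_eq_sum)
qed

lemma kd_kchains:
  assumes A: "graded_mod V A" and c: "c \<in> kchains A i j"
  shows "kd c \<in> kchains A (i - 1) j"
proof (cases i)
  case 0
  then show ?thesis using kd_kchains_0[of c A j] c kchains_zero[OF A] by auto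
next
  case (Suc k)
  have c1: "c \<sigma> \<in> A (j - int k - 1)" if "\<sigma> \<subseteq> V" "card \<sigma> = Suc k" for \<sigma>
    using c that Suc unfolding kchains_def by (auto simp: algebra_simps dest!: spec[of _ \<sigma>])
  have c0: "c \<sigma> = 0" if "\<not> (\<sigma> \<subseteq> V \<and> card \<sigma> = Suc k)" for \<sigma>
    using c that Suc unfolding kchains_def by (auto dest!: spec[of _ \<sigma>])
  have "kd c \<tau> \<in> A (j - int k)" if \<tau>: "\<tau> \<subseteq> V" "card \<tau> = k" for \<tau>
    unfolding kd_eq_sum
  proof (rule graded_mod_sum[OF A])
    fix v assume v: "v \<in> V - \<tau>"
    have "finite \<tau>" using \<tau> finite_V finite_subset by blast
    then have "scale (var v) (c (insert v \<tau>)) \<in> A (j - int k)"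
      using v \<tau> by (intro graded_mod_var[OF A] c1) auto
    then show "scale (eps v \<tau>) (scale (var v) (c (insert v \<tau>))) \<in> A (j - int k)"
      using eps_cases[of v \<tau>] graded_mod_uminus[OF A] by (metis scale_1 scale_minus1)
  qed
  moreover have "kd c \<tau> = 0" if \<tau>: "\<not> (\<tau> \<subseteq> V \<and> card \<tau> = k)" for \<tau>
  proof -
    have "c (insert v \<tau>) = 0" if "v \<in> V - \<tau>" for v
    proof (rule c0)
      show "\<not> (insert v \<tau> \<subseteq> V \<and> card (insert v \<tau>) = Suc k)"
        using that \<tau> finite_V by (metis DiffE card_insert_disjoint finite_subset insert_subset nat.inject)
    qed
    then show ?thesis by (simp add: kd_eq_sum)
  qed
  ultimately show ?thesis unfolding kchains_def Suc by auto
qed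

lemma kd_kd:
  assumes c: "c \<in> kchains A i j"
  shows "kd (kd c) = (\<lambda>\<sigma>. 0)"
proof
  fix \<tau>
  show "kd (kd c) \<tau> = 0"
  proof (cases "finite \<tau>")
    case True
    then show ?thesis by (auto simp: kd_def bd_bd)
  next
    case False
    have "c \<sigma> = 0" if "infinite \<sigma>" for \<sigma>
      using that finite_V finite_subset by (intro kchainsD(2)[OF c]) blast
    then show ?thesis using False by (simp add: kd_eq_sum)
  qed
qed

text \<open>The degree-\<open>j\<close> part of the \<open>i\<close>-th Koszul homology of \<open>A/B\<close> vanishes.  Truncation in \<open>i - 1\<close> is
  harmless: for \<open>i = 0\<close> the differential is zero.\<close>

definition hk_zero :: "('a, 'k::field) pieces \<Rightarrow> ('a, 'k) pieces \<Rightarrow> nat \<Rightarrow> int \<Rightarrow> bool"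
  where "hk_zero A B i j \<longleftrightarrow> (\<forall>c\<in>kchains A i j. kd c \<in> kchains B (i - 1) j \<longrightarrow>
    (\<exists>b\<in>kchains A (Suc i) j. (\<lambda>\<sigma>. c \<sigma> - kd b \<sigma>) \<in> kchains B i j))"

text \<open>The hypotheses make \<open>\<phi>\<close> induce an isomorphism of F/N onto A/B; chains
  are lifted value by value and the errors stay in \<open>B\<close>. It is applied to the
  augmentation of a resolution and to a differential onto its image.\<close>

lemma hk_zero_iso:
  assumes F: "graded_mod V F" and A: "graded_mod V A" and B: "graded_mod V B" and BA: "\<And>d. B d \<subseteq> A d"
    and lin: "linear_map \<phi>" and map: "\<And>d x. x \<in> F d \<Longrightarrow> \<phi> x \<in> A d"
    and surj: "\<And>d a. a \<in> A d \<Longrightarrow> \<exists>x\<in>F d. a - \<phi> x \<in> B d"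
    and N: "\<And>d. N d = {x \<in> F d. \<phi> x \<in> B d}"
  shows "hk_zero F N i j \<longleftrightarrow> hk_zero A B i j"
proof -
  have lift: "\<exists>c'\<in>kchains F i j. (\<lambda>\<sigma>. c \<sigma> - \<phi> (c' \<sigma>)) \<in> kchains B i j" if "c \<in> kchains A i j" for c i
  proof -
    define c' where "c' \<sigma> = (if \<sigma> \<subseteq> V \<and> card \<sigma> = i
      then SOME x. x \<in> F (j - int i) \<and> c \<sigma> - \<phi> x \<in> B (j - int i) else 0)" for \<sigma>
    have c': "c' \<sigma> \<in> F (j - int i) \<and> c \<sigma> - \<phi> (c' \<sigma>) \<in> B (j - int i)" if "\<sigma> \<subseteq> V" "card \<sigma> = i" for \<sigma>
    proof -
      have "\<exists>x. x \<in> F (j - int i) \<and> c \<sigma> - \<phi> x \<in> B (j - int i)"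
        using surj[OF kchainsD(1)[OF \<open>c \<in> kchains A i j\<close> that]] by auto
      from someI_ex[OF this] show ?thesis using that by (simp add: c'_def)
    qed
    have c'0: "c' \<sigma> = 0" if "\<not> (\<sigma> \<subseteq> V \<and> card \<sigma> = i)" for \<sigma>
      using that by (auto simp: c'_def)
    have "c' \<in> kchains F i j" by (rule kchainsI) (use c' c'0 in auto)
    moreover have "(\<lambda>\<sigma>. c \<sigma> - \<phi> (c' \<sigma>)) \<in> kchains B i j"
      by (rule kchainsI) (use c' c'0 kchainsD(2)[OF \<open>c \<in> kchains A i j\<close>] linear_map_zero[OF lin] in auto)
    ultimately show ?thesis by blast
  qed
  have im: "(\<lambda>\<sigma>. \<phi> (c \<sigma>)) \<in> kchains A i j" if "c \<in> kchains F i j" for c i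
    using that map linear_map_zero[OF lin] unfolding kchains_def by (auto split: if_splits)
  have N_iff: "c \<in> kchains N i j \<longleftrightarrow> c \<in> kchains F i j \<and> (\<lambda>\<sigma>. \<phi> (c \<sigma>)) \<in> kchains B i j" for c i
  proof
    assume c: "c \<in> kchains N i j"
    have 1: "c \<sigma> \<in> F (j - int i) \<and> \<phi> (c \<sigma>) \<in> B (j - int i)" if "\<sigma> \<subseteq> V" "card \<sigma> = i" for \<sigma>
      using kchainsD(1)[OF c that] by (simp add: N)
    note 2 = kchainsD(2)[OF c]
    have "c \<in> kchains F i j" by (rule kchainsI) (use 1 2 in auto)
    moreover have "(\<lambda>\<sigma>. \<phi> (c \<sigma>)) \<in> kchains B i j"
      by (rule kchainsI) (use 1 2 linear_map_zero[OF lin] in auto)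
    ultimately show "c \<in> kchains F i j \<and> (\<lambda>\<sigma>. \<phi> (c \<sigma>)) \<in> kchains B i j" ..
  next
    assume c: "c \<in> kchains F i j \<and> (\<lambda>\<sigma>. \<phi> (c \<sigma>)) \<in> kchains B i j"
    show "c \<in> kchains N i j"
    proof (rule kchainsI)
      fix \<sigma> assume \<sigma>: "\<sigma> \<subseteq> V" "card \<sigma> = i"
      show "c \<sigma> \<in> N (j - int i)"
        unfolding N using kchainsD(1)[OF conjunct1[OF c] \<sigma>] kchainsD(1)[OF conjunct2[OF c] \<sigma>] by simp
    qed (rule kchainsD(2)[OF conjunct1[OF c]])
  qed
  note BAk = kchains_mono[of B A, OF BA, THEN subsetD]
  show ?thesis
  proof
    assume hF: "hk_zero F N i j"
    show "hk_zero A B i j"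
      unfolding hk_zero_def
    proof (intro ballI impI)
      fix c assume c: "c \<in> kchains A i j" and dc: "kd c \<in> kchains B (i - 1) j"
      obtain c' where c': "c' \<in> kchains F i j" and e: "(\<lambda>\<sigma>. c \<sigma> - \<phi> (c' \<sigma>)) \<in> kchains B i j"
        using lift[OF c] by auto
      have "(\<lambda>\<sigma>. kd c \<sigma> - kd (\<lambda>\<sigma>. c \<sigma> - \<phi> (c' \<sigma>)) \<sigma>) \<in> kchains B (i - 1) j"
        by (rule kchains_diff[OF B dc kd_kchains[OF B e]])
      then have "(\<lambda>\<sigma>. \<phi> (kd c' \<sigma>)) \<in> kchains B (i - 1) j"
        by (simp add: kd_diff linear_map_kd[OF lin])
      then have "kd c' \<in> kchains N (i - 1) j" using kd_kchains[OF F c'] N_iff by blast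
      from hF[unfolded hk_zero_def, rule_format, OF c' this] obtain b where b: "b \<in> kchains F (Suc i) j" "(\<lambda>\<sigma>. c' \<sigma> - kd b \<sigma>) \<in> kchains N i j"
        by (elim bexE)
      have "(\<lambda>\<sigma>. (c \<sigma> - \<phi> (c' \<sigma>)) + \<phi> (c' \<sigma> - kd b \<sigma>)) \<in> kchains B i j"
        using b(2) N_iff[of "\<lambda>\<sigma>. c' \<sigma> - kd b \<sigma>"] by (intro kchains_add[OF B e]) simp
      then have "(\<lambda>\<sigma>. c \<sigma> - kd (\<lambda>\<sigma>. \<phi> (b \<sigma>)) \<sigma>) \<in> kchains B i j"
        by (simp add: linear_map_diff[OF lin] linear_map_kd[OF lin])
      then show "\<exists>b\<in>kchains A (Suc i) j. (\<lambda>\<sigma>. c \<sigma> - kd b \<sigma>) \<in> kchains B i j"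
        using im[OF b(1)] by blast
    qed
  next
    assume hA: "hk_zero A B i j"
    show "hk_zero F N i j"
      unfolding hk_zero_def
    proof (intro ballI impI)
      fix c assume c: "c \<in> kchains F i j" and dc: "kd c \<in> kchains N (i - 1) j"
      have "kd (\<lambda>\<sigma>. \<phi> (c \<sigma>)) \<in> kchains B (i - 1) j"
        using dc N_iff[of "kd c"] by (simp add: linear_map_kd[OF lin])
      then obtain b where b: "b \<in> kchains A (Suc i) j" "(\<lambda>\<sigma>. \<phi> (c \<sigma>) - kd b \<sigma>) \<in> kchains B i j"
        using hA[unfolded hk_zero_def, rule_format, OF im[OF c]] by blast
      obtain b' where b': "b' \<in> kchains F (Suc i) j" and e: "(\<lambda>\<sigma>. b \<sigma> - \<phi> (b' \<sigma>)) \<in> kchains B (Suc i) j"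
        using lift[OF b(1)] by auto
      have "kd (\<lambda>\<sigma>. b \<sigma> - \<phi> (b' \<sigma>)) \<in> kchains B i j" using kd_kchains[OF B e] by simp
      then have "(\<lambda>\<sigma>. (\<phi> (c \<sigma>) - kd b \<sigma>) + kd (\<lambda>\<sigma>. b \<sigma> - \<phi> (b' \<sigma>)) \<sigma>) \<in> kchains B i j"
        by (rule kchains_add[OF B b(2)])
      then have "(\<lambda>\<sigma>. \<phi> (c \<sigma> - kd b' \<sigma>)) \<in> kchains B i j"
        by (simp add: kd_diff linear_map_diff[OF lin] linear_map_kd[OF lin])
      moreover have "(\<lambda>\<sigma>. c \<sigma> - kd b' \<sigma>) \<in> kchains F i j"
        using kd_kchains[OF F b'] by (intro kchains_diff[OF F c]) simp
      ultimately show "\<exists>b\<in>kchains F (Suc i) j. (\<lambda>\<sigma>. c \<sigma> - kd b \<sigma>) \<in> kchains N i j"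
        using N_iff b' by blast
    qed
  qed
qed

text \<open>The connecting map, using acyclicity of \<open>F\<close> in degree \<open>i + 1\<close>
  alone. This form also covers \<open>i = 0\<close>, where a free module may have homology.\<close>

lemma hk_zero_Suc_iff:
  assumes F: "graded_mod V F" and N: "graded_mod V N" and NF: "\<And>d. N d \<subseteq> F d"
    and ac: "hk_zero F zero_mod (Suc i) j"
  shows "hk_zero F N (Suc i) j \<longleftrightarrow>
    (\<forall>c\<in>kchains F (Suc i) j. kd c \<in> kchains N i j \<longrightarrow> (\<exists>b\<in>kchains N (Suc i) j. kd b = kd c))"
proof
  assume h: "hk_zero F N (Suc i) j"
  show "\<forall>c\<in>kchains F (Suc i) j. kd c \<in> kchains N i j \<longrightarrow> (\<exists>b\<in>kchains N (Suc i) j. kd b = kd c)"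
  proof (intro ballI impI)
    fix c assume c: "c \<in> kchains F (Suc i) j" "kd c \<in> kchains N i j"
    then obtain b where b: "b \<in> kchains F (Suc (Suc i)) j" "(\<lambda>\<sigma>. c \<sigma> - kd b \<sigma>) \<in> kchains N (Suc i) j"
      using h unfolding hk_zero_def by auto
    moreover have "kd (\<lambda>\<sigma>. c \<sigma> - kd b \<sigma>) = kd c" by (simp add: kd_diff kd_kd[OF b(1)])
    ultimately show "\<exists>b\<in>kchains N (Suc i) j. kd b = kd c" by blast
  qed
next
  assume h: "\<forall>c\<in>kchains F (Suc i) j. kd c \<in> kchains N i j \<longrightarrow> (\<exists>b\<in>kchains N (Suc i) j. kd b = kd c)"
  show "hk_zero F N (Suc i) j"
    unfolding hk_zero_def
  proof (intro ballI impI)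
    fix c assume c: "c \<in> kchains F (Suc i) j" "kd c \<in> kchains N (Suc i - 1) j"
    then obtain b where b: "b \<in> kchains N (Suc i) j" "kd b = kd c" using h by auto
    have "(\<lambda>\<sigma>. c \<sigma> - b \<sigma>) \<in> kchains F (Suc i) j"
      by (rule kchains_diff[OF F c(1) kchains_mono[of N F, OF NF, THEN subsetD, OF b(1)]])
    moreover have "kd (\<lambda>\<sigma>. c \<sigma> - b \<sigma>) = (\<lambda>\<sigma>. 0)" by (simp add: kd_diff b)
    ultimately obtain b' where b': "b' \<in> kchains F (Suc (Suc i)) j" "(\<lambda>\<sigma>. c \<sigma> - b \<sigma> - kd b' \<sigma>) = (\<lambda>\<sigma>. 0)"
      using ac[unfolded hk_zero_def kchains_zero_mod, rule_format, of "\<lambda>\<sigma>. c \<sigma> - b \<sigma>"] by blast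
    have "(\<lambda>\<sigma>. c \<sigma> - kd b' \<sigma>) = b" using b'(2) by (auto simp: fun_eq_iff algebra_simps)
    then show "\<exists>b\<in>kchains F (Suc (Suc i)) j. (\<lambda>\<sigma>. c \<sigma> - kd b \<sigma>) \<in> kchains N (Suc i) j"
      by (intro bexI[OF _ b'(1)]) (simp add: b(1))
  qed
qed

text \<open>The connecting homomorphism of \<open>0 \<rightarrow> N \<rightarrow> F \<rightarrow> F/N \<rightarrow> 0\<close>.\<close>

lemma hk_zero_connect:
  assumes F: "graded_mod V F" and N: "graded_mod V N" and NF: "\<And>d. N d \<subseteq> F d"
    and ac: "hk_zero F zero_mod (Suc i) j" "hk_zero F zero_mod i j"
  shows "hk_zero F N (Suc i) j \<longleftrightarrow> hk_zero N zero_mod i j"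
  unfolding hk_zero_Suc_iff[OF F N NF ac(1)]
proof
  assume h: "\<forall>c\<in>kchains F (Suc i) j. kd c \<in> kchains N i j \<longrightarrow> (\<exists>b\<in>kchains N (Suc i) j. kd b = kd c)"
  show "hk_zero N zero_mod i j"
    unfolding hk_zero_def kchains_zero_mod
  proof (intro ballI impI)
    fix c assume c: "c \<in> kchains N i j" "kd c = (\<lambda>\<sigma>. 0)"
    then have "c \<in> kchains F i j" using kchains_mono[of N F i j] NF by blast
    then obtain b where b: "b \<in> kchains F (Suc i) j" "(\<lambda>\<sigma>. c \<sigma> - kd b \<sigma>) = (\<lambda>\<sigma>. 0)"
      using ac(2) c unfolding hk_zero_def kchains_zero_mod by blast
    then have "kd b = c" by (auto simp: fun_eq_iff)
    then obtain b2 where b2: "b2 \<in> kchains N (Suc i) j" "kd b2 = c"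
      using h[rule_format, OF b(1)] c(1) by auto
    then show "\<exists>b\<in>kchains N (Suc i) j. (\<lambda>\<sigma>. c \<sigma> - kd b \<sigma>) = (\<lambda>\<sigma>. 0)"
      by (intro bexI[of _ b2]) (auto simp: fun_eq_iff)
  qed
next
  assume h: "hk_zero N zero_mod i j"
  show "\<forall>c\<in>kchains F (Suc i) j. kd c \<in> kchains N i j \<longrightarrow> (\<exists>b\<in>kchains N (Suc i) j. kd b = kd c)"
  proof (intro ballI impI)
    fix c assume c: "c \<in> kchains F (Suc i) j" "kd c \<in> kchains N i j"
    then obtain b where b: "b \<in> kchains N (Suc i) j" "(\<lambda>\<sigma>. kd c \<sigma> - kd b \<sigma>) = (\<lambda>\<sigma>. 0)"
      using h kd_kd[OF c(1)] unfolding hk_zero_def kchains_zero_mod by blast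
    then have "kd b = kd c" by (metis (no_types, lifting) ext eq_iff_diff_eq_0)
    with b show "\<exists>b\<in>kchains N (Suc i) j. kd b = kd c" by blast
  qed
qed

lemma kd_kchains_1:
  assumes A: "graded_mod V A"
  shows "(\<lambda>c. kd c {}) ` kchains A (Suc 0) j = max_mult V A j"
proof (intro equalityI subsetI)
  fix x assume "x \<in> (\<lambda>c. kd c {}) ` kchains A (Suc 0) j"
  then obtain c where c: "c \<in> kchains A (Suc 0) j" "x = kd c {}" by auto
  have "x = (\<Sum>v\<in>V. scale (var v) (c {v}))" by (simp add: c kd_eq_sum)
  moreover have "\<forall>v\<in>V. c {v} \<in> A (j - 1)"
    using kchainsD(1)[OF c(1), of "{_}"] by auto
  ultimately show "x \<in> max_mult V A j"
    unfolding max_mult_def by (intro CollectI exI[of _ "\<lambda>v. c {v}"]) simp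
next
  fix x assume "x \<in> max_mult V A j"
  then obtain q where q: "x = (\<Sum>v\<in>V. scale (var v) (q v))" "\<And>v. v \<in> V \<Longrightarrow> q v \<in> A (j - 1)"
    unfolding max_mult_def by auto
  define c where "c \<sigma> = (if \<sigma> \<subseteq> V \<and> card \<sigma> = Suc 0 then q (the_elem \<sigma>) else 0)" for \<sigma>
  have "c \<in> kchains A (Suc 0) j"
    unfolding kchains_def c_def using q(2) by (auto simp: card_Suc_eq)
  moreover have "kd c {} = x" by (simp add: kd_eq_sum c_def q(1) cong: sum.cong)
  ultimately show "x \<in> (\<lambda>c. kd c {}) ` kchains A (Suc 0) j" by blast
qed

lemma kchains_0_iff: "c \<in> kchains A 0 j \<longleftrightarrow> c {} \<in> A j \<and> (\<forall>\<sigma>. \<sigma> \<noteq> {} \<longrightarrow> c \<sigma> = 0)"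
proof -
  have "\<sigma> \<subseteq> V \<and> card \<sigma> = 0 \<longleftrightarrow> \<sigma> = {}" for \<sigma> using finite_V by (auto dest: finite_subset)
  then show ?thesis unfolding kchains_def by (auto split: if_splits)
qed

text \<open>Koszul homology in degree 0 is A/B modulo its multiple by the ideal of
  variables.\<close>

lemma hk_zero_0_iff:
  assumes A: "graded_mod V A" and B: "graded_mod V B"
  shows "hk_zero A B 0 j \<longleftrightarrow> (\<forall>x\<in>A j. \<exists>y\<in>max_mult V A j. x - y \<in> B j)"
proof
  assume h: "hk_zero A B 0 j"
  show "\<forall>x\<in>A j. \<exists>y\<in>max_mult V A j. x - y \<in> B j"
  proof
    fix x assume "x \<in> A j"
    then have c: "(\<lambda>\<sigma>. if \<sigma> = {} then x else 0) \<in> kchains A 0 j" by (simp add: kchains_0_iff)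
    then obtain b where "b \<in> kchains A (Suc 0) j" "(\<lambda>\<sigma>. (if \<sigma> = {} then x else 0) - kd b \<sigma>) \<in> kchains B 0 j"
      using h kd_kchains_0[OF c] kchains_zero[OF B] unfolding hk_zero_def by fastforce
    then show "\<exists>y\<in>max_mult V A j. x - y \<in> B j"
      unfolding kd_kchains_1[OF A, symmetric] kchains_0_iff by auto
  qed
next
  assume h: "\<forall>x\<in>A j. \<exists>y\<in>max_mult V A j. x - y \<in> B j"
  show "hk_zero A B 0 j"
    unfolding hk_zero_def
  proof (intro ballI impI)
    fix c assume c: "c \<in> kchains A 0 j"
    then obtain b where b: "b \<in> kchains A (Suc 0) j" "c {} - kd b {} \<in> B j"
      using h unfolding kd_kchains_1[OF A, symmetric] kchains_0_iff by blast
    have "kd b \<in> kchains A 0 j" using kd_kchains[OF A b(1)] by simp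
    then have "(\<lambda>\<sigma>. c \<sigma> - kd b \<sigma>) \<in> kchains B 0 j" using b c by (auto simp: kchains_0_iff)
    with b(1) show "\<exists>b\<in>kchains A (Suc 0) j. (\<lambda>\<sigma>. c \<sigma> - kd b \<sigma>) \<in> kchains B 0 j" by blast
  qed
qed

text \<open>The first Koszul homology of F/N is the kernel of the map from N/mN to F/mF, with m the
  ideal of variables. This serves twice: it matches the definition of Tor on a resolution, and it
  bounds the degrees in which \<open>N\<close> needs new generators.\<close>

lemma hk_zero_1_iff:
  assumes F: "graded_mod V F" and N: "graded_mod V N" and NF: "\<And>d. N d \<subseteq> F d"
    and ac: "hk_zero F zero_mod (Suc 0) j"
  shows "hk_zero F N (Suc 0) j \<longleftrightarrow> N j \<inter> max_mult V F j \<subseteq> max_mult V N j"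
proof -
  have kd0: "kd b = kd c \<longleftrightarrow> kd b {} = kd c {}" if "b \<in> kchains F (Suc 0) j" "c \<in> kchains F (Suc 0) j" for b c
    using kd_kchains[OF F that(1)] kd_kchains[OF F that(2)] by (auto simp: kchains_0_iff fun_eq_iff) metis
  have N0: "kd c \<in> kchains N 0 j \<longleftrightarrow> kd c {} \<in> N j" if "c \<in> kchains F (Suc 0) j" for c
    using kd_kchains[OF F that] by (auto simp: kchains_0_iff)
  have NF': "b \<in> kchains F (Suc 0) j" if "b \<in> kchains N (Suc 0) j" for b
    using kchains_mono[of N F, OF NF] that by blast
  show ?thesis
    unfolding hk_zero_Suc_iff[OF F N NF ac] kd_kchains_1[OF F, symmetric] kd_kchains_1[OF N, symmetric]
  proof (intro iffI subsetI ballI impI)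
    fix x assume h: "\<forall>c\<in>kchains F (Suc 0) j. kd c \<in> kchains N 0 j \<longrightarrow> (\<exists>b\<in>kchains N (Suc 0) j. kd b = kd c)"
      and "x \<in> N j \<inter> (\<lambda>c. kd c {}) ` kchains F (Suc 0) j"
    then obtain c where c: "x = kd c {}" "c \<in> kchains F (Suc 0) j" "kd c \<in> kchains N 0 j" using N0 by blast
    then obtain b where "b \<in> kchains N (Suc 0) j" "kd b = kd c" using h by blast
    then show "x \<in> (\<lambda>c. kd c {}) ` kchains N (Suc 0) j" using c by (metis imageI)
  next
    fix c assume h: "N j \<inter> (\<lambda>c. kd c {}) ` kchains F (Suc 0) j \<subseteq> (\<lambda>c. kd c {}) ` kchains N (Suc 0) j"
      and c: "c \<in> kchains F (Suc 0) j" "kd c \<in> kchains N 0 j"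
    have "kd c {} \<in> N j \<inter> (\<lambda>c. kd c {}) ` kchains F (Suc 0) j" using c N0 by blast
    then have "kd c {} \<in> (\<lambda>c. kd c {}) ` kchains N (Suc 0) j" using h by blast
    then obtain b where b: "b \<in> kchains N (Suc 0) j" "kd c {} = kd b {}" by blast
    then show "\<exists>b\<in>kchains N (Suc 0) j. kd b = kd c" using kd0[OF NF'[OF b(1)] c(1)] by auto
  qed
qed

end

section \<open>Koszul homology of monomial quotients, one multidegree at a time\<close>

lemma finite_monomials:
  assumes "finite V"
  shows "finite {m. keys m \<subseteq> V \<and> mon_deg m = n}" (is "finite ?M")
proof -
  have "finite {f. \<forall>v. (v \<in> V \<longrightarrow> f v \<in> {..n}) \<and> (v \<notin> V \<longrightarrow> f v = 0)}"
    by (rule finite_set_of_finite_funs) (use assms in auto)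
  moreover have "lookup ` ?M \<subseteq> {f. \<forall>v. (v \<in> V \<longrightarrow> f v \<in> {..n}) \<and> (v \<notin> V \<longrightarrow> f v = 0)}"
  proof
    fix f assume "f \<in> lookup ` ?M"
    then obtain m where f: "f = lookup m" and m: "keys m \<subseteq> V" "n = mon_deg m" by auto
    have "lookup m v \<le> mon_deg m" if "v \<in> V" for v
      unfolding mon_deg_superset[OF assms m(1)] using assms that by (intro member_le_sum) auto
    moreover have "lookup m v = 0" if "v \<notin> V" for v
      using m that by (auto simp: in_keys_iff)
    ultimately show "f \<in> {f. \<forall>v. (v \<in> V \<longrightarrow> f v \<in> {..n}) \<and> (v \<notin> V \<longrightarrow> f v = 0)}"
      by (simp add: f m(2))
  qed
  ultimately have "finite (lookup ` ?M)" by (rule rev_finite_subset)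
  then show ?thesis by (rule finite_imageD) (auto simp: inj_on_def intro: poly_mapping_eqI)
qed

lemma lookup_var_mult:
  fixes v :: 'a
  shows "lookup (var v * p) m =
    (if v \<in> keys m then lookup p (m - single v 1) else 0)"
proof -
  let ?v = "single v 1 :: 'a \<Rightarrow>\<^sub>0 nat"
  have "var v * p = (\<Sum>k\<in>keys p. single (?v + k) (lookup p k))"
    by (subst poly_mapping_sum_single[of p, symmetric]) (simp add: sum_distrib_left var_def mult_single)
  then have L: "lookup (var v * p) m =
      (\<Sum>k\<in>keys p. if ?v + k = m then lookup p k else 0)"
    by (simp add: lookup_sum lookup_single when_def)
  show ?thesis
  proof (cases "v \<in> keys m")
    case True
    have "?v + k = m \<longleftrightarrow> k = m - ?v" for k
    proof
      assume k: "k = m - ?v"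
      show "?v + k = m"
        by (rule poly_mapping_eqI) (use True in \<open>auto simp: k lookup_add lookup_minus lookup_single when_def in_keys_iff\<close>)
    qed auto
    then show ?thesis using True by (auto simp: L in_keys_iff)
  next
    case False
    have "?v + k \<noteq> m" for k
      using False by (auto simp: keys_add_nat)
    then show ?thesis using False by (simp add: L)
  qed
qed

definition ind :: "'a set \<Rightarrow> 'a \<Rightarrow>\<^sub>0 nat" where
  "ind \<sigma> = (\<Sum>v\<in>\<sigma>. single v 1)"

lemma lookup_ind: "finite \<sigma> \<Longrightarrow> lookup (ind \<sigma>) u = (if u \<in> \<sigma> then 1 else 0)"
  by (simp add: ind_def lookup_sum lookup_single when_def)

lemma keys_ind: "finite \<sigma> \<Longrightarrow> keys (ind \<sigma>) = \<sigma>"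
  by (auto simp: in_keys_iff lookup_ind split: if_splits)

lemma mon_deg_ind: "finite \<sigma> \<Longrightarrow> mon_deg (ind \<sigma>) = card \<sigma>"
  by (simp add: mon_deg_def keys_ind lookup_ind)

lemma add_minus_ind:
  assumes "finite \<sigma>" "\<sigma> \<subseteq> keys m"
  shows "m - ind \<sigma> + ind \<sigma> = m"
  by (rule poly_mapping_eqI) (use assms in \<open>auto simp: lookup_add lookup_minus lookup_ind in_keys_iff Suc_le_eq\<close>)

lemma minus_ind_insert:
  assumes "finite \<sigma>" "v \<notin> \<sigma>"
  shows "m - ind \<sigma> - single v 1 = m - ind (insert v \<sigma>)"
  by (rule poly_mapping_eqI) (use assms in \<open>auto simp: lookup_minus lookup_ind lookup_single when_def\<close>)

lemma mon_deg_minus_ind: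
  assumes "finite \<sigma>" "\<sigma> \<subseteq> keys m"
  shows "int (mon_deg (m - ind \<sigma>)) = int (mon_deg m) - int (card \<sigma>)"
  using arg_cong[OF add_minus_ind[OF assms], of mon_deg] by (simp add: mon_deg_add mon_deg_ind assms)

lemma keys_minus_nat: "keys (m - m' :: 'a \<Rightarrow>\<^sub>0 nat) \<subseteq> keys m"
  by (auto simp: in_keys_iff lookup_minus)

text \<open>Coordinates from \<open>r\<close> on vanish, so free modules of every rank sit in one
  type of sequences.\<close>

definition free_piece :: "'a set \<Rightarrow> nat \<Rightarrow> (nat \<Rightarrow> int) \<Rightarrow> ('a, 'k::field) pieces" where
  "free_piece V r s d = {x. (\<forall>l<r. x l \<in> hom_piece V (d - s l)) \<and> (\<forall>l\<ge>r. x l = 0)}"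

text \<open>\<open>J\<close> is the set of monomials of a monomial ideal.\<close>

definition mono_piece ::
  "'a set \<Rightarrow> nat \<Rightarrow> (nat \<Rightarrow> int) \<Rightarrow> ('a \<Rightarrow>\<^sub>0 nat) set \<Rightarrow> ('a, 'k::field) pieces" where
  "mono_piece V r s J d = {x \<in> free_piece V r s d. \<forall>l. keys (x l) \<subseteq> J}"

definition mono_ideal :: "('a \<Rightarrow>\<^sub>0 nat) set \<Rightarrow> bool" where
  "mono_ideal J \<longleftrightarrow> (\<forall>m\<in>J. \<forall>m'. m + m' \<in> J)"

lemma graded_mod_free_piece: "graded_mod V (free_piece V r s)"
  unfolding graded_mod_def free_piece_def
  by (auto intro: hom_piece_diff hom_piece_mult[OF hom_piece_var])

lemma graded_mod_mono_piece:
  assumes "mono_ideal J"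
  shows "graded_mod V (mono_piece V r s J)"
  unfolding graded_mod_def
proof (intro allI conjI ballI)
  fix d and x y :: "nat \<Rightarrow> ('a, 'b) mpoly"
  assume "x \<in> mono_piece V r s J d" "y \<in> mono_piece V r s J d"
  then show "x - y \<in> mono_piece V r s J d"
    using graded_mod_diff[OF graded_mod_free_piece, of x V r s d y] keys_minus_subset[of "x _" "y _"]
    unfolding mono_piece_def by (fastforce simp: subset_iff)
next
  fix d v and x :: "nat \<Rightarrow> ('a, 'b) mpoly"
  assume v: "v \<in> V" and x: "x \<in> mono_piece V r s J d"
  have "scale (var v) x \<in> free_piece V r s (d + 1)"
    using graded_mod_var[OF graded_mod_free_piece v, of x r s "d + 1"] x by (auto simp: mono_piece_def)
  moreover have "keys (scale (var v) x l) \<subseteq> J" for l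
  proof
    fix m assume "m \<in> keys (scale (var v) x l)"
    then obtain a b where "m = a + b" "b \<in> keys (x l)"
      using keys_mult[of "var v" "x l"] by auto
    moreover have "b \<in> J" using calculation x by (auto simp: mono_piece_def)
    ultimately show "m \<in> J" using assms unfolding mono_ideal_def by (metis add.commute)
  qed
  ultimately show "scale (var v) x \<in> mono_piece V r s J (d + 1)" by (auto simp: mono_piece_def)
qed (auto simp: mono_piece_def graded_mod_zero[OF graded_mod_free_piece])

context ordered_vars
begin

text \<open>One coordinate of a Koszul chain with values in a free module; \<open>e\<close> is the
  total degree minus the shift of that coordinate.\<close>

definition schains :: "int \<Rightarrow> nat \<Rightarrow> ('a set \<Rightarrow> ('a, 'k::field) mpoly) \<Rightarrow> bool" where
  "schains e i c \<longleftrightarrow> (\<forall>\<sigma>. if \<sigma> \<subseteq> V \<and> card \<sigma> = i then c \<sigma> \<in> hom_piece V (e - int i) else c \<sigma> = 0)"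

lemma schainsD:
  "schains e i c \<Longrightarrow> \<sigma> \<subseteq> V \<Longrightarrow> card \<sigma> = i \<Longrightarrow> c \<sigma> \<in> hom_piece V (e - int i)"
  "schains e i c \<Longrightarrow> \<not> (\<sigma> \<subseteq> V \<and> card \<sigma> = i) \<Longrightarrow> c \<sigma> = 0"
  by (auto simp: schains_def split: if_splits)

lemma kchains_free_piece:
  "c \<in> kchains (free_piece V r s) i j \<longleftrightarrow>
    (\<forall>l<r. schains (j - s l) i (\<lambda>\<sigma>. c \<sigma> l)) \<and> (\<forall>l\<ge>r. \<forall>\<sigma>. c \<sigma> l = 0)"
proof
  assume c: "c \<in> kchains (free_piece V r s) i j"
  have 1: "c \<sigma> l \<in> hom_piece V (j - s l - int i)" if "\<sigma> \<subseteq> V" "card \<sigma> = i" "l < r" for \<sigma> l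
    using kchainsD(1)[OF c that(1,2)] that(3) by (auto simp: free_piece_def algebra_simps)
  have 2: "c \<sigma> l = 0" if "l \<ge> r" for \<sigma> l
    using kchainsD[OF c, of \<sigma>] that by (cases "\<sigma> \<subseteq> V \<and> card \<sigma> = i") (auto simp: free_piece_def)
  show "(\<forall>l<r. schains (j - s l) i (\<lambda>\<sigma>. c \<sigma> l)) \<and> (\<forall>l\<ge>r. \<forall>\<sigma>. c \<sigma> l = 0)"
    unfolding schains_def using 1 2 kchainsD(2)[OF c] by auto
next
  assume c: "(\<forall>l<r. schains (j - s l) i (\<lambda>\<sigma>. c \<sigma> l)) \<and> (\<forall>l\<ge>r. \<forall>\<sigma>. c \<sigma> l = 0)"
  show "c \<in> kchains (free_piece V r s) i j"
  proof (rule kchainsI)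
    fix \<sigma> assume "\<sigma> \<subseteq> V" "card \<sigma> = i"
    then show "c \<sigma> \<in> free_piece V r s (j - int i)"
      using c schainsD(1)[of "j - s _" i "\<lambda>\<sigma>. c \<sigma> _" \<sigma>] by (fastforce simp: free_piece_def algebra_simps)
  next
    fix \<sigma> assume "\<not> (\<sigma> \<subseteq> V \<and> card \<sigma> = i)"
    then have "c \<sigma> l = 0" for l
      using c schainsD(2)[of "j - s l" i "\<lambda>\<sigma>. c \<sigma> l" \<sigma>] by (cases "l < r") auto
    then show "c \<sigma> = 0" by (simp add: fun_eq_iff)
  qed
qed

lemma schains_bd:
  assumes "schains e i c" shows "schains e (i - 1) (bd var c)"
proof -
  define c' where "c' \<sigma> = (\<lambda>l::nat. if l = 0 then c \<sigma> else 0)" for \<sigma>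
  have "c' \<in> kchains (free_piece V 1 (\<lambda>_. 0)) i e"
    using assms by (simp add: kchains_free_piece c'_def)
  then have "kd c' \<in> kchains (free_piece V 1 (\<lambda>_. 0)) (i - 1) e"
    by (rule kd_kchains[OF graded_mod_free_piece])
  then show ?thesis by (simp add: kchains_free_piece kd_def c'_def)
qed

text \<open>The multidegree-\<open>m\<close> part of a Koszul chain.\<close>

definition slice :: "('a \<Rightarrow>\<^sub>0 nat) \<Rightarrow> ('a set \<Rightarrow> ('a, 'k::field) mpoly) \<Rightarrow> 'a set \<Rightarrow> 'k" where
  "slice m c \<sigma> = (if \<sigma> \<subseteq> keys m then lookup (c \<sigma>) (m - ind \<sigma>) else 0)"

text \<open>Indexes a basis of the multidegree \<open>m\<close> part of the Koszul complex modulo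
  \<open>J\<close>. It is the complement, among subsets of the support of \<open>m\<close>, of the
  upper Koszul simplicial complex of the ideal.\<close>

definition supp_fam :: "('a \<Rightarrow>\<^sub>0 nat) set \<Rightarrow> ('a \<Rightarrow>\<^sub>0 nat) \<Rightarrow> 'a set set" where
  "supp_fam J m = {\<sigma>. \<sigma> \<subseteq> keys m \<and> m - ind \<sigma> \<notin> J}"

text \<open>Multiplication by \<open>var v\<close> carries exponent
  \<open>m - ind (insert v \<tau>)\<close> to \<open>m - ind \<tau>\<close>, so fixing
  \<open>m\<close> turns the Koszul differential into the plain boundary map.\<close>

lemma bd_slice:
  assumes "\<tau> \<subseteq> keys m"
  shows "bd (\<lambda>_. 1) (slice m c) \<tau> = lookup (bd var c \<tau>) (m - ind \<tau>)"
proof -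
  have fin: "finite \<tau>" using assms finite_keys finite_subset by blast
  have "lookup (eps v \<tau> * var v * c (insert v \<tau>)) (m - ind \<tau>) = eps v \<tau> * 1 * slice m c (insert v \<tau>)"
    if v: "v \<in> V - \<tau>" for v
  proof -
    have "v \<in> keys (m - ind \<tau>) \<longleftrightarrow> v \<in> keys m"
      using v fin by (simp add: in_keys_iff lookup_minus lookup_ind)
    then have "lookup (var v * c (insert v \<tau>)) (m - ind \<tau>) = slice m c (insert v \<tau>)"
      using v fin assms by (simp add: lookup_var_mult minus_ind_insert[unfolded One_nat_def] slice_def)
    then show ?thesis
      using eps_cases[of v \<tau>, where ?'b = 'b] eps_cases[of v \<tau>, where ?'b = "('a, 'b) mpoly"]
      by (cases "even (card {u \<in> \<tau>. idx u < idx v})") (simp_all add: eps_def)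
  qed
  then show ?thesis by (simp add: bd_def lookup_sum)
qed

lemma supp_fam_insert:
  assumes J: "mono_ideal J" and \<tau>: "\<tau> \<in> supp_fam J m" and v: "v \<notin> \<tau>" "v \<in> keys m"
  shows "insert v \<tau> \<in> supp_fam J m"
proof -
  have sub: "\<tau> \<subseteq> keys m" using \<tau> by (simp add: supp_fam_def)
  then have fin: "finite \<tau>" using finite_keys finite_subset by blast
  have "m - ind (insert v \<tau>) + single v 1 = m - ind \<tau>"
    by (rule poly_mapping_eqI)
      (use fin v in \<open>auto simp: lookup_add lookup_minus lookup_ind lookup_single when_def in_keys_iff\<close>)
  moreover have "m - ind \<tau> \<notin> J" using \<tau> by (simp add: supp_fam_def)
  ultimately have "m - ind (insert v \<tau>) \<notin> J" using J unfolding mono_ideal_def by metis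
  then show ?thesis using sub v by (simp add: supp_fam_def)
qed

text \<open>The family is closed under enlarging inside the support of \<open>m\<close>, so the
  boundary at a member sees only members.\<close>

lemma bd_restrict_supp_fam:
  assumes J: "mono_ideal J" and \<tau>: "\<tau> \<in> supp_fam J m"
    and f: "\<And>\<sigma>. \<not> \<sigma> \<subseteq> keys m \<Longrightarrow> f \<sigma> = 0"
  shows "bd (\<lambda>_. 1) (\<lambda>\<sigma>. if \<sigma> \<in> supp_fam J m then f \<sigma> else 0) \<tau> = bd (\<lambda>_. 1) f \<tau>"
  unfolding bd_def
proof (rule sum.cong)
  fix v assume "v \<in> V - \<tau>"
  then have "insert v \<tau> \<in> supp_fam J m \<or> f (insert v \<tau>) = 0"
    using supp_fam_insert[OF J \<tau>, of v] f[of "insert v \<tau>"] by auto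
  then show "eps v \<tau> * 1 * (if insert v \<tau> \<in> supp_fam J m then f (insert v \<tau>) else 0) = eps v \<tau> * 1 * f (insert v \<tau>)"
    by auto
qed simp

text \<open>Each of the finitely many multidegrees of total degree \<open>e\<close> is a separate
  problem over the field; the solutions \<open>h m\<close> are reassembled with the monomials they
  stand for.\<close>

lemma schains_exact:
  fixes c :: "'a set \<Rightarrow> ('a, 'k::field) mpoly"
  assumes J: "mono_ideal J" and c: "schains e i c" and cyc: "\<And>\<tau>. keys (bd var c \<tau>) \<subseteq> J"
    and ac: "\<And>m. keys m \<subseteq> V \<Longrightarrow> int (mon_deg m) = e \<Longrightarrow> acyclic_at TYPE('k) (supp_fam J m) i"
  shows "\<exists>b. schains e (Suc i) b \<and> (\<forall>\<sigma>. keys (c \<sigma> - bd var b \<sigma>) \<subseteq> J)"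
proof -
  define Ms where "Ms = {m. keys m \<subseteq> V \<and> int (mon_deg m) = e}"
  have "Ms \<subseteq> {m. keys m \<subseteq> V \<and> mon_deg m = nat e}" by (auto simp: Ms_def)
  then have finM: "finite Ms" using finite_monomials[OF finite_V] finite_subset by blast
  define g where "g m \<sigma> = (if \<sigma> \<in> supp_fam J m then slice m c \<sigma> else 0)" for m \<sigma>
  have "\<exists>h. chains (supp_fam J m) (Suc i) h \<and> (\<forall>\<tau>\<in>supp_fam J m. bd (\<lambda>_. 1) h \<tau> = g m \<tau>)" if m: "m \<in> Ms" for m
  proof -
    have "chains (supp_fam J m) i (g m)"
      unfolding chains_def
    proof (intro allI impI)
      fix \<sigma> assume "g m \<sigma> \<noteq> 0"
      then have "\<sigma> \<in> supp_fam J m" "c \<sigma> \<noteq> 0" by (auto simp: g_def slice_def split: if_splits)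
      then show "\<sigma> \<in> supp_fam J m \<and> card \<sigma> = i" using schainsD(2)[OF c, of \<sigma>] by auto
    qed
    moreover have "bd (\<lambda>_. 1) (g m) \<tau> = 0" if \<tau>: "\<tau> \<in> supp_fam J m" for \<tau>
    proof -
      have "bd (\<lambda>_. 1) (g m) \<tau> = bd (\<lambda>_. 1) (slice m c) \<tau>"
        unfolding g_def by (rule bd_restrict_supp_fam[OF J \<tau>]) (simp add: slice_def)
      also have "\<dots> = lookup (bd var c \<tau>) (m - ind \<tau>)"
        using \<tau> by (intro bd_slice) (simp add: supp_fam_def)
      also have "\<dots> = 0" using \<tau> cyc[of \<tau>] by (auto simp: supp_fam_def in_keys_iff)
      finally show ?thesis .
    qed
    ultimately show ?thesis using ac[of m] m unfolding acyclic_at_def Ms_def by blast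
  qed
  then obtain h where h: "\<And>m. m \<in> Ms \<Longrightarrow> chains (supp_fam J m) (Suc i) (h m)"
    and bh: "\<And>m \<tau>. m \<in> Ms \<Longrightarrow> \<tau> \<in> supp_fam J m \<Longrightarrow> bd (\<lambda>_. 1) (h m) \<tau> = g m \<tau>" by metis
  define b where "b \<sigma> = (\<Sum>m\<in>{m \<in> Ms. \<sigma> \<subseteq> keys m}. single (m - ind \<sigma>) (h m \<sigma>))" for \<sigma>
  have finK: "finite \<sigma>" if "\<sigma> \<subseteq> keys m" for \<sigma> and m :: "'a \<Rightarrow>\<^sub>0 nat"
    using that finite_keys finite_subset by blast
  have b: "schains e (Suc i) b"
    unfolding schains_def
  proof (intro allI)
    fix \<sigma>
    show "if \<sigma> \<subseteq> V \<and> card \<sigma> = Suc i then b \<sigma> \<in> hom_piece V (e - int (Suc i)) else b \<sigma> = 0"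
    proof (cases "\<sigma> \<subseteq> V \<and> card \<sigma> = Suc i")
      case True
      have "b \<sigma> \<in> hom_piece V (e - int (Suc i))"
        unfolding b_def
      proof (rule hom_piece_sum, rule hom_piece_single)
        fix m assume m: "m \<in> {m \<in> Ms. \<sigma> \<subseteq> keys m}"
        then show "keys (m - ind \<sigma>) \<subseteq> V" using keys_minus_nat[of m "ind \<sigma>"] by (auto simp: Ms_def)
        show "int (mon_deg (m - ind \<sigma>)) = e - int (Suc i)"
          using m True finK[of \<sigma> m] by (simp add: mon_deg_minus_ind Ms_def)
      qed
      then show ?thesis using True by simp
    next
      case False
      have "h m \<sigma> = 0" if "m \<in> Ms" "\<sigma> \<subseteq> keys m" for m
        using h[OF that(1)] that False by (auto simp: chains_def Ms_def)
      then show ?thesis using False by (simp add: b_def)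
    qed
  qed
  \<comment> \<open>For fixed \<open>\<sigma>\<close>, different \<open>m\<close> give different
    exponents \<open>m - ind \<sigma>\<close>, so multidegrees do not interfere.\<close>
  have slice_b: "slice m b = h m" if m: "m \<in> Ms" for m
  proof
    fix \<sigma>
    show "slice m b \<sigma> = h m \<sigma>"
    proof (cases "\<sigma> \<subseteq> keys m")
      case True
      note fin = finK[OF True]
      have "lookup (b \<sigma>) (m - ind \<sigma>)
          = (\<Sum>m'\<in>{m \<in> Ms. \<sigma> \<subseteq> keys m}. if m' = m then h m \<sigma> else 0)"
        unfolding b_def lookup_sum
      proof (rule sum.cong)
        fix m' assume m': "m' \<in> {m \<in> Ms. \<sigma> \<subseteq> keys m}"
        have "m' - ind \<sigma> = m - ind \<sigma> \<longleftrightarrow> m' = m"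
          using add_minus_ind[OF fin, of m'] add_minus_ind[OF fin True] m' by (metis (lifting) mem_Collect_eq)
        then show "lookup (single (m' - ind \<sigma>) (h m' \<sigma>)) (m - ind \<sigma>) = (if m' = m then h m \<sigma> else 0)"
          by (auto simp: lookup_single when_def)
      qed simp
      then show ?thesis using True m finM by (simp add: slice_def)
    next
      case False
      then show ?thesis using h[OF m] by (auto simp: slice_def chains_def supp_fam_def)
    qed
  qed
  have "keys (c \<sigma> - bd var b \<sigma>) \<subseteq> J" for \<sigma>
  proof
    fix \<mu> assume \<mu>: "\<mu> \<in> keys (c \<sigma> - bd var b \<sigma>)"
    show "\<mu> \<in> J"
    proof (rule ccontr)
      assume nJ: "\<mu> \<notin> J"
      have sb: "schains e i (bd var b)" using schains_bd[OF b] by simp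
      have "\<sigma> \<subseteq> V \<and> card \<sigma> = i"
        using \<mu> schainsD(2)[OF c, of \<sigma>] schainsD(2)[OF sb, of \<sigma>] by (cases "\<sigma> \<subseteq> V \<and> card \<sigma> = i") auto
      then have \<sigma>: "\<sigma> \<subseteq> V" "card \<sigma> = i" "finite \<sigma>" using finite_V finite_subset by auto
      have "c \<sigma> - bd var b \<sigma> \<in> hom_piece V (e - int i)"
        using schainsD(1)[OF c \<sigma>(1,2)] schainsD(1)[OF sb \<sigma>(1,2)] by (rule hom_piece_diff)
      then have deg: "keys \<mu> \<subseteq> V" "int (mon_deg \<mu>) = e - int i" using \<mu> by (auto simp: hom_piece_iff)
      define m where "m = \<mu> + ind \<sigma>"
      have m: "m \<in> Ms" "\<sigma> \<subseteq> keys m" "m - ind \<sigma> = \<mu>"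
        using deg \<sigma> by (auto simp: Ms_def m_def keys_add_nat keys_ind mon_deg_add mon_deg_ind)
      have U: "\<sigma> \<in> supp_fam J m" using m nJ by (simp add: supp_fam_def)
      have "lookup (bd var b \<sigma>) \<mu> = bd (\<lambda>_. 1) (slice m b) \<sigma>"
        using bd_slice[OF m(2), of b] m by simp
      also have "\<dots> = slice m c \<sigma>" using bh[OF m(1) U] U by (simp add: slice_b[OF m(1)] g_def)
      also have "\<dots> = lookup (c \<sigma>) \<mu>" using m by (simp add: slice_def)
      finally show False using \<mu> by (simp add: in_keys_iff lookup_minus)
    qed
  qed
  with b show ?thesis by blast
qed

lemma hk_zero_mono_piece:
  assumes J: "mono_ideal J"
    and ac: "\<And>l m. l < r \<Longrightarrow> keys m \<subseteq> V \<Longrightarrow> int (mon_deg m) = j - s l \<Longrightarrow>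
      acyclic_at TYPE('k::field) (supp_fam J m) i"
  shows "hk_zero (free_piece V r s :: ('a, 'k) pieces) (mono_piece V r s J) i j"
  unfolding hk_zero_def
proof (intro ballI impI)
  fix c :: "'a set \<Rightarrow> nat \<Rightarrow> ('a, 'k) mpoly"
  assume c: "c \<in> kchains (free_piece V r s) i j" and dc: "kd c \<in> kchains (mono_piece V r s J) (i - 1) j"
  have cyc: "keys (bd var (\<lambda>\<sigma>. c \<sigma> l) \<tau>) \<subseteq> J" for l \<tau>
  proof -
    have "kd c \<tau> l = bd var (\<lambda>\<sigma>. c \<sigma> l) \<tau>" by (simp add: kd_def)
    moreover have "keys (kd c \<tau> l) \<subseteq> J"
      using kchainsD[OF dc, of \<tau>] by (cases "\<tau> \<subseteq> V \<and> card \<tau> = i - 1") (auto simp: mono_piece_def)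
    ultimately show ?thesis by simp
  qed
  have "\<exists>b. schains (j - s l) (Suc i) b \<and> (\<forall>\<sigma>. keys (c \<sigma> l - bd var b \<sigma>) \<subseteq> J)" if l: "l < r" for l
    using c l by (intro schains_exact[OF J _ cyc ac[OF l]]) (auto simp: kchains_free_piece)
  then obtain B where B: "\<And>l. l < r \<Longrightarrow> schains (j - s l) (Suc i) (B l)"
    "\<And>l \<sigma>. l < r \<Longrightarrow> keys (c \<sigma> l - bd var (B l) \<sigma>) \<subseteq> J" by metis
  define b where "b \<sigma> l = (if l < r then B l \<sigma> else 0)" for \<sigma> l
  have b: "b \<in> kchains (free_piece V r s) (Suc i) j" using B by (simp add: kchains_free_piece b_def)
  have "kd b \<in> kchains (free_piece V r s) i j" using kd_kchains[OF graded_mod_free_piece b] by simp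
  then have d: "(\<lambda>\<sigma>. c \<sigma> - kd b \<sigma>) \<in> kchains (free_piece V r s) i j"
    by (rule kchains_diff[OF graded_mod_free_piece c])
  have keys: "keys ((c \<sigma> - kd b \<sigma>) l) \<subseteq> J" for \<sigma> l
  proof (cases "l < r")
    case True
    then show ?thesis using B(2)[OF True, of \<sigma>] by (simp add: kd_def b_def)
  next
    case False
    have "(c \<sigma> - kd b \<sigma>) l = 0" using d False unfolding kchains_free_piece by auto
    then show ?thesis by simp
  qed
  have "(\<lambda>\<sigma>. c \<sigma> - kd b \<sigma>) \<in> kchains (mono_piece V r s J) i j"
  proof (rule kchainsI)
    fix \<sigma> assume "\<sigma> \<subseteq> V" "card \<sigma> = i"
    from kchainsD(1)[OF d this] show "c \<sigma> - kd b \<sigma> \<in> mono_piece V r s J (j - int i)"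
      using keys[of \<sigma>] by (simp add: mono_piece_def)
  qed (rule kchainsD(2)[OF d])
  with b show "\<exists>b\<in>kchains (free_piece V r s) (Suc i) j. (\<lambda>\<sigma>. c \<sigma> - kd b \<sigma>) \<in> kchains (mono_piece V r s J) i j"
    by blast
qed

text \<open>Take \<open>J = {}\<close>: the family at \<open>m\<close> consists of all subsets of
  the support, a cone unless \<open>m = 0\<close>, and for \<open>m = 0\<close> only degree 0
  carries chains.\<close>

lemma hk_zero_free_piece:
  assumes "i \<ge> 1"
  shows "hk_zero (free_piece V r s :: ('a, 'k::field) pieces) zero_mod i j"
proof -
  have "mono_piece V r s {} d = zero_mod d" for d
    by (auto simp: mono_piece_def zero_mod_def fun_eq_iff graded_mod_zero[OF graded_mod_free_piece])
  then have eq: "mono_piece V r s {} = zero_mod" by (rule ext)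
  have "acyclic_at TYPE('k) (supp_fam {} m) i" if m: "keys m \<subseteq> V" for m
  proof (cases "m = 0")
    case True
    have "g = (\<lambda>_. 0)" if "chains {{}} i g" for g :: "'a set \<Rightarrow> 'k"
      using that assms unfolding chains_def fun_eq_iff by (metis card.empty not_one_le_zero singletonD)
    moreover have "supp_fam {} m = {{}}" by (auto simp: supp_fam_def True)
    ultimately show ?thesis by (auto simp: acyclic_at_def chains_def intro!: exI[of _ "\<lambda>_. 0"])
  next
    case False
    then have "keys m \<noteq> {}" by simp
    then obtain t where t: "t \<in> keys m" by blast
    then show ?thesis using m by (intro acyclic_at_cone[where t = t]) (auto simp: supp_fam_def)
  qed
  then have "hk_zero (free_piece V r s :: ('a, 'k) pieces) (mono_piece V r s {}) i j"
    by (intro hk_zero_mono_piece) (auto simp: mono_ideal_def)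
  then show ?thesis by (simp add: eq)
qed

text \<open>The converse passage in rank one: a cycle of the family becomes a Koszul chain by
  attaching to each \<open>\<sigma>\<close> the complementary exponent
  \<open>m - ind \<sigma>\<close>.\<close>

lemma acyclic_at_supp_fam:
  fixes m :: "'a \<Rightarrow>\<^sub>0 nat"
  assumes J: "mono_ideal J" and m: "keys m \<subseteq> V" "int (mon_deg m) = j"
    and hk: "hk_zero (free_piece V 1 (\<lambda>_. 0) :: ('a, 'k::field) pieces) (mono_piece V 1 (\<lambda>_. 0) J) i j"
  shows "acyclic_at TYPE('k) (supp_fam J m) i"
  unfolding acyclic_at_def
proof (intro allI impI)
  let ?U = "supp_fam J m" and ?F = "free_piece V 1 (\<lambda>_. 0)" and ?I = "mono_piece V 1 (\<lambda>_. 0) J"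
  fix g :: "'a set \<Rightarrow> 'k" assume g: "chains ?U i g" and cyc: "\<forall>\<tau>\<in>?U. bd (\<lambda>_. 1) g \<tau> = 0"
  have finK: "finite \<sigma>" if "\<sigma> \<subseteq> keys m" for \<sigma>
    using that finite_keys finite_subset by blast
  define c where "c \<sigma> = (if \<sigma> \<subseteq> keys m then single (m - ind \<sigma>) (g \<sigma>) else 0)" for \<sigma>
  define cv where "cv \<sigma> = (\<lambda>l::nat. if l = 0 then c \<sigma> else 0)" for \<sigma>
  have g0: "g \<sigma> = 0" if "\<not> \<sigma> \<subseteq> keys m" for \<sigma>
    using g that by (auto simp: chains_def supp_fam_def)
  have slice_c: "slice m c = g" using g0 by (auto simp: slice_def c_def fun_eq_iff)
  have sc: "schains j i c"
    unfolding schains_def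
  proof (intro allI)
    fix \<sigma>
    show "if \<sigma> \<subseteq> V \<and> card \<sigma> = i then c \<sigma> \<in> hom_piece V (j - int i) else c \<sigma> = 0"
    proof (cases "\<sigma> \<subseteq> keys m \<and> card \<sigma> = i")
      case True
      then have "c \<sigma> \<in> hom_piece V (j - int i)"
        using finK[of \<sigma>] keys_minus_nat[of m "ind \<sigma>"] m mon_deg_minus_ind[of \<sigma> m]
        by (simp add: c_def hom_piece_single)
      then show ?thesis using True m by auto
    next
      case False
      then have "c \<sigma> = 0" using chainsD(2)[OF g, of \<sigma>] by (auto simp: c_def)
      then show ?thesis by simp
    qed
  qed
  then have cv: "cv \<in> kchains ?F i j" by (simp add: kchains_free_piece cv_def)
  \<comment> \<open>The only monomial that can occur at \<open>\<tau>\<close> is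
    \<open>m - ind \<tau>\<close>, with the boundary of \<open>g\<close> as coefficient. If it
    occurs, \<open>\<tau>\<close> is not a member because \<open>g\<close> is a cycle, so the
    monomial lies in \<open>J\<close>.\<close>
  have keysJ: "keys (bd var c \<tau>) \<subseteq> J" for \<tau>
  proof
    fix \<mu> assume \<mu>: "\<mu> \<in> keys (bd var c \<tau>)"
    then obtain v where v: "v \<in> V - \<tau>" "\<mu> \<in> keys (eps v \<tau> * var v * c (insert v \<tau>))"
      unfolding bd_def using keys_sum by fast
    have "eps v \<tau> * var v * c (insert v \<tau>) = var v * c (insert v \<tau>) \<or>
        eps v \<tau> * var v * c (insert v \<tau>) = - (var v * c (insert v \<tau>))"
      by (cases "even (card {u \<in> \<tau>. idx u < idx v})") (simp_all add: eps_def)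
    then have "\<mu> \<in> keys (var v * c (insert v \<tau>))"
      using v(2) by (elim disjE) (simp_all only: keys_uminus)
    then have "lookup (var v * c (insert v \<tau>)) \<mu> \<noteq> 0" by (simp add: in_keys_iff)
    then have \<mu>v: "v \<in> keys \<mu>" "lookup (c (insert v \<tau>)) (\<mu> - single v 1) \<noteq> 0"
      by (auto simp: lookup_var_mult split: if_splits)
    then have sub: "insert v \<tau> \<subseteq> keys m" and eq: "\<mu> - single v 1 = m - ind (insert v \<tau>)"
      by (auto simp: c_def lookup_single when_def split: if_splits)
    have fin: "finite \<tau>" using finK[OF sub] by simp
    have "\<mu> = m - ind \<tau>"
    proof (rule poly_mapping_eqI)
      fix u
      have "lookup (\<mu> - single v 1) u = lookup (m - ind (insert v \<tau>)) u"
        by (simp only: eq)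
      then show "lookup \<mu> u = lookup (m - ind \<tau>) u"
        using \<mu>v(1) sub v fin
        by (auto simp: lookup_minus lookup_ind lookup_single when_def in_keys_iff split: if_splits)
    qed
    then have "bd (\<lambda>_. 1) g \<tau> \<noteq> 0"
      using bd_slice[of \<tau> m c] sub \<mu> by (simp add: slice_c in_keys_iff)
    then have "\<tau> \<notin> ?U" using cyc by auto
    then show "\<mu> \<in> J" using sub \<open>\<mu> = m - ind \<tau>\<close> by (auto simp: supp_fam_def)
  qed
  have "kd cv \<in> kchains ?I (i - 1) j"
  proof -
    note k = kd_kchains[OF graded_mod_free_piece cv]
    have keys: "keys (kd cv \<tau> l) \<subseteq> J" for \<tau> l
      using keysJ[of \<tau>] by (cases "l = 0") (auto simp: kd_def cv_def)
    show ?thesis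
    proof (rule kchainsI)
      fix \<tau> assume "\<tau> \<subseteq> V" "card \<tau> = i - 1"
      from kchainsD(1)[OF k this] show "kd cv \<tau> \<in> ?I (j - int (i - 1))"
        using keys[of \<tau>] by (simp add: mono_piece_def)
    qed (rule kchainsD(2)[OF k])
  qed
  from hk[unfolded hk_zero_def, rule_format, OF cv this]
  obtain b where b: "b \<in> kchains ?F (Suc i) j" and db: "(\<lambda>\<sigma>. cv \<sigma> - kd b \<sigma>) \<in> kchains ?I i j" by (elim bexE)
  define b0 where "b0 \<sigma> = b \<sigma> 0" for \<sigma>
  have sb: "schains j (Suc i) b0" using b by (simp add: kchains_free_piece b0_def[abs_def])
  define h where "h \<sigma> = (if \<sigma> \<in> ?U then slice m b0 \<sigma> else 0)" for \<sigma>
  have "chains ?U (Suc i) h"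
    unfolding chains_def
  proof (intro allI impI)
    fix \<sigma> assume "h \<sigma> \<noteq> 0"
    then have "\<sigma> \<in> ?U" "b0 \<sigma> \<noteq> 0" by (auto simp: h_def slice_def split: if_splits)
    then show "\<sigma> \<in> ?U \<and> card \<sigma> = Suc i" using schainsD(2)[OF sb, of \<sigma>] by auto
  qed
  moreover have "bd (\<lambda>_. 1) h \<tau> = g \<tau>" if \<tau>: "\<tau> \<in> ?U" for \<tau>
  proof -
    have sub: "\<tau> \<subseteq> keys m" "m - ind \<tau> \<notin> J" using \<tau> by (auto simp: supp_fam_def)
    have "bd (\<lambda>_. 1) h \<tau> = bd (\<lambda>_. 1) (slice m b0) \<tau>"
      unfolding h_def by (rule bd_restrict_supp_fam[OF J \<tau>]) (simp add: slice_def)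
    also have "\<dots> = lookup (bd var b0 \<tau>) (m - ind \<tau>)" by (rule bd_slice[OF sub(1)])
    also have "\<dots> = lookup (c \<tau>) (m - ind \<tau>)"
    proof -
      have "keys ((cv \<tau> - kd b \<tau>) 0) \<subseteq> J"
        using kchainsD[OF db, of \<tau>] by (cases "\<tau> \<subseteq> V \<and> card \<tau> = i") (auto simp: mono_piece_def)
      moreover have "(cv \<tau> - kd b \<tau>) 0 = c \<tau> - bd var b0 \<tau>" by (simp add: cv_def kd_def b0_def[abs_def])
      ultimately have "m - ind \<tau> \<notin> keys (c \<tau> - bd var b0 \<tau>)" using sub by auto
      then show ?thesis by (simp add: in_keys_iff lookup_minus)
    qed
    also have "\<dots> = g \<tau>" using sub by (simp add: c_def)
    finally show ?thesis .
  qed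
  ultimately show "\<exists>h. chains ?U (Suc i) h \<and> (\<forall>\<tau>\<in>?U. bd (\<lambda>_. 1) h \<tau> = g \<tau>)" by blast
qed

lemma hk_zero_below:
  assumes "\<And>d. d < 0 \<Longrightarrow> A d = {0}" "graded_mod V A" "graded_mod V B" "j < int i"
  shows "hk_zero A B i j"
  unfolding hk_zero_def
proof (intro ballI impI)
  fix c assume c: "c \<in> kchains A i j"
  have "c \<sigma> = 0" for \<sigma>
    using kchainsD[OF c, of \<sigma>] assms(1)[of "j - int i"] assms(4) by auto
  then have "c = (\<lambda>\<sigma>. 0)" by auto
  then show "\<exists>b\<in>kchains A (Suc i) j. (\<lambda>\<sigma>. c \<sigma> - kd b \<sigma>) \<in> kchains B i j"
    using kchains_zero[OF assms(2)] kchains_zero[OF assms(3)] by (intro bexI[of _ "\<lambda>_. 0"]) auto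
qed

end

section \<open>Koszul homology of edge ideals\<close>

definition edge_monomials :: "'a set set \<Rightarrow> ('a \<Rightarrow>\<^sub>0 nat) set" where
  "edge_monomials E = {m. \<exists>e\<in>E. e \<subseteq> keys m}"

lemma mono_ideal_edge_monomials: "mono_ideal (edge_monomials E)"
  unfolding mono_ideal_def edge_monomials_def
proof (intro ballI allI)
  fix m m' :: "'a \<Rightarrow>\<^sub>0 nat" assume "m \<in> {m. \<exists>e\<in>E. e \<subseteq> keys m}"
  then obtain e where "e \<in> E" "e \<subseteq> keys m" by auto
  then show "m + m' \<in> {m. \<exists>e\<in>E. e \<subseteq> keys m}" by (auto simp: keys_add_nat)
qed

context ordered_vars
begin

lemma supp_fam_ind: "finite A \<Longrightarrow> supp_fam (edge_monomials E) (ind A) = fam E {} A"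
proof -
  assume A: "finite A"
  have "keys (ind A - ind \<sigma>) = A - \<sigma>" if "\<sigma> \<subseteq> A" for \<sigma>
    using that A finite_subset[OF that A] by (auto simp: in_keys_iff lookup_minus lookup_ind split: if_splits)
  then show ?thesis using A by (auto simp: supp_fam_def fam_def edge_monomials_def indep_def keys_ind)
qed

text \<open>A multidegree with an exponent at least 2 contributes nothing: dividing once by that
  variable keeps the support, so the family is a cone. A squarefree multidegree is
  \<open>ind A\<close> with \<open>j = card A\<close>, where \<open>acyclic_fam\<close>
  applies.\<close>

lemma hk_zero_edge_ideal:
  assumes edge: "\<And>e. e \<in> E \<Longrightarrow> card e = 2"
    and simp: "\<And>B. B \<subseteq> V \<Longrightarrow> B \<noteq> {} \<Longrightarrow> \<exists>w\<in>B. simplicial E B w"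
    and bound: "\<And>M. induced_matching E M \<Longrightarrow> \<Union> M \<subseteq> V \<Longrightarrow> card M \<le> n"
    and j: "j > int i + int n"
  shows "hk_zero (free_piece V 1 (\<lambda>_. 0) :: ('a, 'k::field) pieces)
    (mono_piece V 1 (\<lambda>_. 0) (edge_monomials E)) i j"
proof (rule hk_zero_mono_piece[OF mono_ideal_edge_monomials])
  fix l :: nat and m :: "'a \<Rightarrow>\<^sub>0 nat" assume m: "keys m \<subseteq> V" "int (mon_deg m) = j - 0"
  let ?U = "supp_fam (edge_monomials E) m"
  show "acyclic_at TYPE('k) ?U i"
  proof (cases "\<exists>t. lookup m t \<ge> 2")
    case True
    then obtain t where t: "lookup m t \<ge> 2" by auto
    then have tm: "t \<in> keys m" by (simp add: in_keys_iff)
    show ?thesis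
    proof (rule acyclic_at_cone[where t = t])
      fix \<sigma> assume \<sigma>: "t \<notin> \<sigma>"
      have "keys (m - ind (insert t \<sigma>)) = keys (m - ind \<sigma>)" if "\<sigma> \<subseteq> keys m"
      proof -
        have "finite \<sigma>" using that finite_keys finite_subset by blast
        then show ?thesis using t \<sigma> by (auto simp: in_keys_iff lookup_minus lookup_ind split: if_splits)
      qed
      then show "insert t \<sigma> \<in> ?U \<longleftrightarrow> \<sigma> \<in> ?U" using tm by (auto simp: supp_fam_def edge_monomials_def)
    qed (use tm m in \<open>auto simp: supp_fam_def\<close>)
  next
    case False
    define A where "A = keys m"
    have A: "finite A" by (simp add: A_def)
    have "m = ind A"
    proof (rule poly_mapping_eqI)
      fix u show "lookup m u = lookup (ind A) u"
        using False A by (auto simp: lookup_ind A_def in_keys_iff not_le dest: spec[of _ u])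
    qed
    moreover have "acyclic_at TYPE('k) (fam E {} A) i"
    proof (rule acyclic_fam[where n = n])
      show "i + n < card A + card {}" using m j \<open>m = ind A\<close> A by (simp add: mon_deg_ind)
      show "card M \<le> n" if "induced_matching E M" "\<Union> M \<subseteq> A" for M
        using that m by (intro bound) (auto simp: A_def)
    qed (use edge simp m in \<open>auto simp: A_def\<close>)
    ultimately show ?thesis using supp_fam_ind[OF A] by simp
  qed
qed

lemma card_Union_induced_matching:
  assumes edge: "\<And>e. e \<in> E \<Longrightarrow> card e = 2" and M: "induced_matching E M"
  shows "card (\<Union> M) = 2 * card M"
proof -
  have "card (\<Union> M) = sum card M"
  proof (rule card_Union_disjoint)
    show "disjoint M"
      unfolding disjoint_def
    proof (intro ballI impI)
      fix e e' assume e: "e \<in> M" "e' \<in> M" "e \<noteq> e'"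
      then have "e \<in> E" using M by (auto simp: induced_matching_def)
      moreover from edge[OF this] have "e \<noteq> {}" by auto
      ultimately show "e \<inter> e' = {}" using M e unfolding induced_matching_def by (metis Int_absorb)
    qed
    show "finite e" if "e \<in> M" for e
      using that M edge[of e] by (auto simp: induced_matching_def card_ge_0_finite)
  qed
  also have "\<dots> = (\<Sum>e\<in>M. 2)"
    by (rule sum.cong) (use M edge in \<open>auto simp: induced_matching_def\<close>)
  finally show ?thesis by simp
qed

text \<open>The class lives in the squarefree multidegree of all matched vertices, of degree
  \<open>2 * card M\<close>, and in homological degree \<open>card M\<close>; the difference is the
  size of the matching.\<close>

lemma hk_nonzero_edge_ideal:
  assumes edge: "\<And>e. e \<in> E \<Longrightarrow> card e = 2" and M: "induced_matching E M" "\<Union> M \<subseteq> V"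
  shows "\<not> hk_zero (free_piece V 1 (\<lambda>_. 0) :: ('a, 'k::field) pieces)
    (mono_piece V 1 (\<lambda>_. 0) (edge_monomials E)) (card M) (2 * int (card M))"
proof
  have fin: "finite (\<Union> M)" "finite M" using M finite_V finite_subset by (blast, blast intro: finite_UnionD)
  assume "hk_zero (free_piece V 1 (\<lambda>_. 0) :: ('a, 'k::field) pieces)
    (mono_piece V 1 (\<lambda>_. 0) (edge_monomials E)) (card M) (2 * int (card M))"
  then have "acyclic_at TYPE('k) (supp_fam (edge_monomials E) (ind (\<Union> M))) (card M)"
    by (rule acyclic_at_supp_fam[OF mono_ideal_edge_monomials, rotated 2])
      (use M fin card_Union_induced_matching[OF edge M(1)] in \<open>auto simp: keys_ind mon_deg_ind\<close>)
  then show False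
    using not_acyclic_matching[OF edge M(1) fin(2) M(2), where K = "TYPE('k)"] by (simp add: supp_fam_ind[OF fin(1)])
qed

end

section \<open>Tor from a graded free resolution\<close>

lemma const_coeff_zero [simp]: "const_coeff 0 = 0"
  and const_coeff_diff: "const_coeff (p - q) = const_coeff p - const_coeff q"
  and const_coeff_const [simp]: "const_coeff (single 0 c) = c"
  by (simp_all add: const_coeff_def lookup_add lookup_minus)

lemma const_coeff_sum: "const_coeff (sum f S) = (\<Sum>i\<in>S. const_coeff (f i))"
  by (simp add: const_coeff_def lookup_sum)

lemma lookup_single_mult_0:
  "lookup (single (m :: 'a \<Rightarrow>\<^sub>0 nat) c * p) 0 = (if m = 0 then c * lookup p 0 else 0)"
proof -
  have "single m c * p = (\<Sum>k\<in>keys p. single (m + k) (c * lookup p k))"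
    by (subst poly_mapping_sum_single[of p, symmetric]) (simp add: sum_distrib_left mult_single)
  moreover have "m + k = 0 \<longleftrightarrow> m = 0 \<and> k = 0" for k :: "'a \<Rightarrow>\<^sub>0 nat"
  proof
    assume "m + k = 0"
    then have "mon_deg m + mon_deg k = 0" by (metis mon_deg_add mon_deg_zero)
    then show "m = 0 \<and> k = 0" by (simp add: mon_deg_eq_0_iff)
  qed auto
  ultimately show ?thesis by (auto simp: lookup_sum lookup_single when_def in_keys_iff)
qed

lemma const_coeff_mult: "const_coeff (p * q) = const_coeff p * const_coeff q"
proof -
  have "const_coeff (p * q) = (\<Sum>m\<in>keys p. lookup (single m (lookup p m) * q) 0)"
    by (subst poly_mapping_sum_single[of p, symmetric]) (simp add: const_coeff_def sum_distrib_right lookup_sum)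
  also have "\<dots> = const_coeff p * const_coeff q"
    by (auto simp: lookup_single_mult_0 const_coeff_def in_keys_iff)
  finally show ?thesis .
qed

definition mv :: "nat \<Rightarrow> (nat \<Rightarrow> nat \<Rightarrow> 'b::comm_ring_1) \<Rightarrow> (nat \<Rightarrow> 'b) \<Rightarrow> nat \<Rightarrow> 'b" where
  "mv r D x = (\<lambda>i. \<Sum>l<r. D i l * x l)"

lemma linear_map_mv: "linear_map (mv r D)"
  by (auto simp: linear_map_def mv_def fun_eq_iff algebra_simps sum.distrib sum_distrib_left)

text \<open>Rows from \<open>r\<close> on vanish so that products land in the free module of rank
  \<open>r\<close>; columns from \<open>r'\<close> on are never read by
  \<open>mv r'\<close>.\<close>

definition hom_matrix ::
  "'a set \<Rightarrow> nat \<Rightarrow> (nat \<Rightarrow> int) \<Rightarrow> nat \<Rightarrow> (nat \<Rightarrow> int) \<Rightarrow> (nat \<Rightarrow> nat \<Rightarrow> ('a, 'k::field) mpoly) \<Rightarrow> bool" where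
  "hom_matrix V r s r' s' D \<longleftrightarrow> (\<forall>i<r. \<forall>l<r'. D i l \<in> hom_piece V (s' l - s i)) \<and> (\<forall>i\<ge>r. \<forall>l. D i l = 0)"

lemma mv_free_piece:
  assumes "hom_matrix V r s r' s' D" "x \<in> free_piece V r' s' d"
  shows "mv r' D x \<in> free_piece V r s d"
  unfolding free_piece_def mem_Collect_eq
proof (intro conjI allI impI)
  fix i assume "i < r"
  then show "mv r' D x i \<in> hom_piece V (d - s i)"
    using assms unfolding mv_def hom_matrix_def free_piece_def
    by (intro hom_piece_sum) (auto intro!: hom_piece_mult)
next
  fix i assume "r \<le> i"
  then show "mv r' D x i = 0" using assms by (simp add: mv_def hom_matrix_def)
qed

definition im_piece ::
  "'a set \<Rightarrow> nat \<Rightarrow> (nat \<Rightarrow> int) \<Rightarrow> (nat \<Rightarrow> nat \<Rightarrow> ('a, 'k::field) mpoly) \<Rightarrow> ('a, 'k) pieces" where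
  "im_piece V r s D d = mv r D ` free_piece V r s d"

lemma graded_mod_im_piece: "graded_mod V (im_piece V r s D)"
  unfolding graded_mod_def
proof (intro allI conjI ballI)
  fix d
  show "0 \<in> im_piece V r s D d"
    unfolding im_piece_def using graded_mod_zero[OF graded_mod_free_piece] linear_map_zero[OF linear_map_mv]
    by (metis imageI)
next
  fix d x y assume "x \<in> im_piece V r s D d" "y \<in> im_piece V r s D d"
  then obtain x' y' where "x' \<in> free_piece V r s d" "y' \<in> free_piece V r s d" "x = mv r D x'" "y = mv r D y'"
    by (auto simp: im_piece_def)
  then show "x - y \<in> im_piece V r s D d"
    unfolding im_piece_def using graded_mod_diff[OF graded_mod_free_piece] linear_map_diff[OF linear_map_mv]
    by (metis imageI)
next
  fix d v x assume v: "v \<in> V" and "x \<in> im_piece V r s D d"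
  then obtain x' where x': "x' \<in> free_piece V r s d" "x = mv r D x'" by (auto simp: im_piece_def)
  then have "scale (var v) x' \<in> free_piece V r s (d + 1)"
    by (intro graded_mod_var[OF graded_mod_free_piece v]) simp
  then show "scale (var v) x \<in> im_piece V r s D (d + 1)"
    unfolding im_piece_def x' by (metis linear_map_scale[OF linear_map_mv] imageI)
qed

lemma im_piece_free_piece:
  "hom_matrix V r s r' s' D \<Longrightarrow> im_piece V r' s' D d \<subseteq> free_piece V r s d"
  by (auto simp: im_piece_def intro: mv_free_piece)

text \<open>Writes the augmentation as a one-row matrix into the free module of rank one, so that it
  is treated like the other maps.\<close>

definition row_mat :: "(nat \<Rightarrow> 'b::zero) \<Rightarrow> nat \<Rightarrow> nat \<Rightarrow> 'b" where
  "row_mat g i l = (if i = 0 then g l else 0)"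

text \<open>A graded free resolution of \<open>S/I\<close>, where \<open>I\<close> is spanned by the monomials in \<open>J\<close>, read off
  degree by degree; the vectors \<open>g l\<close> represent the generators of \<open>F\<^sub>0\<close>.\<close>

definition graded_exact ::
  "'a set \<Rightarrow> ('a \<Rightarrow>\<^sub>0 nat) set \<Rightarrow> (nat \<Rightarrow> nat) \<Rightarrow> (nat \<Rightarrow> nat \<Rightarrow> int) \<Rightarrow>
    (nat \<Rightarrow> nat \<Rightarrow> nat \<Rightarrow> ('a, 'k::field) mpoly) \<Rightarrow> (nat \<Rightarrow> ('a, 'k) mpoly) \<Rightarrow> bool" where
  "graded_exact V J r s D g \<longleftrightarrow>
     (\<forall>i. hom_matrix V (r i) (s i) (r (Suc i)) (s (Suc i)) (D i)) \<and>
     (\<forall>l<r 0. g l \<in> hom_piece V (s 0 l)) \<and>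
     (\<forall>d. \<forall>a\<in>free_piece V 1 (\<lambda>_. 0) d. \<exists>x\<in>free_piece V (r 0) (s 0) d.
        a - mv (r 0) (row_mat g) x \<in> mono_piece V 1 (\<lambda>_. 0) J d) \<and>
     (\<forall>d. im_piece V (r 1) (s 1) (D 0) d =
        {x \<in> free_piece V (r 0) (s 0) d. mv (r 0) (row_mat g) x \<in> mono_piece V 1 (\<lambda>_. 0) J d}) \<and>
     (\<forall>i d. im_piece V (r (Suc (Suc i))) (s (Suc (Suc i))) (D (Suc i)) d =
        {x \<in> free_piece V (r (Suc i)) (s (Suc i)) d. mv (r (Suc i)) (D i) x = 0})"

definition const_piece :: "nat \<Rightarrow> (nat \<Rightarrow> int) \<Rightarrow> int \<Rightarrow> (nat \<Rightarrow> 'k::zero) set" where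
  "const_piece r s j = {x. \<forall>l. x l \<noteq> 0 \<longrightarrow> l < r \<and> s l = j}"

abbreviation cmat :: "(nat \<Rightarrow> nat \<Rightarrow> ('a, 'k::field) mpoly) \<Rightarrow> nat \<Rightarrow> nat \<Rightarrow> 'k" where
  "cmat D \<equiv> \<lambda>a b. const_coeff (D a b)"

text \<open>The inclusion of the Tor cycles in the Tor boundaries, for matrices given as functions.\<close>

fun tor_vanish ::
  "(nat \<Rightarrow> nat) \<Rightarrow> (nat \<Rightarrow> nat \<Rightarrow> int) \<Rightarrow> (nat \<Rightarrow> nat \<Rightarrow> nat \<Rightarrow> ('a, 'k::field) mpoly) \<Rightarrow> nat \<Rightarrow> int \<Rightarrow> bool" where
  "tor_vanish r s D 0 j \<longleftrightarrow>
     (\<forall>x\<in>const_piece (r 0) (s 0) j. \<exists>y\<in>const_piece (r 1) (s 1) j. mv (r 1) (cmat (D 0)) y = x)"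
| "tor_vanish r s D (Suc i) j \<longleftrightarrow>
     (\<forall>x\<in>const_piece (r (Suc i)) (s (Suc i)) j. mv (r (Suc i)) (cmat (D i)) x = 0 \<longrightarrow>
        (\<exists>y\<in>const_piece (r (Suc (Suc i))) (s (Suc (Suc i))) j. mv (r (Suc (Suc i))) (cmat (D (Suc i))) y = x))"

text \<open>Reduction modulo the ideal of variables, that is, tensoring with the residue field;
  \<open>const_vec\<close> is a section of it.\<close>

definition cvec :: "(nat \<Rightarrow> ('a, 'k::field) mpoly) \<Rightarrow> nat \<Rightarrow> 'k" where
  "cvec z = (\<lambda>l. const_coeff (z l))"

definition const_vec :: "(nat \<Rightarrow> 'k::field) \<Rightarrow> nat \<Rightarrow> ('a, 'k) mpoly" where
  "const_vec x = (\<lambda>l. single 0 (x l))"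

lemma cvec_const_vec [simp]: "cvec (const_vec x) = x"
  by (simp add: cvec_def const_vec_def)

lemma cvec_mv: "cvec (mv r D z) = mv r (cmat D) (cvec z)"
  by (simp add: cvec_def mv_def const_coeff_sum const_coeff_mult)

lemma cvec_diff: "cvec (x - y) = cvec x - cvec y"
  by (auto simp: cvec_def const_coeff_diff)

lemma const_vec_free_piece: "x \<in> const_piece r s j \<Longrightarrow> const_vec x \<in> free_piece V r s j"
proof -
  assume x: "x \<in> const_piece r s j"
  have "single 0 (x l) \<in> hom_piece V (j - s l)" for l
  proof (cases "x l = 0")
    case False
    then show ?thesis using x by (auto simp: const_piece_def hom_piece_const)
  qed simp
  moreover have "x l = 0" if "l \<ge> r" for l
    using x that by (auto simp: const_piece_def)
  ultimately show ?thesis by (auto simp: free_piece_def const_vec_def)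
qed

lemma cvec_const_piece:
  assumes "z \<in> free_piece V r s j" shows "cvec z \<in> const_piece r s j"
  unfolding const_piece_def mem_Collect_eq
proof (intro allI impI)
  fix l assume nz: "cvec z l \<noteq> 0"
  then have l: "l < r" using assms by (cases "l < r") (auto simp: free_piece_def cvec_def)
  have "0 \<in> keys (z l)" using nz by (simp add: cvec_def const_coeff_def in_keys_iff)
  moreover have "z l \<in> hom_piece V (j - s l)" using assms l by (simp add: free_piece_def)
  ultimately have "int (mon_deg (0 :: 'a \<Rightarrow>\<^sub>0 nat)) = j - s l" by (metis hom_piece_iff)
  with l show "l < r \<and> s l = j" by simp
qed

lemma cvec_max_mult:
  fixes z :: "nat \<Rightarrow> ('a, 'k::field) mpoly"
  assumes "z \<in> max_mult V A j" shows "cvec z = 0"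
proof -
  have "const_coeff (var v * p) = 0" for v and p :: "('a, 'k) mpoly"
    by (simp add: const_coeff_def lookup_var_mult)
  then show ?thesis using assms
    by (auto simp: max_mult_def cvec_def sum_fun_apply const_coeff_sum fun_eq_iff)
qed

context ordered_vars
begin

text \<open>Together with \<open>cvec_max_mult\<close>: on a free module, the kernel of reduction is
  exactly the multiple by the ideal of variables.\<close>

lemma max_mult_free_piece:
  assumes z: "z \<in> free_piece V r s j" and c: "cvec z = 0"
  shows "z \<in> max_mult V (free_piece V r s) j"
proof -
  have "\<exists>q. (\<forall>v. q v \<in> hom_piece V (j - s l - 1)) \<and> z l = (\<Sum>v\<in>V. var v * q v)" if "l < r" for l
  proof -
    have "z l \<in> hom_piece V (j - s l)" "const_coeff (z l) = 0"
      using z c that by (auto simp: free_piece_def cvec_def fun_eq_iff)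
    from hom_piece_no_const[OF this finite_V] show ?thesis by metis
  qed
  then obtain q where q: "\<And>l v. l < r \<Longrightarrow> q l v \<in> hom_piece V (j - s l - 1)"
    "\<And>l. l < r \<Longrightarrow> z l = (\<Sum>v\<in>V. var v * q l v)" by metis
  define p where "p v l = (if l < r then q l v else 0)" for v l
  have "z = (\<Sum>v\<in>V. scale (var v) (p v))"
  proof
    fix l show "z l = (\<Sum>v\<in>V. scale (var v) (p v)) l"
      using q(2)[of l] z by (cases "l < r") (auto simp: sum_fun_apply p_def free_piece_def)
  qed
  moreover have "\<forall>v\<in>V. p v \<in> free_piece V r s (j - 1)"
    using q(1) by (auto simp: p_def free_piece_def algebra_simps)
  ultimately show ?thesis unfolding max_mult_def by (intro CollectI exI[of _ p]) simp
qed

lemma max_mult_im_piece: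
  "max_mult V (im_piece V r s D) j = mv r D ` max_mult V (free_piece V r s) j"
proof (intro equalityI subsetI)
  fix x assume "x \<in> max_mult V (im_piece V r s D) j"
  then obtain q where q: "x = (\<Sum>v\<in>V. scale (var v) (q v))" "\<And>v. v \<in> V \<Longrightarrow> q v \<in> im_piece V r s D (j - 1)"
    by (auto simp: max_mult_def)
  have "\<forall>v\<in>V. \<exists>y. y \<in> free_piece V r s (j - 1) \<and> q v = mv r D y"
    using q(2) by (auto simp: im_piece_def)
  then obtain p where p: "\<And>v. v \<in> V \<Longrightarrow> p v \<in> free_piece V r s (j - 1) \<and> q v = mv r D (p v)"
    by metis
  have "x = mv r D (\<Sum>v\<in>V. scale (var v) (p v))"
    unfolding q(1) linear_map_sum[OF linear_map_mv] linear_map_scale[OF linear_map_mv]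
    by (rule sum.cong) (use p in auto)
  moreover have "(\<Sum>v\<in>V. scale (var v) (p v)) \<in> max_mult V (free_piece V r s) j"
    unfolding max_mult_def using p by (intro CollectI exI[of _ p]) simp
  ultimately show "x \<in> mv r D ` max_mult V (free_piece V r s) j" by simp
next
  fix x assume "x \<in> mv r D ` max_mult V (free_piece V r s) j"
  then obtain p where p: "x = mv r D (\<Sum>v\<in>V. scale (var v) (p v))" "\<forall>v\<in>V. p v \<in> free_piece V r s (j - 1)"
    by (auto simp: max_mult_def)
  have "x = (\<Sum>v\<in>V. scale (var v) (mv r D (p v)))"
    unfolding p(1) linear_map_sum[OF linear_map_mv] linear_map_scale[OF linear_map_mv] ..
  moreover have "\<forall>v\<in>V. mv r D (p v) \<in> im_piece V r s D (j - 1)"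
    using p(2) by (auto simp: im_piece_def)
  ultimately show "x \<in> max_mult V (im_piece V r s D) j"
    unfolding max_mult_def by (intro CollectI exI[of _ "\<lambda>v. mv r D (p v)"] conjI)
qed

text \<open>The image of \<open>D\<close> has two roles: as a submodule of the target it shifts
  homology down by one, and as a quotient it is the source modulo the kernel. The condition
  \<open>p \<ge> 1\<close> keeps both degrees where free modules are acyclic.\<close>

lemma hk_zero_kernel:
  fixes D :: "nat \<Rightarrow> nat \<Rightarrow> ('a, 'k::field) mpoly"
  assumes "p \<ge> 1" and D: "hom_matrix V r s r' s' D"
  shows "hk_zero (free_piece V r s) (im_piece V r' s' D) (Suc p) j \<longleftrightarrow>
    hk_zero (free_piece V r' s') (\<lambda>d. {x \<in> free_piece V r' s' d. mv r' D x = 0}) p j"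
proof -
  have "hk_zero (free_piece V r s) (im_piece V r' s' D) (Suc p) j \<longleftrightarrow> hk_zero (im_piece V r' s' D) zero_mod p j"
    using assms by (intro hk_zero_connect graded_mod_free_piece graded_mod_im_piece im_piece_free_piece hk_zero_free_piece) auto
  also have "\<dots> \<longleftrightarrow> hk_zero (free_piece V r' s') (\<lambda>d. {x \<in> free_piece V r' s' d. mv r' D x = 0}) p j"
  proof (rule hk_zero_iso[OF graded_mod_free_piece graded_mod_im_piece graded_mod_zero_mod _ linear_map_mv[of r' D], symmetric])
    show "zero_mod d \<subseteq> im_piece V r' s' D d" for d
      using graded_mod_zero[OF graded_mod_im_piece] by (auto simp: zero_mod_def)
    show "mv r' D x \<in> im_piece V r' s' D d" if "x \<in> free_piece V r' s' d" for d x
      using that by (auto simp: im_piece_def)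
    show "\<exists>x\<in>free_piece V r' s' d. a - mv r' D x \<in> zero_mod d" if "a \<in> im_piece V r' s' D d" for d a
      using that by (auto simp: im_piece_def zero_mod_def)
  qed (simp add: zero_mod_def)
  finally show ?thesis .
qed

section \<open>Tor of one fixed resolution\<close>

context
  fixes J :: "('a \<Rightarrow>\<^sub>0 nat) set" and r :: "nat \<Rightarrow> nat" and s :: "nat \<Rightarrow> nat \<Rightarrow> int"
    and D :: "nat \<Rightarrow> nat \<Rightarrow> nat \<Rightarrow> ('a, 'k::field) mpoly" and g :: "nat \<Rightarrow> ('a, 'k) mpoly"
  assumes J: "mono_ideal J" and ex: "graded_exact V J r s D g"
begin

abbreviation (input) "FF i \<equiv> free_piece V (r i) (s i) :: ('a, 'k) pieces"
text \<open>\<open>FF i\<close> modulo \<open>NN i\<close> is, up to isomorphism, the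
  \<open>i\<close>-th syzygy module; for \<open>i = 0\<close> it is the resolved quotient.\<close>

abbreviation (input) "NN i \<equiv> im_piece V (r (Suc i)) (s (Suc i)) (D i)"

lemma NN_FF: "NN i d \<subseteq> FF i d"
  using ex im_piece_free_piece by (fastforce simp: graded_exact_def)

lemma hk_zero_FF_0:
  "hk_zero (FF 0) (NN 0) p j \<longleftrightarrow>
    hk_zero (free_piece V 1 (\<lambda>_. 0) :: ('a, 'k) pieces) (mono_piece V 1 (\<lambda>_. 0) J) p j"
proof (rule hk_zero_iso[OF graded_mod_free_piece graded_mod_free_piece graded_mod_mono_piece[OF J] _ linear_map_mv[of "r 0" "row_mat g"]])
  have "hom_matrix V 1 (\<lambda>_. 0) (r 0) (s 0) (row_mat g)"
    using ex by (auto simp: hom_matrix_def row_mat_def graded_exact_def)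
  then show "mv (r 0) (row_mat g) x \<in> free_piece V 1 (\<lambda>_. 0) d" if "x \<in> FF 0 d" for x d
    using that by (rule mv_free_piece)
qed (use ex in \<open>auto simp: graded_exact_def mono_piece_def\<close>)

lemma hk_zero_FF_Suc:
  assumes "p \<ge> 1"
  shows "hk_zero (FF i) (NN i) (Suc p) j \<longleftrightarrow> hk_zero (FF (Suc i)) (NN (Suc i)) p j"
proof -
  have eq: "NN (Suc i) = (\<lambda>d. {x \<in> FF (Suc i) d. mv (r (Suc i)) (D i) x = 0})"
    using ex by (simp add: graded_exact_def fun_eq_iff)
  have "hom_matrix V (r i) (s i) (r (Suc i)) (s (Suc i)) (D i)" using ex by (simp add: graded_exact_def)
  then show ?thesis unfolding eq by (rule hk_zero_kernel[OF assms])
qed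

text \<open>Iterates \<open>hk_zero_FF_Suc\<close>; \<open>p\<close> is generalized because every
  step along the resolution raises it by one.\<close>

lemma hk_zero_FF:
  "hk_zero (FF i) (NN i) (Suc p) j \<longleftrightarrow>
    hk_zero (free_piece V 1 (\<lambda>_. 0) :: ('a, 'k) pieces) (mono_piece V 1 (\<lambda>_. 0) J) (Suc (p + i)) j"
proof (induction i arbitrary: p)
  case 0
  then show ?case using hk_zero_FF_0 by simp
next
  case (Suc i)
  have "hk_zero (FF (Suc i)) (NN (Suc i)) (Suc p) j \<longleftrightarrow> hk_zero (FF i) (NN i) (Suc (Suc p)) j"
    by (rule hk_zero_FF_Suc[symmetric]) simp
  with Suc.IH[of "Suc p"] show ?case by (simp only: add_Suc add_Suc_right)
qed

text \<open>Both sides express the intersection criterion of \<open>hk_zero_1_iff\<close>: a Tor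
  cycle lifts to constants whose image lies in \<open>NN i\<close> and in the multiple of
  \<open>FF i\<close> by the variables, and an element of that intersection has a preimage whose
  constants form a Tor cycle. \<open>D i\<close> may have constant entries, hence the corrections by
  \<open>w\<close> and \<open>q\<close>.\<close>

lemma tor_vanish_Suc_iff: "tor_vanish r s D (Suc i) j \<longleftrightarrow> hk_zero (FF i) (NN i) (Suc 0) j"
proof -
  have hk: "hk_zero (FF i) (NN i) (Suc 0) j \<longleftrightarrow> NN i j \<inter> max_mult V (FF i) j \<subseteq> max_mult V (NN i) j"
    by (intro hk_zero_1_iff graded_mod_free_piece graded_mod_im_piece NN_FF hk_zero_free_piece) auto
  have ker: "NN (Suc i) d = {x \<in> FF (Suc i) d. mv (r (Suc i)) (D i) x = 0}" for d
    using ex by (simp add: graded_exact_def)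
  have hm: "hom_matrix V (r i) (s i) (r (Suc i)) (s (Suc i)) (D i)" for i using ex by (simp add: graded_exact_def)
  show ?thesis
    unfolding hk max_mult_im_piece
  proof
    assume tv: "tor_vanish r s D (Suc i) j"
    show "NN i j \<inter> max_mult V (FF i) j \<subseteq> mv (r (Suc i)) (D i) ` max_mult V (FF (Suc i)) j"
    proof
      fix x assume x: "x \<in> NN i j \<inter> max_mult V (FF i) j"
      then obtain z where z: "z \<in> FF (Suc i) j" "x = mv (r (Suc i)) (D i) z" by (auto simp: im_piece_def)
      have "mv (r (Suc i)) (cmat (D i)) (cvec z) = 0"
        using x cvec_max_mult[of x V "FF i" j] z by (simp flip: cvec_mv)
      then obtain y where y: "y \<in> const_piece (r (Suc (Suc i))) (s (Suc (Suc i))) j"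
        "mv (r (Suc (Suc i))) (cmat (D (Suc i))) y = cvec z"
        using tv cvec_const_piece[OF z(1)] by auto
      \<comment> \<open>The constants of \<open>z\<close> are a Tor boundary; subtracting the lifted
        boundary keeps the image \<open>x\<close> and leaves a vector without constant
        terms.\<close>
      define w where "w = mv (r (Suc (Suc i))) (D (Suc i)) (const_vec y)"
      have "w \<in> NN (Suc i) j" unfolding w_def im_piece_def by (intro imageI const_vec_free_piece y)
      then have w: "w \<in> FF (Suc i) j" "mv (r (Suc i)) (D i) w = 0" by (auto simp: ker)
      have "cvec (z - w) = 0" by (simp add: cvec_diff w_def cvec_mv y)
      then have "z - w \<in> max_mult V (FF (Suc i)) j"
        using z w by (intro max_mult_free_piece graded_mod_diff[OF graded_mod_free_piece])
      moreover have "x = mv (r (Suc i)) (D i) (z - w)"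
        using z w by (simp add: linear_map_diff[OF linear_map_mv])
      ultimately show "x \<in> mv (r (Suc i)) (D i) ` max_mult V (FF (Suc i)) j" by blast
    qed
  next
    assume sub: "NN i j \<inter> max_mult V (FF i) j \<subseteq> mv (r (Suc i)) (D i) ` max_mult V (FF (Suc i)) j"
    show "tor_vanish r s D (Suc i) j"
      unfolding tor_vanish.simps
    proof (intro ballI impI)
      fix x :: "nat \<Rightarrow> 'k" assume x: "x \<in> const_piece (r (Suc i)) (s (Suc i)) j" "mv (r (Suc i)) (cmat (D i)) x = 0"
      define z :: "nat \<Rightarrow> ('a, 'k) mpoly" where "z = const_vec x"
      have z: "z \<in> FF (Suc i) j" using x by (simp add: z_def const_vec_free_piece)
      have "cvec (mv (r (Suc i)) (D i) z) = 0" using x by (simp add: cvec_mv z_def)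
      then have "mv (r (Suc i)) (D i) z \<in> NN i j \<inter> max_mult V (FF i) j"
        using z mv_free_piece[OF hm z] by (auto simp: im_piece_def intro: max_mult_free_piece)
      then obtain q where q: "q \<in> max_mult V (FF (Suc i)) j" "mv (r (Suc i)) (D i) z = mv (r (Suc i)) (D i) q"
        using sub by blast
      have "q \<in> FF (Suc i) j"
        using q(1) unfolding max_mult_def
        by (auto intro!: graded_mod_sum[OF graded_mod_free_piece] graded_mod_var[OF graded_mod_free_piece])
      \<comment> \<open>Removing \<open>q\<close>, which has no constant terms, turns the lift into
        a genuine cycle with the same constants \<open>x\<close>.\<close>
      then have "z - q \<in> NN (Suc i) j"
        unfolding ker using z q by (simp add: graded_mod_diff[OF graded_mod_free_piece] linear_map_diff[OF linear_map_mv])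
      then obtain w where w: "w \<in> FF (Suc (Suc i)) j" "z - q = mv (r (Suc (Suc i))) (D (Suc i)) w"
        by (auto simp: im_piece_def)
      have "x = cvec (z - q)" using cvec_max_mult[OF q(1)] by (simp add: cvec_diff z_def)
      then have "mv (r (Suc (Suc i))) (cmat (D (Suc i))) (cvec w) = x" by (simp add: w cvec_mv)
      then show "\<exists>y\<in>const_piece (r (Suc (Suc i))) (s (Suc (Suc i))) j. mv (r (Suc (Suc i))) (cmat (D (Suc i))) y = x"
        using cvec_const_piece[OF w(1)] by blast
    qed
  qed
qed

lemma tor_vanish_0_iff: "tor_vanish r s D 0 j \<longleftrightarrow> hk_zero (FF 0) (NN 0) 0 j"
  unfolding hk_zero_0_iff[OF graded_mod_free_piece graded_mod_im_piece]
proof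
  assume tv: "tor_vanish r s D 0 j"
  show "\<forall>x\<in>FF 0 j. \<exists>y\<in>max_mult V (FF 0) j. x - y \<in> NN 0 j"
  proof
    fix x assume x: "x \<in> FF 0 j"
    then obtain y where y: "y \<in> const_piece (r 1) (s 1) j" "mv (r 1) (cmat (D 0)) y = cvec x"
      using tv cvec_const_piece[OF x] by auto
    define w where "w = mv (r 1) (D 0) (const_vec y)"
    have w: "w \<in> NN 0 j"
      using const_vec_free_piece[OF y(1)] by (auto simp: w_def im_piece_def)
    then have "w \<in> FF 0 j" using NN_FF by blast
    moreover have "cvec (x - w) = 0" using y(2) by (simp add: cvec_diff w_def cvec_mv)
    ultimately have "x - w \<in> max_mult V (FF 0) j"
      using x by (intro max_mult_free_piece graded_mod_diff[OF graded_mod_free_piece])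
    moreover have "x - (x - w) \<in> NN 0 j" using w by simp
    ultimately show "\<exists>y\<in>max_mult V (FF 0) j. x - y \<in> NN 0 j" by blast
  qed
next
  assume h: "\<forall>x\<in>FF 0 j. \<exists>y\<in>max_mult V (FF 0) j. x - y \<in> NN 0 j"
  show "tor_vanish r s D 0 j"
    unfolding tor_vanish.simps
  proof
    fix x :: "nat \<Rightarrow> 'k" assume x: "x \<in> const_piece (r 0) (s 0) j"
    then obtain y where y: "y \<in> max_mult V (FF 0) j" "const_vec x - y \<in> NN 0 j"
      using h const_vec_free_piece by blast
    then obtain w where w: "w \<in> FF 1 j" "const_vec x - y = mv (r 1) (D 0) w" by (auto simp: im_piece_def)
    have "x = cvec (const_vec x - y)" using cvec_max_mult[OF y(1)] by (simp add: cvec_diff)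
    also have "\<dots> = mv (r 1) (cmat (D 0)) (cvec w)" by (simp add: w cvec_mv)
    finally show "\<exists>y\<in>const_piece (r 1) (s 1) j. mv (r 1) (cmat (D 0)) y = x"
      using cvec_const_piece[OF w(1)] by metis
  qed
qed

text \<open>The right-hand side does not mention the resolution; this is the independence of Tor
  from its choice.\<close>

lemma tor_vanish_iff:
  "tor_vanish r s D i j \<longleftrightarrow>
    hk_zero (free_piece V 1 (\<lambda>_. 0) :: ('a, 'k) pieces) (mono_piece V 1 (\<lambda>_. 0) J) i j"
proof (cases i)
  case 0
  then show ?thesis using tor_vanish_0_iff hk_zero_FF_0 by simp
next
  case (Suc i)
  then show ?thesis using tor_vanish_Suc_iff hk_zero_FF[of i 0] by simp
qed

end

end

section \<open>Homogeneous components\<close>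

definition hcomp :: "int \<Rightarrow> ('a, 'k::field) mpoly \<Rightarrow> ('a, 'k) mpoly" where
  "hcomp d p = Poly_Mapping.mapp (\<lambda>m c. if int (mon_deg m) = d then c else 0) p"

lemma lookup_hcomp:
  "lookup (hcomp d p) m = (if int (mon_deg m) = d then lookup p m else 0)"
  by (simp add: hcomp_def lookup_mapp when_def in_keys_iff)

lemma hcomp_add: "hcomp d (p + q) = hcomp d p + hcomp d q"
  by (rule poly_mapping_eqI) (simp add: lookup_hcomp lookup_add)

lemma hcomp_diff: "hcomp d (p - q) = hcomp d p - hcomp d q"
  by (rule poly_mapping_eqI) (simp add: lookup_hcomp lookup_minus)

lemma hcomp_zero [simp]: "hcomp d 0 = 0"
  by (rule poly_mapping_eqI) (simp add: lookup_hcomp)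

lemma hcomp_sum: "hcomp d (sum f S) = (\<Sum>i\<in>S. hcomp d (f i))"
  by (induction S rule: infinite_finite_induct) (simp_all add: hcomp_add)

lemma keys_hcomp: "keys (hcomp d p) = {m \<in> keys p. int (mon_deg m) = d}"
  by (auto simp: in_keys_iff lookup_hcomp split: if_splits)

lemma hcomp_hom_piece: "p \<in> carrier (poly_ring V) \<Longrightarrow> hcomp d p \<in> hom_piece V d"
  by (auto simp: hom_piece_iff keys_hcomp poly_ring_carrier_iff)

lemma hcomp_id: "p \<in> hom_piece V d \<Longrightarrow> hcomp d p = p"
  by (rule poly_mapping_eqI) (auto simp: lookup_hcomp hom_piece_iff in_keys_iff)

lemma hcomp_eq_0: "(\<And>m. m \<in> keys p \<Longrightarrow> int (mon_deg m) \<noteq> d) \<Longrightarrow> hcomp d p = 0"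
  by (rule poly_mapping_eqI) (auto simp: lookup_hcomp in_keys_iff)

lemma hcomp_mult:
  assumes q: "q \<in> hom_piece V e"
  shows "hcomp d (q * p) = q * hcomp (d - e) p"
proof -
  let ?h = "hcomp (d - e) p" and ?p' = "p - hcomp (d - e) p"
  have "hcomp d (q * ?p') = 0"
  proof (rule hcomp_eq_0)
    fix m assume "m \<in> keys (q * ?p')"
    then obtain a b where ab: "m = a + b" "a \<in> keys q" "b \<in> keys ?p'"
      using keys_mult[of q ?p'] by auto
    have "int (mon_deg b) \<noteq> d - e" using ab(3) by (auto simp: in_keys_iff lookup_minus lookup_hcomp)
    then show "int (mon_deg m) \<noteq> d" using ab q by (auto simp: hom_piece_iff mon_deg_add)
  qed
  moreover have "hcomp d (q * ?h) = q * ?h"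
  proof -
    have "?h \<in> hom_piece UNIV (d - e)" by (rule hcomp_hom_piece) (simp add: poly_ring_def)
    moreover have "q \<in> hom_piece UNIV e" using q by (auto simp: hom_piece_iff)
    ultimately show ?thesis by (intro hcomp_id[of _ UNIV] hom_piece_mult) auto
  qed
  moreover have "q * p = q * ?h + q * ?p'" by (simp add: algebra_simps)
  ultimately show ?thesis by (simp add: hcomp_add)
qed

definition vcomp :: "(nat \<Rightarrow> int) \<Rightarrow> int \<Rightarrow> (nat \<Rightarrow> ('a, 'k::field) mpoly) \<Rightarrow> nat \<Rightarrow> ('a, 'k) mpoly" where
  "vcomp s d x = (\<lambda>l. hcomp (d - s l) (x l))"

definition free_fun :: "'a set \<Rightarrow> nat \<Rightarrow> (nat \<Rightarrow> ('a, 'k::field) mpoly) set" where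
  "free_fun V r = {x. (\<forall>l<r. x l \<in> carrier (poly_ring V)) \<and> (\<forall>l\<ge>r. x l = 0)}"

lemma free_piece_free_fun: "x \<in> free_piece V r s d \<Longrightarrow> x \<in> free_fun V r"
  by (auto simp: free_piece_def free_fun_def hom_piece_carrier)

lemma vcomp_free_piece: "x \<in> free_fun V r \<Longrightarrow> vcomp s d x \<in> free_piece V r s d"
  by (auto simp: free_piece_def free_fun_def vcomp_def hcomp_hom_piece)

lemma vcomp_id: "x \<in> free_piece V r s d \<Longrightarrow> vcomp s d x = x"
proof
  fix l assume "x \<in> free_piece V r s d"
  then show "vcomp s d x l = x l"
    by (cases "l < r") (auto simp: free_piece_def vcomp_def hcomp_id)
qed

lemma vcomp_zero [simp]: "vcomp s d 0 = 0"
  by (auto simp: vcomp_def)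

lemma poly_ring_add: "p \<in> carrier (poly_ring V) \<Longrightarrow> q \<in> carrier (poly_ring V) \<Longrightarrow> p + q \<in> carrier (poly_ring V)"
  using keys_add[of p q] by (auto simp: poly_ring_carrier_iff)

lemma poly_ring_uminus: "p \<in> carrier (poly_ring V) \<Longrightarrow> - p \<in> carrier (poly_ring V)"
  by (simp add: poly_ring_carrier_iff)

lemma poly_ring_diff: "p \<in> carrier (poly_ring V) \<Longrightarrow> q \<in> carrier (poly_ring V) \<Longrightarrow> p - q \<in> carrier (poly_ring V)"
  using keys_minus_subset[of p q] by (auto simp: poly_ring_carrier_iff)

lemma poly_ring_mult: "p \<in> carrier (poly_ring V) \<Longrightarrow> q \<in> carrier (poly_ring V) \<Longrightarrow> p * q \<in> carrier (poly_ring V)"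
proof -
  assume pq: "p \<in> carrier (poly_ring V)" "q \<in> carrier (poly_ring V)"
  show ?thesis
    unfolding poly_ring_carrier_iff
  proof
    fix m assume "m \<in> keys (p * q)"
    then obtain a b where "m = a + b" "a \<in> keys p" "b \<in> keys q"
      using keys_mult[of p q] by auto
    then show "keys m \<subseteq> V" using pq by (auto simp: poly_ring_carrier_iff keys_add_nat)
  qed
qed

lemma poly_ring_zero: "0 \<in> carrier (poly_ring V)"
  by (simp add: poly_ring_carrier_iff)

lemma poly_ring_sum: "(\<And>i. i \<in> S \<Longrightarrow> f i \<in> carrier (poly_ring V)) \<Longrightarrow> sum f S \<in> carrier (poly_ring V)"
  by (induction S rule: infinite_finite_induct) (auto intro: poly_ring_add poly_ring_zero)

lemma free_fun_sum: "(\<And>i. i \<in> S \<Longrightarrow> f i \<in> free_fun V r) \<Longrightarrow> sum f S \<in> free_fun V r"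
  by (auto simp: free_fun_def sum_fun_apply intro: poly_ring_sum)

lemma mv_free_fun:
  assumes D: "hom_matrix V r s r' s' D" and x: "x \<in> free_fun V r'"
  shows "mv r' D x \<in> free_fun V r"
  unfolding free_fun_def mem_Collect_eq
proof (intro conjI allI impI)
  fix i assume "i < r"
  then show "mv r' D x i \<in> carrier (poly_ring V)"
    using assms unfolding mv_def hom_matrix_def free_fun_def
    by (intro poly_ring_sum poly_ring_mult) (auto dest: hom_piece_carrier)
next
  fix i assume "r \<le> i"
  then show "mv r' D x i = 0" using D by (simp add: mv_def hom_matrix_def)
qed

lemma vcomp_mv:
  assumes D: "hom_matrix V r s r' s' D"
  shows "vcomp s d (mv r' D x) = mv r' D (vcomp s' d x)"
proof
  fix i
  show "vcomp s d (mv r' D x) i = mv r' D (vcomp s' d x) i"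
  proof (cases "i < r")
    case True
    have "hcomp (d - s i) (D i l * x l) = D i l * hcomp (d - s' l) (x l)" if "l < r'" for l
      using D True that hcomp_mult[of "D i l" V "s' l - s i" "d - s i" "x l"] by (auto simp: hom_matrix_def)
    then show ?thesis by (simp add: vcomp_def mv_def hcomp_sum)
  next
    case False
    then show ?thesis using D by (simp add: vcomp_def mv_def hom_matrix_def)
  qed
qed

lemma free_fun_decompose:
  assumes "x \<in> free_fun V r"
  obtains S where "finite S" "x = (\<Sum>d\<in>S. vcomp s d x)"
proof
  \<comment> \<open>All degrees in which some coordinate of \<open>x\<close> has a monomial, counted
    with the shift of that coordinate.\<close>
  define S where "S = (\<Union>l<r. (\<lambda>m. int (mon_deg m) + s l) ` keys (x l))"
  show fin: "finite S" by (simp add: S_def)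
  show "x = (\<Sum>d\<in>S. vcomp s d x)"
  proof (rule ext, rule poly_mapping_eqI)
    fix l m
    have "lookup ((\<Sum>d\<in>S. vcomp s d x) l) m = (\<Sum>d\<in>S. if d = int (mon_deg m) + s l then lookup (x l) m else 0)"
      unfolding sum_fun_apply lookup_sum vcomp_def lookup_hcomp by (rule sum.cong) auto
    also have "\<dots> = (if int (mon_deg m) + s l \<in> S then lookup (x l) m else 0)"
      using fin by simp
    also have "\<dots> = lookup (x l) m"
    proof (cases "lookup (x l) m = 0")
      case False
      then have "m \<in> keys (x l)" by (simp add: in_keys_iff)
      moreover have "l < r" using assms False by (cases "l < r") (auto simp: free_fun_def)
      ultimately have "int (mon_deg m) + s l \<in> S" by (auto simp: S_def)
      then show ?thesis by simp
    qed simp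
    finally show "lookup (x l) m = lookup ((\<Sum>d\<in>S. vcomp s d x) l) m" by simp
  qed
qed

definition mono_span :: "'a set \<Rightarrow> ('a \<Rightarrow>\<^sub>0 nat) set \<Rightarrow> ('a, 'k::field) mpoly set" where
  "mono_span V J = {p \<in> carrier (poly_ring V). keys p \<subseteq> J}"

lemma mono_span_sum: "(\<And>i. i \<in> S \<Longrightarrow> f i \<in> mono_span V J) \<Longrightarrow> sum f S \<in> mono_span V J"
proof -
  assume f: "\<And>i. i \<in> S \<Longrightarrow> f i \<in> mono_span V J"
  then have "sum f S \<in> carrier (poly_ring V)" by (intro poly_ring_sum) (auto simp: mono_span_def)
  moreover have "keys (sum f S) \<subseteq> J"
    using keys_sum[of f S] f by (fastforce simp: mono_span_def)
  ultimately show ?thesis by (simp add: mono_span_def)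
qed

text \<open>Exactness on the full modules, as \<open>graded_free_resolution\<close> demands, but
  already for functions and representatives; it mediates between that definition and
  \<open>graded_exact\<close>.\<close>

definition ungraded_exact ::
  "'a set \<Rightarrow> ('a \<Rightarrow>\<^sub>0 nat) set \<Rightarrow> (nat \<Rightarrow> nat) \<Rightarrow> (nat \<Rightarrow> nat \<Rightarrow> int) \<Rightarrow>
    (nat \<Rightarrow> nat \<Rightarrow> nat \<Rightarrow> ('a, 'k::field) mpoly) \<Rightarrow> (nat \<Rightarrow> ('a, 'k) mpoly) \<Rightarrow> bool" where
  "ungraded_exact V J r s D g \<longleftrightarrow>
     (\<forall>i. hom_matrix V (r i) (s i) (r (Suc i)) (s (Suc i)) (D i)) \<and>
     (\<forall>l<r 0. g l \<in> hom_piece V (s 0 l)) \<and>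
     (\<forall>p\<in>carrier (poly_ring V). \<exists>x\<in>free_fun V (r 0). p - (\<Sum>l<r 0. x l * g l) \<in> mono_span V J) \<and>
     {x \<in> free_fun V (r 0). (\<Sum>l<r 0. x l * g l) \<in> mono_span V J} = mv (r 1) (D 0) ` free_fun V (r 1) \<and>
     (\<forall>i. {x \<in> free_fun V (r (Suc i)). mv (r (Suc i)) (D i) x = 0} =
        mv (r (Suc (Suc i))) (D (Suc i)) ` free_fun V (r (Suc (Suc i))))"

lemma mv_row_mat: "mv n (row_mat g) x = (\<lambda>l. if l = 0 then \<Sum>l<n. x l * g l else 0)"
  by (auto simp: mv_def row_mat_def fun_eq_iff mult.commute)

text \<open>Exactness can be tested on homogeneous elements, since homogeneous maps commute with taking
  components.\<close>

lemma im_eq_ker_graded_iff: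
  assumes E: "hom_matrix V r s r' s' E"
    and L: "linear_map L" and Z0: "0 \<in> Z" and Zs: "\<And>x y. x \<in> Z \<Longrightarrow> y \<in> Z \<Longrightarrow> x + y \<in> Z"
    and Lc: "\<And>x d. x \<in> free_fun V r \<Longrightarrow> L x \<in> Z \<Longrightarrow> L (vcomp s d x) \<in> Z"
  shows "{x \<in> free_fun V r. L x \<in> Z} = mv r' E ` free_fun V r' \<longleftrightarrow>
    (\<forall>d. im_piece V r' s' E d = {x \<in> free_piece V r s d. L x \<in> Z})"
proof
  assume eq: "{x \<in> free_fun V r. L x \<in> Z} = mv r' E ` free_fun V r'"
  show "\<forall>d. im_piece V r' s' E d = {x \<in> free_piece V r s d. L x \<in> Z}"
  proof (intro allI equalityI subsetI)
    fix d x assume "x \<in> im_piece V r' s' E d"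
    then obtain y where y: "y \<in> free_piece V r' s' d" "x = mv r' E y" by (auto simp: im_piece_def)
    then have "x \<in> mv r' E ` free_fun V r'" using free_piece_free_fun by blast
    then have "L x \<in> Z" using eq by blast
    then show "x \<in> {x \<in> free_piece V r s d. L x \<in> Z}" using mv_free_piece[OF E y(1)] y by simp
  next
    fix d x assume x: "x \<in> {x \<in> free_piece V r s d. L x \<in> Z}"
    then have "x \<in> {x \<in> free_fun V r. L x \<in> Z}" by (auto dest: free_piece_free_fun)
    then obtain y where y: "y \<in> free_fun V r'" "x = mv r' E y" using eq by auto
    have "x = vcomp s d x" using x vcomp_id by (metis (no_types, lifting) mem_Collect_eq)
    also have "\<dots> = mv r' E (vcomp s' d y)" unfolding y(2) by (rule vcomp_mv[OF E])
    finally show "x \<in> im_piece V r' s' E d"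
      unfolding im_piece_def using vcomp_free_piece[OF y(1)] by blast
  qed
next
  assume eq: "\<forall>d. im_piece V r' s' E d = {x \<in> free_piece V r s d. L x \<in> Z}"
  have Zsum: "sum f S \<in> Z" if "\<And>i. i \<in> S \<Longrightarrow> f i \<in> Z" for f and S :: "int set"
    using that by (induction S rule: infinite_finite_induct) (auto intro: Z0 Zs)
  show "{x \<in> free_fun V r. L x \<in> Z} = mv r' E ` free_fun V r'"
  proof (intro equalityI subsetI)
    fix x assume x: "x \<in> {x \<in> free_fun V r. L x \<in> Z}"
    then obtain S where S: "finite S" "x = (\<Sum>d\<in>S. vcomp s d x)" using free_fun_decompose by blast
    have "\<forall>d. \<exists>y. y \<in> free_piece V r' s' d \<and> vcomp s d x = mv r' E y"
    proof
      fix d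
      have "vcomp s d x \<in> {x \<in> free_piece V r s d. L x \<in> Z}"
        using x Lc vcomp_free_piece by auto
      then have "vcomp s d x \<in> im_piece V r' s' E d" using eq by simp
      then show "\<exists>y. y \<in> free_piece V r' s' d \<and> vcomp s d x = mv r' E y" by (auto simp: im_piece_def)
    qed
    then obtain y where y: "\<And>d. y d \<in> free_piece V r' s' d" "\<And>d. vcomp s d x = mv r' E (y d)" by metis
    have "x = mv r' E (\<Sum>d\<in>S. y d)"
      unfolding linear_map_sum[OF linear_map_mv] using S(2) by (simp only: y(2))
    moreover have "(\<Sum>d\<in>S. y d) \<in> free_fun V r'"
      using y(1) free_piece_free_fun by (intro free_fun_sum) blast
    ultimately show "x \<in> mv r' E ` free_fun V r'" by blast
  next
    fix x assume "x \<in> mv r' E ` free_fun V r'"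
    then obtain y where y: "y \<in> free_fun V r'" "x = mv r' E y" by auto
    obtain S where S: "finite S" "y = (\<Sum>d\<in>S. vcomp s' d y)" using free_fun_decompose y(1) by blast
    have "L (mv r' E (vcomp s' d y)) \<in> Z" for d
    proof -
      have "mv r' E (vcomp s' d y) \<in> im_piece V r' s' E d"
        using vcomp_free_piece[OF y(1)] by (auto simp: im_piece_def)
      then show ?thesis using eq by blast
    qed
    then have "(\<Sum>d\<in>S. L (mv r' E (vcomp s' d y))) \<in> Z" by (intro Zsum) auto
    moreover have "L x = (\<Sum>d\<in>S. L (mv r' E (vcomp s' d y)))"
      unfolding y(2) by (subst S(2)) (simp only: linear_map_sum[OF linear_map_mv] linear_map_sum[OF L])
    ultimately show "x \<in> {x \<in> free_fun V r. L x \<in> Z}"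
      using y mv_free_fun[OF E y(1)] by simp
  qed
qed

lemma ungraded_exact_iff:
  fixes D :: "nat \<Rightarrow> nat \<Rightarrow> nat \<Rightarrow> ('a, 'k::field) mpoly"
  assumes J: "mono_ideal J"
  shows "ungraded_exact V J r s D g \<longleftrightarrow> graded_exact V J r s D g"
proof (cases "(\<forall>i. hom_matrix V (r i) (s i) (r (Suc i)) (s (Suc i)) (D i)) \<and> (\<forall>l<r 0. g l \<in> hom_piece V (s 0 l))")
  case False
  then show ?thesis unfolding ungraded_exact_def graded_exact_def by auto
next
  case True
  then have D: "\<And>i. hom_matrix V (r i) (s i) (r (Suc i)) (s (Suc i)) (D i)" and g: "\<And>l. l < r 0 \<Longrightarrow> g l \<in> hom_piece V (s 0 l)"
    by auto
  have G: "hom_matrix V 1 (\<lambda>_. 0) (r 0) (s 0) (row_mat g)"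
    using g by (auto simp: hom_matrix_def row_mat_def)
  \<comment> \<open>Exactness at the first place is the case of the augmentation \<open>?L\<close>
    and the vectors whose coordinate 0 lies in the ideal; the later places use a differential and
    \<open>{0}\<close>.\<close>
  let ?L = "mv (r 0) (row_mat g)" and ?Z = "{z :: nat \<Rightarrow> ('a, 'k) mpoly. z 0 \<in> mono_span V J}"
  have L_iff: "?L x \<in> ?Z \<longleftrightarrow> (\<Sum>l<r 0. x l * g l) \<in> mono_span V J" for x
    by (simp add: mv_row_mat)
  have L_iff': "?L x \<in> ?Z \<longleftrightarrow> ?L x \<in> mono_piece V 1 (\<lambda>_. 0) J d" if "x \<in> free_piece V (r 0) (s 0) d" for x d
  proof -
    have "(\<forall>l. keys (?L x l) \<subseteq> J) \<longleftrightarrow> keys (?L x 0) \<subseteq> J" by (auto simp: mv_row_mat)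
    moreover have "?L x 0 \<in> carrier (poly_ring V)"
      using mv_free_piece[OF G that] by (auto simp: free_piece_def hom_piece_carrier)
    ultimately show ?thesis using mv_free_piece[OF G that] by (simp add: mono_piece_def mono_span_def)
  qed
  have A: "{x \<in> free_fun V (r 0). (\<Sum>l<r 0. x l * g l) \<in> mono_span V J} = mv (r 1) (D 0) ` free_fun V (r 1) \<longleftrightarrow>
    (\<forall>d. im_piece V (r 1) (s 1) (D 0) d =
        {x \<in> free_piece V (r 0) (s 0) d. mv (r 0) (row_mat g) x \<in> mono_piece V 1 (\<lambda>_. 0) J d})"
  proof -
    have "{x \<in> free_fun V (r 0). ?L x \<in> ?Z} = mv (r 1) (D 0) ` free_fun V (r 1) \<longleftrightarrow>
      (\<forall>d. im_piece V (r 1) (s 1) (D 0) d = {x \<in> free_piece V (r 0) (s 0) d. ?L x \<in> ?Z})"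
    proof (rule im_eq_ker_graded_iff[OF _ linear_map_mv])
      show "hom_matrix V (r 0) (s 0) (r 1) (s 1) (D 0)" using D[of 0] by simp
      show "0 \<in> ?Z" by (simp add: mono_span_def poly_ring_zero)
      show "x + y \<in> ?Z" if "x \<in> ?Z" "y \<in> ?Z" for x y
        using that mono_span_sum[of "{True, False}" "\<lambda>b. if b then x 0 else y 0" V J] by auto
      show "?L (vcomp (s 0) d x) \<in> ?Z" if "x \<in> free_fun V (r 0)" "?L x \<in> ?Z" for x d
      proof -
        have "?L (vcomp (s 0) d x) = vcomp (\<lambda>_. 0) d (?L x)" by (rule vcomp_mv[OF G, symmetric])
        then show ?thesis using that(2) by (auto simp: vcomp_def mono_span_def keys_hcomp poly_ring_carrier_iff)
      qed
    qed
    moreover have "{x \<in> free_piece V (r 0) (s 0) d. ?L x \<in> ?Z} =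
        {x \<in> free_piece V (r 0) (s 0) d. ?L x \<in> mono_piece V 1 (\<lambda>_. 0) J d}" for d
      using L_iff' by blast
    ultimately show ?thesis by (simp only: L_iff)
  qed
  have B: "{x \<in> free_fun V (r (Suc i)). mv (r (Suc i)) (D i) x = 0} =
        mv (r (Suc (Suc i))) (D (Suc i)) ` free_fun V (r (Suc (Suc i))) \<longleftrightarrow>
      (\<forall>d. im_piece V (r (Suc (Suc i))) (s (Suc (Suc i))) (D (Suc i)) d =
        {x \<in> free_piece V (r (Suc i)) (s (Suc i)) d. mv (r (Suc i)) (D i) x = 0})" for i
  proof -
    have "{x \<in> free_fun V (r (Suc i)). mv (r (Suc i)) (D i) x \<in> {0}} =
        mv (r (Suc (Suc i))) (D (Suc i)) ` free_fun V (r (Suc (Suc i))) \<longleftrightarrow>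
      (\<forall>d. im_piece V (r (Suc (Suc i))) (s (Suc (Suc i))) (D (Suc i)) d =
        {x \<in> free_piece V (r (Suc i)) (s (Suc i)) d. mv (r (Suc i)) (D i) x \<in> {0}})"
    proof (rule im_eq_ker_graded_iff[OF D linear_map_mv])
      show "mv (r (Suc i)) (D i) (vcomp (s (Suc i)) d x) \<in> {0}" if "mv (r (Suc i)) (D i) x \<in> {0}" for x d
        using that vcomp_mv[OF D[of i], of d x] by simp
    qed auto
    then show ?thesis by simp
  qed
  have C: "(\<forall>p\<in>carrier (poly_ring V). \<exists>x\<in>free_fun V (r 0). p - (\<Sum>l<r 0. x l * g l) \<in> mono_span V J) \<longleftrightarrow>
     (\<forall>d. \<forall>a\<in>free_piece V 1 (\<lambda>_. 0) d. \<exists>x\<in>free_piece V (r 0) (s 0) d. a - ?L x \<in> mono_piece V 1 (\<lambda>_. 0) J d)"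
  proof
    assume h: "\<forall>p\<in>carrier (poly_ring V). \<exists>x\<in>free_fun V (r 0). p - (\<Sum>l<r 0. x l * g l) \<in> mono_span V J"
    show "\<forall>d. \<forall>a\<in>free_piece V 1 (\<lambda>_. 0) d. \<exists>x\<in>free_piece V (r 0) (s 0) d. a - ?L x \<in> mono_piece V 1 (\<lambda>_. 0) J d"
    proof (intro allI ballI)
      fix d and a :: "nat \<Rightarrow> ('a, 'k) mpoly" assume a: "a \<in> free_piece V 1 (\<lambda>_. 0) d"
      then have "a 0 \<in> carrier (poly_ring V)" by (auto simp: free_piece_def hom_piece_carrier)
      then obtain x where x: "x \<in> free_fun V (r 0)" "(a - ?L x) 0 \<in> mono_span V J"
        using h by (auto simp: mv_row_mat)
      have x': "vcomp (s 0) d x \<in> free_piece V (r 0) (s 0) d" by (rule vcomp_free_piece[OF x(1)])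
      have eq: "a - ?L (vcomp (s 0) d x) = vcomp (\<lambda>_. 0) d (a - ?L x)"
        unfolding vcomp_mv[OF G, symmetric] using vcomp_id[OF a]
        by (auto simp: vcomp_def fun_eq_iff hcomp_diff)
      have mem: "a - ?L (vcomp (s 0) d x) \<in> free_piece V 1 (\<lambda>_. 0) d"
        using a mv_free_piece[OF G x'] by (rule graded_mod_diff[OF graded_mod_free_piece])
      have "keys ((a - ?L (vcomp (s 0) d x)) l) \<subseteq> J" for l
      proof (cases "l = 0")
        case True
        then show ?thesis unfolding eq using x(2) by (auto simp: vcomp_def keys_hcomp mono_span_def)
      next
        case False
        then have "(a - ?L (vcomp (s 0) d x)) l = 0" using mem by (auto simp: free_piece_def)
        then show ?thesis by simp
      qed
      with mem have "a - ?L (vcomp (s 0) d x) \<in> mono_piece V 1 (\<lambda>_. 0) J d" by (simp add: mono_piece_def)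
      with x' show "\<exists>x\<in>free_piece V (r 0) (s 0) d. a - ?L x \<in> mono_piece V 1 (\<lambda>_. 0) J d" by blast
    qed
  next
    assume h: "\<forall>d. \<forall>a\<in>free_piece V 1 (\<lambda>_. 0) d. \<exists>x\<in>free_piece V (r 0) (s 0) d. a - ?L x \<in> mono_piece V 1 (\<lambda>_. 0) J d"
    show "\<forall>p\<in>carrier (poly_ring V). \<exists>x\<in>free_fun V (r 0). p - (\<Sum>l<r 0. x l * g l) \<in> mono_span V J"
    proof
      fix p :: "('a, 'k) mpoly" assume p: "p \<in> carrier (poly_ring V)"
      define a where "a = (\<lambda>l::nat. if l = 0 then p else 0)"
      have a: "a \<in> free_fun V 1" using p by (simp add: a_def free_fun_def)
      then obtain S where S: "finite S" "a = (\<Sum>d\<in>S. vcomp (\<lambda>_. 0) d a)" using free_fun_decompose by blast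
      have "\<forall>d. \<exists>x. x \<in> free_piece V (r 0) (s 0) d \<and> vcomp (\<lambda>_. 0) d a - ?L x \<in> mono_piece V 1 (\<lambda>_. 0) J d"
        using h vcomp_free_piece[OF a] by blast
      then obtain x where x: "\<And>d. x d \<in> free_piece V (r 0) (s 0) d"
        "\<And>d. vcomp (\<lambda>_. 0) d a - ?L (x d) \<in> mono_piece V 1 (\<lambda>_. 0) J d" by metis
      define y where "y = (\<Sum>d\<in>S. x d)"
      have "y \<in> free_fun V (r 0)" using x(1) free_piece_free_fun unfolding y_def by (intro free_fun_sum) blast
      moreover have "a - ?L y = (\<Sum>d\<in>S. vcomp (\<lambda>_. 0) d a - ?L (x d))"
        unfolding y_def linear_map_sum[OF linear_map_mv] sum_subtractf using S(2) by simp
      then have "(a - ?L y) 0 = (\<Sum>d\<in>S. (vcomp (\<lambda>_. 0) d a - ?L (x d)) 0)" by (simp only: sum_fun_apply)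
      moreover have "(vcomp (\<lambda>_. 0) d a - ?L (x d)) 0 \<in> mono_span V J" for d
        using x(2)[of d] unfolding mono_piece_def free_piece_def mono_span_def by (auto dest: hom_piece_carrier)
      ultimately have "(a - ?L y) 0 \<in> mono_span V J" by (simp only: mono_span_sum)
      moreover have "(a - ?L y) 0 = p - (\<Sum>l<r 0. y l * g l)" by (simp add: a_def mv_row_mat)
      ultimately show "\<exists>x\<in>free_fun V (r 0). p - (\<Sum>l<r 0. x l * g l) \<in> mono_span V J"
        using \<open>y \<in> free_fun V (r 0)\<close> by auto
    qed
  qed
  show ?thesis unfolding ungraded_exact_def graded_exact_def A B C by blast
qed

section \<open>Resolutions of monomial quotients\<close>

lemma cring_poly_ring: "cring (poly_ring V :: ('a, 'k::field) mpoly ring)"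
proof (intro cringI abelian_groupI comm_monoidI)
  let ?R = "poly_ring V :: ('a, 'k) mpoly ring"
  note simps = poly_ring_def[of V]
  show "x \<oplus>\<^bsub>?R\<^esub> y \<in> carrier ?R" if "x \<in> carrier ?R" "y \<in> carrier ?R" for x y
    using poly_ring_add[OF that] by (simp add: simps)
  show "x \<otimes>\<^bsub>?R\<^esub> y \<in> carrier ?R" if "x \<in> carrier ?R" "y \<in> carrier ?R" for x y
    using poly_ring_mult[OF that] by (simp add: simps)
  show "\<zero>\<^bsub>?R\<^esub> \<in> carrier ?R" "\<one>\<^bsub>?R\<^esub> \<in> carrier ?R" by (simp_all add: simps)
  show "\<exists>y\<in>carrier ?R. y \<oplus>\<^bsub>?R\<^esub> x = \<zero>\<^bsub>?R\<^esub>" if "x \<in> carrier ?R" for x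
    using poly_ring_uminus[OF that] by (intro bexI[of _ "- x"]) (simp_all add: simps)
qed (simp_all add: poly_ring_def algebra_simps)

lemma poly_ring_a_inv:
  assumes "p \<in> carrier (poly_ring V :: ('a, 'k::field) mpoly ring)"
  shows "\<ominus>\<^bsub>poly_ring V\<^esub> p = - p"
proof -
  interpret R: cring "poly_ring V :: ('a, 'k) mpoly ring" by (rule cring_poly_ring)
  show ?thesis
    by (rule R.minus_equality) (use assms poly_ring_uminus[OF assms] in \<open>simp_all add: poly_ring_def\<close>)
qed

lemma mono_span_diff: "p \<in> mono_span V J \<Longrightarrow> q \<in> mono_span V J \<Longrightarrow> p - q \<in> mono_span V J"
  using keys_minus_subset[of p q] poly_ring_diff[of p V q] by (auto simp: mono_span_def)

lemma mono_span_zero: "0 \<in> mono_span V J"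
  by (simp add: mono_span_def poly_ring_zero)

lemma mono_span_mult:
  assumes J: "mono_ideal J" and "p \<in> mono_span V J" "q \<in> carrier (poly_ring V)"
  shows "p * q \<in> mono_span V J"
proof -
  have "keys (p * q) \<subseteq> J"
  proof
    fix m assume "m \<in> keys (p * q)"
    then obtain a b where "m = a + b" "a \<in> keys p"
      using keys_mult[of p q] by auto
    then show "m \<in> J" using assms by (auto simp: mono_ideal_def mono_span_def)
  qed
  then show ?thesis using assms poly_ring_mult[of p V q] by (simp add: mono_span_def)
qed

lemma ideal_mono_span:
  assumes J: "mono_ideal J"
  shows "ideal (mono_span V J :: ('a, 'k::field) mpoly set) (poly_ring V)"
proof -
  interpret R: cring "poly_ring V :: ('a, 'k) mpoly ring" by (rule cring_poly_ring)
  let ?R = "poly_ring V :: ('a, 'k) mpoly ring" and ?I = "mono_span V J :: ('a, 'k) mpoly set"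
  have sub: "?I \<subseteq> carrier ?R" by (auto simp: mono_span_def)
  have "- p \<in> ?I" if "p \<in> ?I" for p using mono_span_diff[OF mono_span_zero that] by simp
  moreover have "p + q \<in> ?I" if "p \<in> ?I" "q \<in> ?I" for p q
    using mono_span_sum[of "{True, False}" "\<lambda>b. if b then p else q" V J] that by auto
  moreover have "\<ominus>\<^bsub>?R\<^esub> p = - p" if "p \<in> ?I" for p using poly_ring_a_inv[of p V] sub that by auto
  moreover have "p \<oplus>\<^bsub>?R\<^esub> q = p + q" for p q by (simp add: poly_ring_def)
  ultimately have "subgroup ?I (add_monoid ?R)"
    using sub mono_span_zero[of V J] by (intro R.add.subgroupI) (auto simp: a_inv_def)
  then show ?thesis
    using mono_span_mult[OF J] by (intro idealI R.ring_axioms) (auto simp: poly_ring_def mult.commute)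
qed

context
  fixes V :: "'a set" and J :: "('a \<Rightarrow>\<^sub>0 nat) set" and I :: "('a, 'k::field) mpoly set"
  assumes J: "mono_ideal J" and I: "I = mono_span V J"
begin

abbreviation (input) "RR \<equiv> poly_ring V :: ('a, 'k) mpoly ring"
abbreviation (input) "cls p \<equiv> I +>\<^bsub>poly_ring V\<^esub> p"

lemma cls_eq_iff: "cls p = cls q \<longleftrightarrow> p - q \<in> I"
proof -
  have cls: "cls p = (\<lambda>h. h + p) ` I" for p
    by (auto simp: a_r_coset_def' poly_ring_def)
  show ?thesis
  proof
    assume "cls p = cls q"
    moreover have "p \<in> cls p" unfolding cls using mono_span_zero[of V J] by (auto simp: I image_iff)
    ultimately obtain h where "h \<in> I" "p = h + q" unfolding cls by auto
    then show "p - q \<in> I" by simp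
  next
    assume d: "p - q \<in> I"
    show "cls p = cls q"
    proof (intro equalityI subsetI)
      fix x assume "x \<in> cls p"
      then obtain h where h: "h \<in> I" "x = h + p" by (auto simp: cls)
      have "h - (q - p) \<in> I"
        using mono_span_diff[of h V J "q - p"] mono_span_diff[OF mono_span_zero, of "p - q" V J] h d by (simp add: I)
      moreover have "x = (h - (q - p)) + q" by (simp add: h)
      ultimately show "x \<in> cls q" unfolding cls by blast
    next
      fix x assume "x \<in> cls q"
      then obtain h where h: "h \<in> I" "x = h + q" by (auto simp: cls)
      have "h - (p - q) \<in> I" using mono_span_diff[of h V J "p - q"] h d by (simp add: I)
      moreover have "x = (h - (p - q)) + p" by (simp add: h)
      ultimately show "x \<in> cls p" unfolding cls by blast
    qed
  qed
qed

text \<open>Reduces the quotient module to polynomial arithmetic on representatives.\<close>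

lemma quot_module_simps:
  "carrier (quot_module RR I) = cls ` carrier RR"
  "zero (quot_module RR I) = cls 0"
  "p \<in> carrier RR \<Longrightarrow> q \<in> carrier RR \<Longrightarrow> add (quot_module RR I) (cls p) (cls q) = cls (p + q)"
  "p \<in> carrier RR \<Longrightarrow> q \<in> carrier RR \<Longrightarrow> smult (quot_module RR I) p (cls q) = cls (p * q)"
proof -
  interpret ideal I RR unfolding I by (rule ideal_mono_span[OF J])
  show "carrier (quot_module RR I) = cls ` carrier RR"
    by (auto simp: quot_module_def FactRing_def A_RCOSETS_def')
  have "cls 0 = I"
    by (auto simp: a_r_coset_def' poly_ring_def)
  then show "zero (quot_module RR I) = cls 0" by (simp add: quot_module_def FactRing_def)
  show "add (quot_module RR I) (cls p) (cls q) = cls (p + q)" if "p \<in> carrier RR" "q \<in> carrier RR"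
    using a_rcos_sum[OF that] by (simp add: quot_module_def FactRing_def) (simp add: poly_ring_def)
  show "smult (quot_module RR I) p (cls q) = cls (p * q)" if "p \<in> carrier RR" "q \<in> carrier RR"
    using rcoset_mult_add[OF that] by (simp add: quot_module_def FactRing_def) (simp add: poly_ring_def)
qed

lemma abelian_monoid_quot_module: "abelian_monoid (quot_module RR I)"
  by (rule abelian_monoidI)
    (auto simp: quot_module_simps poly_ring_add poly_ring_zero add.assoc, auto simp: add.commute)

lemma finsum_quot_module:
  assumes "finite A" "\<And>l. l \<in> A \<Longrightarrow> f l \<in> carrier RR"
  shows "(\<Oplus>\<^bsub>quot_module RR I\<^esub>l\<in>A. cls (f l)) = cls (\<Sum>l\<in>A. f l)"
proof -
  interpret M: abelian_monoid "quot_module RR I" by (rule abelian_monoid_quot_module)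
  show ?thesis
    using assms
  proof (induction A)
    case empty
    then show ?case by (simp add: quot_module_simps)
  next
    case (insert a A)
    have "(\<Oplus>\<^bsub>quot_module RR I\<^esub>l\<in>insert a A. cls (f l)) =
        cls (f a) \<oplus>\<^bsub>quot_module RR I\<^esub> (\<Oplus>\<^bsub>quot_module RR I\<^esub>l\<in>A. cls (f l))"
      using insert by (intro M.finsum_insert) (auto simp: quot_module_simps)
    then show ?case using insert by (simp add: quot_module_simps poly_ring_sum)
  qed
qed

end

section \<open>Vectors and matrices as zero-padded functions\<close>

definition vec_fun :: "'b::zero vec \<Rightarrow> nat \<Rightarrow> 'b" where
  "vec_fun x = (\<lambda>l. if l < dim_vec x then x $ l else 0)"

definition mat_fun :: "'b::zero mat \<Rightarrow> nat \<Rightarrow> nat \<Rightarrow> 'b" where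
  "mat_fun A = (\<lambda>a b. if a < dim_row A \<and> b < dim_col A then A $$ (a, b) else 0)"

lemma vec_fun_mult:
  assumes "A \<in> carrier_mat n m" "x \<in> carrier_vec m"
  shows "vec_fun (A *\<^sub>v x) = mv m (mat_fun A) (vec_fun x)"
proof
  fix i
  show "vec_fun (A *\<^sub>v x) i = mv m (mat_fun A) (vec_fun x) i"
    using assms by (auto simp: vec_fun_def mat_fun_def mv_def scalar_prod_def lessThan_atLeast0 intro!: sum.cong)
qed

lemma vec_fun_zero: "vec_fun (0\<^sub>v n) = 0"
  by (auto simp: vec_fun_def)

lemma inj_on_vec_fun: "inj_on vec_fun (carrier_vec n)"
proof (rule inj_onI, rule eq_vecI)
  fix x y :: "'a vec" and i assume *: "x \<in> carrier_vec n" "y \<in> carrier_vec n" "vec_fun x = vec_fun y"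
  show "x $ i = y $ i" if "i < dim_vec y"
    using fun_cong[OF *(3), of i] that * by (simp add: vec_fun_def)
qed auto

lemma vec_fun_vec: "(\<And>l. l \<ge> n \<Longrightarrow> f l = 0) \<Longrightarrow> vec_fun (vec n f) = f"
  by (auto simp: vec_fun_def)

lemma vec_fun_free_mod: "vec_fun ` free_mod V r = (free_fun V r :: (nat \<Rightarrow> ('a, 'k::field) mpoly) set)"
proof (intro equalityI subsetI)
  fix f :: "nat \<Rightarrow> ('a, 'k) mpoly" assume f: "f \<in> free_fun V r"
  then have "vec_fun (vec r f) = f" by (intro vec_fun_vec) (simp add: free_fun_def)
  moreover have "vec r f \<in> free_mod V r" using f by (simp add: free_fun_def free_mod_def)
  ultimately show "f \<in> vec_fun ` free_mod V r" by (metis imageI)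
qed (auto simp: free_fun_def free_mod_def vec_fun_def)

lemma vec_fun_tens_piece:
  fixes F :: "('a, 'k::field, 'm) free_seq"
  shows "vec_fun ` tens_piece F i j = const_piece (frank F i) (shift F i) j"
proof (intro equalityI subsetI)
  fix f :: "nat \<Rightarrow> 'k" assume f: "f \<in> const_piece (frank F i) (shift F i) j"
  then have "vec_fun (vec (frank F i) f) = f" by (intro vec_fun_vec) (force simp: const_piece_def)
  moreover have "vec (frank F i) f \<in> tens_piece F i j" using f by (simp add: const_piece_def tens_piece_def)
  ultimately show "f \<in> vec_fun ` tens_piece F i j" by (metis imageI)
qed (auto simp: const_piece_def tens_piece_def vec_fun_def split: if_splits)

lemma mat_fun_tens_dmat: "mat_fun (tens_dmat F i) = cmat (mat_fun (dmat F i))"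
  by (auto simp: mat_fun_def tens_dmat_def fun_eq_iff)

lemma image_vec_fun_mult:
  assumes "A \<in> carrier_mat n m" "S \<subseteq> carrier_vec m"
  shows "vec_fun ` ((\<lambda>y. A *\<^sub>v y) ` S) = mv m (mat_fun A) ` (vec_fun ` S)"
  using assms vec_fun_mult[OF assms(1)] unfolding image_image by (intro image_cong) auto

lemma image_vec_fun_ker:
  assumes A: "A \<in> carrier_mat n m" "S \<subseteq> carrier_vec m"
  shows "vec_fun ` {x \<in> S. A *\<^sub>v x = 0\<^sub>v n} = {x \<in> vec_fun ` S. mv m (mat_fun A) x = 0}"
proof -
  have "A *\<^sub>v x = 0\<^sub>v n \<longleftrightarrow> mv m (mat_fun A) (vec_fun x) = 0" if "x \<in> S" for x
  proof -
    have x: "x \<in> carrier_vec m" using that assms by auto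
    have "A *\<^sub>v x = 0\<^sub>v n \<longleftrightarrow> vec_fun (A *\<^sub>v x) = vec_fun (0\<^sub>v n)"
      by (rule inj_on_eq_iff[OF inj_on_vec_fun[of n], symmetric]) (use A x in auto)
    then show ?thesis by (simp add: vec_fun_mult[OF A(1) x] vec_fun_zero)
  qed
  then show ?thesis by auto
qed

lemma tor_vanish_mat_fun:
  assumes d: "\<And>i. dmat F i \<in> carrier_mat (frank F i) (frank F (Suc i))"
  shows "tor_cycles F i j \<subseteq> tor_boundaries F i j \<longleftrightarrow> tor_vanish (frank F) (shift F) (\<lambda>i. mat_fun (dmat F i)) i j"
proof -
  have t: "tens_dmat F i \<in> carrier_mat (frank F i) (frank F (Suc i))" for i
    using d[of i] by (simp add: tens_dmat_def)
  have tp: "tens_piece F i j \<subseteq> carrier_vec (frank F i)" for i by (auto simp: tens_piece_def)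
  have b: "vec_fun ` tor_boundaries F i j = mv (frank F (Suc i)) (cmat (mat_fun (dmat F i))) ` const_piece (frank F (Suc i)) (shift F (Suc i)) j" for i
    unfolding tor_boundaries_def image_vec_fun_mult[OF t tp] vec_fun_tens_piece mat_fun_tens_dmat ..
  have image_sub: "X \<subseteq> h ` Y \<longleftrightarrow> (\<forall>x\<in>X. \<exists>y\<in>Y. h y = x)" for X Y and h :: "(nat \<Rightarrow> 'b) \<Rightarrow> nat \<Rightarrow> 'b"
    unfolding subset_iff image_iff by metis
  have bc: "tor_boundaries F i j \<subseteq> carrier_vec (frank F i)"
  proof
    fix x assume "x \<in> tor_boundaries F i j"
    then obtain y where "x = tens_dmat F i *\<^sub>v y" by (auto simp: tor_boundaries_def)
    then show "x \<in> carrier_vec (frank F i)" using t[of i] by (auto intro: carrier_vecI)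
  qed
  have cc: "tor_cycles F i j \<subseteq> carrier_vec (frank F i)"
    using tp by (auto simp: tor_cycles_def split: nat.splits)
  have "tor_cycles F i j \<subseteq> tor_boundaries F i j \<longleftrightarrow> vec_fun ` tor_cycles F i j \<subseteq> vec_fun ` tor_boundaries F i j"
  proof
    assume sub: "vec_fun ` tor_cycles F i j \<subseteq> vec_fun ` tor_boundaries F i j"
    show "tor_cycles F i j \<subseteq> tor_boundaries F i j"
    proof
      fix x assume x: "x \<in> tor_cycles F i j"
      then obtain y where y: "y \<in> tor_boundaries F i j" "vec_fun x = vec_fun y" using sub by blast
      then have "x = y" using inj_onD[OF inj_on_vec_fun[of "frank F i"]] x cc bc by blast
      with y show "x \<in> tor_boundaries F i j" by simp
    qed
  qed (rule image_mono)
  also have "\<dots> \<longleftrightarrow> tor_vanish (frank F) (shift F) (\<lambda>i. mat_fun (dmat F i)) i j"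
  proof (cases i)
    case 0
    then have "vec_fun ` tor_cycles F i j = const_piece (frank F 0) (shift F 0) j"
      by (simp add: tor_cycles_def vec_fun_tens_piece)
    then show ?thesis unfolding b image_sub 0 by simp
  next
    case (Suc h)
    have "vec_fun ` tor_cycles F i j = {x \<in> const_piece (frank F i) (shift F i) j. mv (frank F i) (cmat (mat_fun (dmat F h))) x = 0}"
      using image_vec_fun_ker[OF t[of h] tp[of "Suc h"]] by (simp add: tor_cycles_def Suc vec_fun_tens_piece mat_fun_tens_dmat)
    then show ?thesis unfolding b image_sub unfolding Suc by (simp add: Ball_def imp_conjL)
  qed
  finally show ?thesis .
qed

text \<open>The generators are cosets of homogeneous polynomials; fixing representatives
  \<open>g\<close> turns each clause of the definition into one about polynomials, matched one by
  one in \<open>A\<close> to \<open>E\<close>.\<close>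

lemma graded_free_resolution_iff:
  fixes g :: "nat \<Rightarrow> ('a, 'k::field) mpoly"
  assumes J: "mono_ideal J" and I: "I = mono_span V J"
    and g: "\<And>l. l < frank F 0 \<Longrightarrow> g l \<in> hom_piece V (shift F 0 l)"
    and gen: "\<And>l. l < frank F 0 \<Longrightarrow> gen F l = I +>\<^bsub>poly_ring V\<^esub> g l"
    and d: "\<And>i. dmat F i \<in> carrier_mat (frank F i) (frank F (Suc i))"
  shows "graded_free_resolution V (quot_module (poly_ring V) I) (quot_piece V I) F \<longleftrightarrow>
    ungraded_exact V J (frank F) (shift F) (\<lambda>i. mat_fun (dmat F i)) g"
proof -
  let ?M = "quot_module (poly_ring V) I"
  note qs = quot_module_simps[OF J I]
  have aug: "augment ?M F x = I +>\<^bsub>poly_ring V\<^esub> (\<Sum>l<frank F 0. vec_fun x l * g l)" if x: "x \<in> free_mod V (frank F 0)" for x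
  proof -
    have xl: "x $ l \<in> carrier (poly_ring V)" "vec_fun x l = x $ l" "g l \<in> carrier (poly_ring V)" if "l < frank F 0" for l
      using x that g[OF that] hom_piece_carrier by (auto simp: free_mod_def vec_fun_def)
    have "augment ?M F x = (\<Oplus>\<^bsub>?M\<^esub>l\<in>{..<frank F 0}. I +>\<^bsub>poly_ring V\<^esub> (vec_fun x l * g l))"
      unfolding augment_def
    proof (rule abelian_monoid.finsum_cong'[OF abelian_monoid_quot_module[OF J I]])
    qed (use xl in \<open>auto simp: gen qs poly_ring_mult\<close>)
    also have "\<dots> = I +>\<^bsub>poly_ring V\<^esub> (\<Sum>l<frank F 0. vec_fun x l * g l)"
      by (rule finsum_quot_module[OF J I]) (use xl in \<open>auto simp: poly_ring_mult\<close>)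
    finally show ?thesis .
  qed
  have sum_c: "(\<Sum>l<frank F 0. x l * g l) \<in> carrier (poly_ring V)" if "x \<in> free_fun V (frank F 0)" for x
    using that g hom_piece_carrier by (intro poly_ring_sum poly_ring_mult) (auto simp: free_fun_def)
  have free_mod_vec: "free_mod V r \<subseteq> carrier_vec r" for r :: nat by (auto simp: free_mod_def)
  have A: "(\<forall>l<frank F 0. gen F l \<in> quot_piece V I (shift F 0 l)) \<longleftrightarrow> (\<forall>l<frank F 0. g l \<in> hom_piece V (shift F 0 l))"
    using g gen by (auto simp: quot_piece_def)
  have B: "(\<forall>r<frank F i. \<forall>c<frank F (Suc i). dmat F i $$ (r, c) \<in> hom_piece V (shift F (Suc i) c - shift F i r)) \<longleftrightarrow>
    hom_matrix V (frank F i) (shift F i) (frank F (Suc i)) (shift F (Suc i)) (mat_fun (dmat F i))" for i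
    using d[of i] by (auto simp: hom_matrix_def mat_fun_def)
  have C: "augment ?M F ` free_mod V (frank F 0) = carrier ?M \<longleftrightarrow>
    (\<forall>p\<in>carrier (poly_ring V). \<exists>x\<in>free_fun V (frank F 0). p - (\<Sum>l<frank F 0. x l * g l) \<in> mono_span V J)"
  proof -
    have "augment ?M F ` free_mod V (frank F 0) =
        (\<lambda>x. I +>\<^bsub>poly_ring V\<^esub> (\<Sum>l<frank F 0. x l * g l)) ` free_fun V (frank F 0)"
      unfolding vec_fun_free_mod[symmetric] image_image by (rule image_cong) (use aug in auto)
    moreover have "\<dots> = carrier ?M \<longleftrightarrow> (\<forall>p\<in>carrier (poly_ring V). \<exists>x\<in>free_fun V (frank F 0).
          I +>\<^bsub>poly_ring V\<^esub> p = I +>\<^bsub>poly_ring V\<^esub> (\<Sum>l<frank F 0. x l * g l))"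
      (is "?X = _ \<longleftrightarrow> ?P")
    proof -
      have "?X \<subseteq> carrier ?M" using sum_c by (auto simp: qs)
      then have "?X = carrier ?M \<longleftrightarrow> (\<forall>p\<in>carrier (poly_ring V). I +>\<^bsub>poly_ring V\<^esub> p \<in> ?X)" unfolding qs by blast
      then show ?thesis by (simp only: image_iff)
    qed
    ultimately have "augment ?M F ` free_mod V (frank F 0) = carrier ?M \<longleftrightarrow> ?P" by simp
    then show ?thesis unfolding cls_eq_iff[OF J I] by (simp add: I)
  qed
  have D: "{x \<in> free_mod V (frank F 0). augment ?M F x = \<zero>\<^bsub>?M\<^esub>} = (\<lambda>y. dmat F 0 *\<^sub>v y) ` free_mod V (frank F 1) \<longleftrightarrow>
    {x \<in> free_fun V (frank F 0). (\<Sum>l<frank F 0. x l * g l) \<in> mono_span V J} =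
      mv (frank F 1) (mat_fun (dmat F 0)) ` free_fun V (frank F 1)"
  proof -
    have iff: "augment ?M F x = \<zero>\<^bsub>?M\<^esub> \<longleftrightarrow> (\<Sum>l<frank F 0. vec_fun x l * g l) \<in> mono_span V J"
      if "x \<in> free_mod V (frank F 0)" for x
      unfolding aug[OF that] qs cls_eq_iff[OF J I] by (simp add: I)
    have "vec_fun ` {x \<in> free_mod V (frank F 0). augment ?M F x = \<zero>\<^bsub>?M\<^esub>} =
        {x \<in> free_fun V (frank F 0). (\<Sum>l<frank F 0. x l * g l) \<in> mono_span V J}"
      unfolding vec_fun_free_mod[symmetric] using iff by auto
    moreover have "vec_fun ` ((\<lambda>y. dmat F 0 *\<^sub>v y) ` free_mod V (frank F 1)) =
        mv (frank F 1) (mat_fun (dmat F 0)) ` free_fun V (frank F 1)"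
      using image_vec_fun_mult[OF d[of 0] free_mod_vec] by (simp add: vec_fun_free_mod)
    moreover have "(\<lambda>y. dmat F 0 *\<^sub>v y) ` free_mod V (frank F 1) \<subseteq> carrier_vec (frank F 0)"
    proof
      fix x assume "x \<in> (\<lambda>y. dmat F 0 *\<^sub>v y) ` free_mod V (frank F 1)"
      then show "x \<in> carrier_vec (frank F 0)" using d[of 0] by (auto intro: carrier_vecI)
    qed
    ultimately show ?thesis
      using inj_on_image_eq_iff[OF inj_on_vec_fun, of "{x \<in> free_mod V (frank F 0). augment ?M F x = \<zero>\<^bsub>?M\<^esub>}" "frank F 0"]
        free_mod_vec[of "frank F 0"] by (metis (no_types, lifting) mem_Collect_eq subset_eq)
  qed
  have E: "{x \<in> free_mod V (frank F (Suc i)). dmat F i *\<^sub>v x = 0\<^sub>v (frank F i)} =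
       (\<lambda>y. dmat F (Suc i) *\<^sub>v y) ` free_mod V (frank F (Suc (Suc i))) \<longleftrightarrow>
     {x \<in> free_fun V (frank F (Suc i)). mv (frank F (Suc i)) (mat_fun (dmat F i)) x = 0} =
        mv (frank F (Suc (Suc i))) (mat_fun (dmat F (Suc i))) ` free_fun V (frank F (Suc (Suc i)))" for i
  proof -
    have 1: "(\<lambda>y. dmat F (Suc i) *\<^sub>v y) ` free_mod V (frank F (Suc (Suc i))) \<subseteq> carrier_vec (frank F (Suc i))"
    proof
      fix x assume "x \<in> (\<lambda>y. dmat F (Suc i) *\<^sub>v y) ` free_mod V (frank F (Suc (Suc i)))"
      then show "x \<in> carrier_vec (frank F (Suc i))" using d[of "Suc i"] by (auto intro: carrier_vecI)
    qed
    have 2: "{x \<in> free_mod V (frank F (Suc i)). dmat F i *\<^sub>v x = 0\<^sub>v (frank F i)} \<subseteq> carrier_vec (frank F (Suc i))"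
      using free_mod_vec by auto
    show ?thesis
      unfolding inj_on_image_eq_iff[OF inj_on_vec_fun 2 1, symmetric]
      by (simp only: image_vec_fun_ker[OF d free_mod_vec] image_vec_fun_mult[OF d free_mod_vec] vec_fun_free_mod)
  qed
  show ?thesis
    unfolding graded_free_resolution_def ungraded_exact_def A B C D E using d by blast
qed

section \<open>Existence of resolutions\<close>

text \<open>Elimination on the positions in \<open>X\<close>, which together detect zero: the
  vectors whose coefficient at one position vanishes form \<open>N0\<close>, and a single vector
  \<open>g\<close> with nonzero coefficient there suffices to span \<open>N\<close> over it.\<close>

lemma finite_spanning_set:
  fixes N :: "(nat \<Rightarrow> ('a, 'k::field) mpoly) set"
  assumes "finite X"
    and "0 \<in> N" "\<And>x y. x \<in> N \<Longrightarrow> y \<in> N \<Longrightarrow> x - y \<in> N"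
    and "\<And>c x. x \<in> N \<Longrightarrow> scale (single 0 c) x \<in> N"
    and "\<And>x. x \<in> N \<Longrightarrow> (\<And>l m. (l, m) \<in> X \<Longrightarrow> lookup (x l) m = 0) \<Longrightarrow> x = 0"
  shows "\<exists>B. finite B \<and> B \<subseteq> N \<and> (\<forall>x\<in>N. \<exists>c. x = (\<Sum>b\<in>B. scale (single 0 (c b)) b))"
  using assms
proof (induction X arbitrary: N)
  case empty
  then have "x = 0" if "x \<in> N" for x using that by blast
  then have "\<forall>x\<in>N. \<exists>c. x = (\<Sum>b\<in>{}. scale (single 0 (c b)) b)" by (simp only: sum.empty) blast
  then show ?case by (intro exI[of _ "{}"] conjI finite.emptyI empty_subsetI)
next
  case (insert i X)
  obtain l m where i: "i = (l, m)" by fastforce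
  have lookup_scale: "lookup (scale (single 0 c) x l) m = c * lookup (x l) m" for c and x :: "nat \<Rightarrow> ('a, 'k) mpoly"
  proof -
    have "single 0 c * x l = (\<Sum>k\<in>keys (x l). single k (c * lookup (x l) k))"
      by (subst poly_mapping_sum_single[of "x l", symmetric]) (simp add: sum_distrib_left mult_single)
    then show ?thesis by (auto simp: lookup_sum lookup_single when_def in_keys_iff)
  qed
  define N0 where "N0 = {x \<in> N. lookup (x l) m = 0}"
  have "\<exists>B. finite B \<and> B \<subseteq> N0 \<and> (\<forall>x\<in>N0. \<exists>c. x = (\<Sum>b\<in>B. scale (single 0 (c b)) b))"
  proof (rule insert.IH)
    show "x = 0" if "x \<in> N0" "\<And>l m. (l, m) \<in> X \<Longrightarrow> lookup (x l) m = 0" for x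
      using that by (intro insert.prems(4)) (auto simp: N0_def i)
    show "scale (single 0 c) x \<in> N0" if "x \<in> N0" for c x
      using that insert.prems(3)[of x c] lookup_scale[of c x] by (simp add: N0_def del: scale_apply)
  qed (use insert.prems(1,2) in \<open>auto simp: N0_def lookup_minus\<close>)
  then obtain B where B: "finite B" "B \<subseteq> N0" "\<And>x. x \<in> N0 \<Longrightarrow> \<exists>c. x = (\<Sum>b\<in>B. scale (single 0 (c b)) b)"
    by blast
  show ?case
  proof (cases "N0 = N")
    case True
    then show ?thesis using B by blast
  next
    case False
    then obtain g where g: "g \<in> N" "lookup (g l) m \<noteq> 0" by (auto simp: N0_def)
    then have gB: "g \<notin> B" using B(2) by (auto simp: N0_def)
    have "\<exists>c. x = (\<Sum>b\<in>insert g B. scale (single 0 (c b)) b)" if x: "x \<in> N" for x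
    proof -
      define a where "a = lookup (x l) m / lookup (g l) m"
      define y where "y = x - scale (single 0 a) g"
      have "y \<in> N0"
        unfolding N0_def mem_Collect_eq
      proof
        show "y \<in> N" unfolding y_def by (intro insert.prems(2,3) x g)
        have "lookup (y l) m = lookup (x l) m - lookup (scale (single 0 a) g l) m"
          by (simp only: y_def lookup_minus minus_apply)
        then show "lookup (y l) m = 0" using g(2) by (simp only: lookup_scale) (simp add: a_def)
      qed
      then obtain c where c: "y = (\<Sum>b\<in>B. scale (single 0 (c b)) b)" using B(3) by blast
      have "(\<Sum>b\<in>B. scale (single 0 ((c(g := a)) b)) b) = (\<Sum>b\<in>B. scale (single 0 (c b)) b)"
        by (rule sum.cong) (use gB in auto)
      then have "(\<Sum>b\<in>insert g B. scale (single 0 ((c(g := a)) b)) b) = scale (single 0 a) g + y"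
        by (simp only: sum.insert[OF B(1) gB] fun_upd_same c)
      moreover have "x = scale (single 0 a) g + y" by (simp add: y_def fun_eq_iff)
      ultimately have "x = (\<Sum>b\<in>insert g B. scale (single 0 ((c(g := a)) b)) b)"
        by (simp only:)
      then show ?thesis by blast
    qed
    moreover have "finite (insert g B)" "insert g B \<subseteq> N" using B(1,2) g by (auto simp: N0_def)
    ultimately show ?thesis by blast
  qed
qed

definition poly_closed :: "'a set \<Rightarrow> ('a, 'k::field) pieces \<Rightarrow> bool" where
  "poly_closed V N \<longleftrightarrow> (\<forall>d. 0 \<in> N d \<and> (\<forall>x\<in>N d. \<forall>y\<in>N d. x - y \<in> N d) \<and>
     (\<forall>e. \<forall>p\<in>hom_piece V e. \<forall>x\<in>N d. scale p x \<in> N (d + e)))"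

lemma poly_closed_graded_mod: "poly_closed V N \<Longrightarrow> graded_mod V N"
  unfolding poly_closed_def graded_mod_def by (simp add: hom_piece_var)

lemma poly_closed_free_piece: "poly_closed V (free_piece V r s)"
  unfolding poly_closed_def free_piece_def
  by (auto intro: hom_piece_diff hom_piece_mult)

lemma poly_closed_mono_piece:
  assumes "mono_ideal J"
  shows "poly_closed V (mono_piece V r s J :: ('a, 'k::field) pieces)"
  unfolding poly_closed_def
proof (intro allI conjI ballI)
  fix d e and p :: "('a, 'k) mpoly" and x :: "nat \<Rightarrow> ('a, 'k) mpoly"
  assume p: "p \<in> hom_piece V e" and x: "x \<in> mono_piece V r s J d"
  have "scale p x \<in> free_piece V r s (d + e)"
    using poly_closed_free_piece[of V r s] p x unfolding poly_closed_def mono_piece_def by blast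
  moreover have "keys (scale p x l) \<subseteq> J" for l
  proof
    fix m assume "m \<in> keys (scale p x l)"
    then obtain a b where ab: "m = b + a" "b \<in> keys (x l)"
      using keys_mult[of p "x l"] by (auto simp: add.commute)
    then have "b \<in> J" using x by (auto simp: mono_piece_def)
    then show "m \<in> J" using assms ab by (auto simp: mono_ideal_def)
  qed
  ultimately show "scale p x \<in> mono_piece V r s J (d + e)" by (auto simp: mono_piece_def)
qed (use graded_mod_mono_piece[OF assms, of V r s] in \<open>auto simp: graded_mod_def\<close>)

lemma poly_closed_kernel:
  "poly_closed V (\<lambda>d. {x \<in> free_piece V r s d. mv r D x = 0})"
  using poly_closed_free_piece[of V r s] unfolding poly_closed_def
  by (auto simp: linear_map_zero[OF linear_map_mv] linear_map_diff[OF linear_map_mv] linear_map_scale[OF linear_map_mv])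

context ordered_vars
begin

text \<open>In degrees beyond \<open>b\<close> and all generator degrees of the free module,
  elements of \<open>N\<close> lie in the multiple of the free module by the variables; vanishing
  first Koszul homology puts them in the multiple of \<open>N\<close>, so no new generators arise.
  Below the smallest generator degree \<open>N\<close> is zero. Finitely many degrees remain, each
  of finite dimension.\<close>

lemma finite_generation:
  fixes N :: "('a, 'k::field) pieces"
  assumes N: "poly_closed V N" and NF: "\<And>d. N d \<subseteq> free_piece V r s d"
    and hk: "\<And>j. j > b \<Longrightarrow> hk_zero (free_piece V r s) N (Suc 0) j"
  obtains r' s' D where "hom_matrix V r s r' s' D" "\<And>d. im_piece V r' s' D d = N d" "\<And>i l. l \<ge> r' \<Longrightarrow> D i l = 0"
proof -
  note gN = poly_closed_graded_mod[OF N]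
  have Nscale: "scale p x \<in> N d" if "p \<in> hom_piece V e" "x \<in> N d'" "d' + e = d" for p x d d' e
    using N that unfolding poly_closed_def by blast
  \<comment> \<open>The inserted 0 and \<open>b\<close> keep the sets nonempty when
    \<open>r = 0\<close>, and \<open>b\<close> makes \<open>U\<close> a valid bound for the
    vanishing.\<close>
  define L where "L = Min (insert 0 (s ` {..<r}))"
  define U where "U = Max (insert b (s ` {..<r}))"
  have L: "L \<le> s l" and U: "s l \<le> U" if "l < r" for l using that by (auto simp: L_def U_def)
  have bU: "b \<le> U" by (simp add: U_def)
  have span: "\<exists>B. finite B \<and> B \<subseteq> N d \<and> (\<forall>x\<in>N d. \<exists>c. x = (\<Sum>b\<in>B. scale (single 0 (c b)) b))" for d
  proof (rule finite_spanning_set)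
    let ?X = "SIGMA l:{..<r}. {m. keys m \<subseteq> V \<and> mon_deg m = nat (d - s l)}"
    show "finite ?X" using finite_monomials[OF finite_V] by blast
    show "0 \<in> N d" by (rule graded_mod_zero[OF gN])
    show "x - y \<in> N d" if "x \<in> N d" "y \<in> N d" for x y by (rule graded_mod_diff[OF gN that])
    show "scale (single 0 c) x \<in> N d" if "x \<in> N d" for c x
      by (rule Nscale[OF hom_piece_const that]) simp
    fix x assume x: "x \<in> N d" and z: "\<And>l m. (l, m) \<in> ?X \<Longrightarrow> lookup (x l) m = 0"
    show "x = 0"
    proof (rule ext, rule poly_mapping_eqI)
      fix l m
      have xF: "x \<in> free_piece V r s d" using x NF by blast
      have "m \<notin> keys (x l)"
      proof
        assume m: "m \<in> keys (x l)"
        then have l: "l < r" using xF by (cases "l < r") (auto simp: free_piece_def)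
        then have "keys m \<subseteq> V \<and> int (mon_deg m) = d - s l"
          using xF m by (auto simp: free_piece_def hom_piece_iff)
        then have "(l, m) \<in> ?X" using l by auto
        then show False using z m by (simp add: in_keys_iff)
      qed
      then show "lookup (x l) m = lookup (0 l) m" by (simp add: in_keys_iff)
    qed
  qed
  have "\<forall>d. \<exists>B. finite B \<and> B \<subseteq> N d \<and> (\<forall>x\<in>N d. \<exists>c. x = (\<Sum>b\<in>B. scale (single 0 (c b)) b))"
    by (rule allI, rule span)
  from choice[OF this]
  obtain Bs where Bs': "\<forall>d. finite (Bs d) \<and> Bs d \<subseteq> N d \<and>
      (\<forall>x\<in>N d. \<exists>c. x = (\<Sum>b\<in>Bs d. scale (single 0 (c b)) b))" by (elim exE)
  have Bs: "finite (Bs d)" "Bs d \<subseteq> N d"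
    "x \<in> N d \<Longrightarrow> \<exists>c. x = (\<Sum>b\<in>Bs d. scale (single 0 (c b)) b)" for d x
    using spec[OF Bs', of d] by simp_all
  have "finite (SIGMA d:{L..U}. Bs d)" using Bs(1) by blast
  then obtain gs where gs: "set gs = (SIGMA d:{L..U}. Bs d)" using finite_list by blast
  define r' where "r' = length gs"
  define s' where "s' l = fst (gs ! l)" for l
  define D where "D i l = (if l < r' then snd (gs ! l) i else 0)" for i l
  have gl: "snd (gs ! l) \<in> N (s' l)" if "l < r'" for l
  proof -
    have "gs ! l \<in> (SIGMA d:{L..U}. Bs d)" using that gs nth_mem[of l gs] by (simp add: r'_def)
    then have "snd (gs ! l) \<in> Bs (fst (gs ! l))" by auto
    then show ?thesis using Bs(2) unfolding s'_def by blast
  qed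
  have glF: "snd (gs ! l) \<in> free_piece V r s (s' l)" if "l < r'" for l using gl[OF that] NF by blast
  have D: "hom_matrix V r s r' s' D"
    using glF by (auto simp: hom_matrix_def D_def free_piece_def)
  have mvD: "mv r' D y = (\<Sum>l<r'. scale (y l) (snd (gs ! l)))" for y
    by (auto simp: mv_def D_def sum_fun_apply fun_eq_iff mult.commute intro!: sum.cong)
  have gI: "graded_mod V (im_piece V r' s' D)" by (rule graded_mod_im_piece)
  have gen: "scale (single 0 c) g \<in> im_piece V r' s' D d" if g: "g \<in> Bs d" "L \<le> d" "d \<le> U" for g c d
  proof -
    have "(d, g) \<in> set gs" using g gs by auto
    then obtain l where l: "l < r'" "gs ! l = (d, g)" by (auto simp: r'_def in_set_conv_nth)
    define y where "y k = (if k = l then single 0 c else (0 :: ('a, 'k) mpoly))" for k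
    have "y \<in> free_piece V r' s' d"
      using l hom_piece_const[of c V] by (auto simp: free_piece_def y_def s'_def)
    moreover have "mv r' D y = scale (single 0 c) g"
    proof -
      have "mv r' D y = (\<Sum>k<r'. if k = l then scale (single 0 c) g else 0)"
        unfolding mvD by (rule sum.cong) (auto simp: y_def l fun_eq_iff)
      then show ?thesis using l(1) by (simp only: sum.delta finite_lessThan lessThan_iff if_True)
    qed
    ultimately show ?thesis by (metis im_piece_def imageI)
  qed
  \<comment> \<open>\<open>n\<close> measures how far \<open>d\<close> may lie above
    \<open>L\<close>, so that the induction runs over integers bounded below.\<close>
  have sub: "x \<in> im_piece V r' s' D d" if "x \<in> N d" "d < L + int n" for x d n
    using that
  proof (induction n arbitrary: x d)
    case 0
    have "x = 0"
    proof
      fix l show "x l = 0 l"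
      proof (cases "l < r")
        case True
        have "x l \<in> hom_piece V (d - s l)" using 0 NF True by (auto simp: free_piece_def)
        then show ?thesis using L[OF True] 0 hom_piece_neg[of "d - s l" "x l" V] by auto
      next
        case False
        then show ?thesis using 0 NF[of d] by (auto simp: free_piece_def)
      qed
    qed
    then show ?case using graded_mod_zero[OF gI] by metis
  next
    case (Suc n)
    consider "d < L" | "L \<le> d" "d \<le> U" | "U < d" by linarith
    then show ?case
    proof cases
      case 1
      then show ?thesis using Suc by (intro Suc.IH) auto
    next
      case 2
      obtain c where c: "x = (\<Sum>b\<in>Bs d. scale (single 0 (c b)) b)" using Bs(3)[OF Suc.prems(1)] by blast
      show ?thesis unfolding c by (rule graded_mod_sum[OF gI gen]) (use 2 in auto)
    next
      case 3
      have xF: "x \<in> free_piece V r s d" using Suc.prems(1) NF by blast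
      \<comment> \<open>A nonzero constant in coordinate \<open>l\<close> would force
        \<open>d = s l\<close>, but \<open>d\<close> exceeds every shift.\<close>
      have "cvec x l = 0" for l
        using cvec_const_piece[OF xF] U[of l] 3 by (fastforce simp: const_piece_def)
      then have "cvec x = 0" by (simp add: fun_eq_iff)
      then have "x \<in> max_mult V (free_piece V r s) d" by (rule max_mult_free_piece[OF xF])
      moreover have "N d \<inter> max_mult V (free_piece V r s) d \<subseteq> max_mult V N d"
        using hk_zero_1_iff[OF graded_mod_free_piece gN NF hk_zero_free_piece, of d] hk[of d] 3 bU by simp
      ultimately have "x \<in> max_mult V N d" using Suc.prems(1) by blast
      then obtain q where q: "x = (\<Sum>v\<in>V. scale (var v) (q v))" "\<forall>v\<in>V. q v \<in> N (d - 1)"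
        by (auto simp: max_mult_def)
      show ?thesis
        unfolding q(1)
        by (intro graded_mod_sum[OF gI] graded_mod_var[OF gI] Suc.IH) (use q(2) Suc.prems(2) in auto)
    qed
  qed
  have "im_piece V r' s' D d = N d" for d
  proof (intro equalityI subsetI)
    fix x assume "x \<in> im_piece V r' s' D d"
    then obtain y where y: "y \<in> free_piece V r' s' d" "x = mv r' D y" by (auto simp: im_piece_def)
    show "x \<in> N d"
      unfolding y(2) mvD
    proof (rule graded_mod_sum[OF gN])
      fix l assume "l \<in> {..<r'}"
      then have l: "l < r'" by simp
      show "scale (y l) (snd (gs ! l)) \<in> N d"
        by (rule Nscale[OF _ gl[OF l], of _ "d - s' l"]) (use y(1) l in \<open>auto simp: free_piece_def\<close>)
    qed
  next
    fix x assume "x \<in> N d"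
    then show "x \<in> im_piece V r' s' D d" by (rule sub[of _ _ "nat (d - L + 1)"]) auto
  qed
  with D show ?thesis by (intro that[of r' s' D]) (auto simp: D_def)
qed

text \<open>Dependent choice: each step generates the kernel of the previous differential. The
  vanishing bound travels along and reads \<open>j > p + n + i\<close> at step \<open>i\<close>,
  because every syzygy costs one homological degree.\<close>

lemma graded_exact_exists:
  assumes J: "mono_ideal J"
    and hk: "\<And>i j. j > int i + int n \<Longrightarrow>
      hk_zero (free_piece V 1 (\<lambda>_. 0) :: ('a, 'k::field) pieces) (mono_piece V 1 (\<lambda>_. 0) J) i j"
  obtains r s and D :: "nat \<Rightarrow> nat \<Rightarrow> nat \<Rightarrow> ('a, 'k::field) mpoly" where
    "graded_exact V J r s D (\<lambda>_. 1)" "r 0 = 1" "s 0 = (\<lambda>_. 0)" "\<And>i a l. l \<ge> r (Suc i) \<Longrightarrow> D i a l = 0"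
proof -
  \<comment> \<open>A state holds two consecutive free modules and the map between them. Its
    vanishing columns let the map be recovered from a finite matrix; the last clause anchors the
    start at the rank one module modulo \<open>J\<close>.\<close>
  define P :: "nat \<Rightarrow> (nat \<times> (nat \<Rightarrow> int)) \<times> (nat \<times> (nat \<Rightarrow> int)) \<times> (nat \<Rightarrow> nat \<Rightarrow> ('a, 'k) mpoly) \<Rightarrow> bool" where
    "P i = (\<lambda>((r, s), (r', s'), D). hom_matrix V r s r' s' D \<and> (\<forall>a. \<forall>l\<ge>r'. D a l = 0) \<and>
      (\<forall>p\<ge>1. \<forall>j>int p + int n + int i. hk_zero (free_piece V r s) (im_piece V r' s' D) p j) \<and>
      (i = 0 \<longrightarrow> r = 1 \<and> s = (\<lambda>_. 0) \<and> im_piece V r' s' D = mono_piece V 1 (\<lambda>_. 0) J))" for i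
  define Q :: "nat \<Rightarrow> (nat \<times> (nat \<Rightarrow> int)) \<times> (nat \<times> (nat \<Rightarrow> int)) \<times> (nat \<Rightarrow> nat \<Rightarrow> ('a, 'k) mpoly) \<Rightarrow>
      (nat \<times> (nat \<Rightarrow> int)) \<times> (nat \<times> (nat \<Rightarrow> int)) \<times> (nat \<Rightarrow> nat \<Rightarrow> ('a, 'k) mpoly) \<Rightarrow> bool" where
    "Q i = (\<lambda>(R, (r, s), D) ((r1, s1), (r', s'), D'). r1 = r \<and> s1 = s \<and>
      (\<forall>d. im_piece V r' s' D' d = {x \<in> free_piece V r s d. mv r D x = 0}))" for i
  have "\<exists>f. \<forall>i. P i (f i) \<and> Q i (f i) (f (Suc i))"
  proof (rule dependent_nat_choice)
    obtain r' s' and D :: "nat \<Rightarrow> nat \<Rightarrow> ('a, 'k) mpoly" where "hom_matrix V 1 (\<lambda>_. 0) r' s' D"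
      "\<And>d. im_piece V r' s' D d = mono_piece V 1 (\<lambda>_. 0) J d" "\<And>i l. l \<ge> r' \<Longrightarrow> D i l = 0"
    proof (rule finite_generation[OF poly_closed_mono_piece[OF J]])
      show "hk_zero (free_piece V 1 (\<lambda>_. 0) :: ('a, 'k) pieces) (mono_piece V 1 (\<lambda>_. 0) J) (Suc 0) j"
        if "j > 1 + int n" for j using that by (intro hk) simp
    qed (auto simp: mono_piece_def)
    moreover from this have "im_piece V r' s' D = mono_piece V 1 (\<lambda>_. 0) J" by blast
    ultimately have "P 0 ((1, \<lambda>_. 0), (r', s'), D)" using hk by (simp add: P_def)
    then show "\<exists>x. P 0 x" by blast
  next
    fix x i assume "P i x"
    moreover obtain r s r' s' D where x: "x = ((r, s), (r', s'), D)" by (metis prod.collapse)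
    ultimately have D: "hom_matrix V r s r' s' D"
      and hkD: "\<And>p j. p \<ge> 1 \<Longrightarrow> j > int p + int n + int i \<Longrightarrow> hk_zero (free_piece V r s) (im_piece V r' s' D) p j"
      by (auto simp: P_def)
    let ?K = "\<lambda>d. {x \<in> free_piece V r' s' d. mv r' D x = 0}"
    have hkK: "hk_zero (free_piece V r' s') ?K p j" if "p \<ge> 1" "j > int p + int n + int (Suc i)" for p j
      using hk_zero_kernel[OF that(1) D, of j] hkD[of "Suc p" j] that by simp
    obtain r2 s2 D2 where D2: "hom_matrix V r' s' r2 s2 D2" "\<And>d. im_piece V r2 s2 D2 d = ?K d" "\<And>a l. l \<ge> r2 \<Longrightarrow> D2 a l = 0"
    proof (rule finite_generation[OF poly_closed_kernel[of V r' s' D]])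
      show "hk_zero (free_piece V r' s') ?K (Suc 0) j" if "j > 1 + int n + int (Suc i)" for j
        using that by (intro hkK) auto
    qed auto
    then have "im_piece V r2 s2 D2 = ?K" by blast
    then have "P (Suc i) ((r', s'), (r2, s2), D2)" using D2 hkK by (simp add: P_def)
    moreover have "Q i x ((r', s'), (r2, s2), D2)" using D2 by (simp add: Q_def x)
    ultimately show "\<exists>y. P (Suc i) y \<and> Q i x y" by blast
  qed
  then obtain f where f: "\<And>i. P i (f i)" "\<And>i. Q i (f i) (f (Suc i))" by blast
  define r where "r i = fst (fst (f i))" for i
  define s where "s i = snd (fst (f i))" for i
  define D where "D i = snd (snd (f i))" for i
  have fi: "f i = ((r i, s i), (r (Suc i), s (Suc i)), D i)" for i
    using f(2)[of i] by (auto simp: Q_def r_def s_def D_def split: prod.splits)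
  have P: "hom_matrix V (r i) (s i) (r (Suc i)) (s (Suc i)) (D i)" "\<And>a l. l \<ge> r (Suc i) \<Longrightarrow> D i a l = 0"
    "i = 0 \<Longrightarrow> r 0 = 1 \<and> s 0 = (\<lambda>_. 0) \<and> im_piece V (r 1) (s 1) (D 0) = mono_piece V 1 (\<lambda>_. 0) J" for i
    using f(1)[of i] unfolding fi P_def by auto
  have Q: "im_piece V (r (Suc (Suc i))) (s (Suc (Suc i))) (D (Suc i)) d =
      {x \<in> free_piece V (r (Suc i)) (s (Suc i)) d. mv (r (Suc i)) (D i) x = 0}" for i d
    using f(2)[of i] unfolding fi Q_def by auto
  have r0: "r 0 = 1" "s 0 = (\<lambda>_. 0)" "im_piece V (r 1) (s 1) (D 0) = mono_piece V 1 (\<lambda>_. 0) J" using P(3)[of 0] by auto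
  have id: "mv 1 (row_mat (\<lambda>_. 1)) x = x" if "x \<in> free_piece V 1 (\<lambda>_. 0) d" for x :: "nat \<Rightarrow> ('a, 'k) mpoly" and d
    using that by (auto simp: mv_row_mat free_piece_def fun_eq_iff)
  have "graded_exact V J r s D (\<lambda>_. 1)"
    unfolding graded_exact_def
  proof (intro conjI allI impI ballI)
    show "1 \<in> hom_piece V (s 0 l)" for l using hom_piece_const[of 1 V] by (simp add: r0)
    show "\<exists>x\<in>free_piece V (r 0) (s 0) d. a - mv (r 0) (row_mat (\<lambda>_. 1)) x \<in> mono_piece V 1 (\<lambda>_. 0) J d"
      if "a \<in> free_piece V 1 (\<lambda>_. 0) d" for a :: "nat \<Rightarrow> ('a, 'k) mpoly" and d
      using that id[OF that] graded_mod_zero[OF graded_mod_mono_piece[OF J]] unfolding r0 by (intro bexI[of _ a]) auto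
    show "im_piece V (r 1) (s 1) (D 0) d =
        {x \<in> free_piece V (r 0) (s 0) d. mv (r 0) (row_mat (\<lambda>_. 1)) x \<in> mono_piece V 1 (\<lambda>_. 0) J d}" for d
    proof -
      have "mono_piece V 1 (\<lambda>_. 0) J d \<subseteq> free_piece V 1 (\<lambda>_. 0) d" by (auto simp: mono_piece_def)
      then show ?thesis unfolding r0 using id[of _ d] by auto
    qed
  qed (use P(1) Q in auto)
  then show ?thesis using r0 P(2) by (intro that[of r s D]) auto
qed

text \<open>For a given resolution, representatives of its generators are chosen and
  \<open>tor_vanish_iff\<close> applies. The bound \<open>hk\<close> enters in the other direction,
  where a resolution must be produced.\<close>

lemma tor_nonzero_iff:
  fixes I :: "('a, 'k::field) mpoly set"
  assumes J: "mono_ideal J" and I: "I = mono_span V J"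
    and hk: "\<And>i j. j > int i + int n \<Longrightarrow>
      hk_zero (free_piece V 1 (\<lambda>_. 0) :: ('a, 'k) pieces) (mono_piece V 1 (\<lambda>_. 0) J) i j"
  shows "tor_nonzero V (quot_module (poly_ring V) I) (quot_piece V I) i j \<longleftrightarrow>
    \<not> hk_zero (free_piece V 1 (\<lambda>_. 0) :: ('a, 'k) pieces) (mono_piece V 1 (\<lambda>_. 0) J) i j"
    (is "?tor \<longleftrightarrow> \<not> ?hk")
proof
  assume ?tor
  then obtain F where F: "graded_free_resolution V (quot_module (poly_ring V) I) (quot_piece V I) F"
    and nz: "\<not> tor_cycles F i j \<subseteq> tor_boundaries F i j" unfolding tor_nonzero_def by blast
  have d: "dmat F i \<in> carrier_mat (frank F i) (frank F (Suc i))" for i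
    using F by (simp add: graded_free_resolution_def)
  have "\<forall>l. \<exists>p. l < frank F 0 \<longrightarrow> p \<in> hom_piece V (shift F 0 l) \<and> gen F l = I +>\<^bsub>poly_ring V\<^esub> p"
    using F by (auto simp: graded_free_resolution_def quot_piece_def)
  then obtain g where g: "\<And>l. l < frank F 0 \<Longrightarrow> g l \<in> hom_piece V (shift F 0 l)"
    "\<And>l. l < frank F 0 \<Longrightarrow> gen F l = I +>\<^bsub>poly_ring V\<^esub> g l" by metis
  have "graded_exact V J (frank F) (shift F) (\<lambda>i. mat_fun (dmat F i)) g"
    using graded_free_resolution_iff[OF J I g d] F ungraded_exact_iff[OF J] by blast
  then show "\<not> ?hk" using tor_vanish_iff[OF J] tor_vanish_mat_fun[of F, OF d] nz by blast
next
  assume nhk: "\<not> ?hk"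
  obtain r s and D :: "nat \<Rightarrow> nat \<Rightarrow> nat \<Rightarrow> ('a, 'k) mpoly" where
    ex: "graded_exact V J r s D (\<lambda>_. 1)" and r0: "r 0 = 1" "s 0 = (\<lambda>_. 0)" and D0: "\<And>i a l. l \<ge> r (Suc i) \<Longrightarrow> D i a l = 0"
    using graded_exact_exists[OF J hk] by blast
  define F where "F = \<lparr>frank = r, shift = s, dmat = \<lambda>i. mat (r i) (r (Suc i)) (\<lambda>(a, b). D i a b),
    gen = \<lambda>_. I +>\<^bsub>poly_ring V\<^esub> 1\<rparr>"
  have Fs: "frank F = r" "shift F = s" "gen F = (\<lambda>_. I +>\<^bsub>poly_ring V\<^esub> 1)" by (simp_all add: F_def)
  have d: "dmat F i \<in> carrier_mat (frank F i) (frank F (Suc i))" for i by (simp add: F_def)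
  have mat_fun_D: "mat_fun (dmat F i) = D i" for i
  proof (intro ext)
    fix a b
    have "hom_matrix V (r i) (s i) (r (Suc i)) (s (Suc i)) (D i)" using ex by (simp add: graded_exact_def)
    then show "mat_fun (dmat F i) a b = D i a b"
      using D0[of i b a] by (auto simp: mat_fun_def F_def hom_matrix_def)
  qed
  have "graded_free_resolution V (quot_module (poly_ring V) I) (quot_piece V I) F"
  proof (subst graded_free_resolution_iff[OF J I _ _ d, where g = "\<lambda>_. 1"])
    show "1 \<in> hom_piece V (shift F 0 l)" for l using hom_piece_const[of 1 V] by (simp add: Fs r0)
    show "ungraded_exact V J (frank F) (shift F) (\<lambda>i. mat_fun (dmat F i)) (\<lambda>_. 1)"
      unfolding ungraded_exact_iff[OF J] mat_fun_D Fs by (rule ex)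
  qed (simp add: Fs)
  moreover have "\<not> tor_cycles F i j \<subseteq> tor_boundaries F i j"
    using tor_vanish_mat_fun[of F, OF d] tor_vanish_iff[OF J ex] nhk by (simp add: mat_fun_D Fs)
  ultimately show ?tor unfolding tor_nonzero_def by blast
qed

end

section \<open>Regularity and induced matchings\<close>

lemma edge_ideal_eq_mono_span:
  assumes E: "\<And>e. e \<in> edges G \<Longrightarrow> card e = 2 \<and> e \<subseteq> verts G"
  shows "(edge_ideal G :: ('a, 'k::field) mpoly set) = mono_span (verts G) (edge_monomials (edges G))"
proof
  let ?V = "verts G" and ?J = "edge_monomials (edges G)"
  let ?R = "poly_ring ?V :: ('a, 'k) mpoly ring"
  let ?S = "{var u * var w |u w. {u, w} \<in> edges G} :: ('a, 'k) mpoly set"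
  interpret R: cring ?R by (rule cring_poly_ring)
  have var2: "var u * var w = (single (single u 1 + single w 1) 1 :: ('a, 'k) mpoly)" for u w
    by (simp add: var_def mult_single)
  have S: "?S \<subseteq> mono_span ?V ?J"
  proof
    fix p assume "p \<in> ?S"
    then obtain u w where p: "p = var u * var w" "{u, w} \<in> edges G" by auto
    have "{u, w} \<subseteq> ?V" using E[OF p(2)] by auto
    then show "p \<in> mono_span ?V ?J"
      using p(2) by (auto simp: p(1) var2 mono_span_def poly_ring_carrier_iff edge_monomials_def keys_add_nat
        intro!: bexI[of _ "{u, w}"])
  qed
  show "(edge_ideal G :: ('a, 'k) mpoly set) \<subseteq> mono_span ?V ?J"
    unfolding edge_ideal_def by (rule R.genideal_minimal[OF ideal_mono_span[OF mono_ideal_edge_monomials] S])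
  show "mono_span ?V ?J \<subseteq> (edge_ideal G :: ('a, 'k) mpoly set)"
  proof
    fix p :: "('a, 'k) mpoly" assume p: "p \<in> mono_span ?V ?J"
    have Sc: "?S \<subseteq> carrier ?R" using S by (auto simp: mono_span_def)
    interpret I: ideal "edge_ideal G" ?R unfolding edge_ideal_def by (rule R.genideal_ideal[OF Sc])
    have mono: "single m c \<in> edge_ideal G" if m: "m \<in> ?J" "keys m \<subseteq> ?V" for m and c :: 'k
    proof -
      obtain e where e: "e \<in> edges G" "e \<subseteq> keys m" using m by (auto simp: edge_monomials_def)
      then obtain u w where uw: "e = {u, w}" "u \<noteq> w" using E[OF e(1)] by (auto simp: card_2_iff)
      \<comment> \<open>The cofactor of the two variables of an edge, which exhibits the monomial as
        a multiple of a generator.\<close>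
      let ?m = "m - (single u 1 + single w 1)"
      have "?m + (single u 1 + single w 1) = m"
        by (rule poly_mapping_eqI)
          (use e uw in \<open>auto simp: lookup_add lookup_minus lookup_single when_def in_keys_iff\<close>)
      then have "single m c = single ?m c * (var u * var w)"
        by (simp only: var2 mult_single mult_1_right)
      moreover have "var u * var w \<in> (edge_ideal G :: ('a, 'k) mpoly set)"
        unfolding edge_ideal_def using e(1) uw by (intro subsetD[OF R.genideal_self[OF Sc]]) auto
      moreover have "single ?m c \<in> carrier ?R"
        using m(2) keys_minus_nat by (fastforce simp: poly_ring_carrier_iff)
      ultimately show ?thesis using I.I_l_closed by (simp add: poly_ring_def)
    qed
    have sum_mem: "sum f A \<in> edge_ideal G" if "\<And>a. a \<in> A \<Longrightarrow> f a \<in> edge_ideal G" for f :: "('a \<Rightarrow>\<^sub>0 nat) \<Rightarrow> ('a, 'k) mpoly" and A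
      using that
    proof (induction A rule: infinite_finite_induct)
      case (insert a A)
      then have "f a \<oplus>\<^bsub>?R\<^esub> sum f A \<in> edge_ideal G" by (intro I.a_closed) auto
      with insert show ?case by (simp add: poly_ring_def)
    qed (use I.zero_closed in \<open>auto simp: poly_ring_def\<close>)
    have "(\<Sum>m\<in>keys p. single m (lookup p m)) \<in> edge_ideal G"
      by (rule sum_mem, rule mono) (use p in \<open>auto simp: mono_span_def poly_ring_carrier_iff\<close>)
    then show "p \<in> edge_ideal G" by (simp only: poly_mapping_sum_single)
  qed
qed

text \<open>Chordality through simplicial vertices in all induced subgraphs, equivalent by Dirac's
  theorem to the absence of long induced cycles; this is the form that the induction in
  \<open>acyclic_fam\<close> consumes.\<close>

definition chordal_graph :: "'a set \<Rightarrow> 'a set set \<Rightarrow> bool" where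
  "chordal_graph V E \<longleftrightarrow> finite V \<and> (\<forall>e\<in>E. card e = 2 \<and> e \<subseteq> V) \<and>
     (\<forall>B. B \<subseteq> V \<longrightarrow> B \<noteq> {} \<longrightarrow> (\<exists>w\<in>B. simplicial E B w))"

definition nu :: "'a set set \<Rightarrow> nat" where
  "nu E = Max (card ` {M. induced_matching E M})"

definition del_edges :: "'a set set \<Rightarrow> 'a \<Rightarrow> 'a set set" where
  "del_edges E v = {e \<in> E. v \<notin> e}"

lemma chordal_graphD:
  assumes "chordal_graph V E"
  shows "finite V" "e \<in> E \<Longrightarrow> card e = 2" "e \<in> E \<Longrightarrow> e \<subseteq> V" "finite E"
    "B \<subseteq> V \<Longrightarrow> B \<noteq> {} \<Longrightarrow> \<exists>w\<in>B. simplicial E B w"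
proof -
  show "finite V" "e \<in> E \<Longrightarrow> card e = 2" "e \<in> E \<Longrightarrow> e \<subseteq> V"
    "B \<subseteq> V \<Longrightarrow> B \<noteq> {} \<Longrightarrow> \<exists>w\<in>B. simplicial E B w"
    using assms by (simp_all add: chordal_graph_def)
  have "E \<subseteq> Pow V" "finite (Pow V)" using assms by (auto simp: chordal_graph_def)
  then show "finite E" by (rule finite_subset)
qed

lemma induced_matchingD:
  "induced_matching E M \<Longrightarrow> d \<in> E \<Longrightarrow> e \<in> M \<Longrightarrow> e' \<in> M \<Longrightarrow> x \<in> d \<Longrightarrow> x \<in> e \<Longrightarrow> y \<in> d \<Longrightarrow> y \<in> e' \<Longrightarrow> e = e'"
  "induced_matching E M \<Longrightarrow> e \<in> M \<Longrightarrow> e \<in> E"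
  unfolding induced_matching_def by (metis IntI empty_iff, blast)

lemma induced_matching_sub: "induced_matching E M \<Longrightarrow> M \<subseteq> E"
  by (simp add: induced_matching_def)

lemma induced_matching_finite: "finite E \<Longrightarrow> induced_matching E M \<Longrightarrow> finite M"
  by (auto simp: induced_matching_def intro: finite_subset)

lemma nu_set: "finite E \<Longrightarrow> finite (card ` {M. induced_matching E M}) \<and> card ` {M. induced_matching E M} \<noteq> {}"
proof -
  assume "finite E"
  then have "finite (Pow E)" by simp
  then have "finite {M. induced_matching E M}"
    by (rule rev_finite_subset) (auto dest: induced_matching_sub)
  moreover have "induced_matching E {}" by (simp add: induced_matching_def)
  ultimately show ?thesis by blast
qed

lemma nu_ge: "finite E \<Longrightarrow> induced_matching E M \<Longrightarrow> card M \<le> nu E"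
  unfolding nu_def by (rule Max_ge) (use nu_set in auto)

lemma nu_ex: "finite E \<Longrightarrow> \<exists>M. induced_matching E M \<and> card M = nu E"
proof -
  assume "finite E"
  then have "nu E \<in> card ` {M. induced_matching E M}"
    unfolding nu_def by (intro Max_in) (simp_all only: nu_set not_False_eq_True)
  then show ?thesis by (metis (mono_tags) imageE mem_Collect_eq)
qed

lemma nu_leI: "finite E \<Longrightarrow> (\<And>M. induced_matching E M \<Longrightarrow> card M \<le> n) \<Longrightarrow> nu E \<le> n"
  using nu_ex by metis

text \<open>Koszul homology can be nonzero only for \<open>j - i\<close> between 0 and
  \<open>nu\<close>, and a maximum matching gives the value \<open>nu\<close>. The lower bound makes
  the set under \<open>Max\<close> finite.\<close>

lemma edge_reg_eq_nu:
  assumes G: "chordal_graph (verts G) (edges G)"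
  shows "edge_reg TYPE('k::field) G = int (nu (edges G))"
proof -
  let ?V = "verts G" and ?E = "edges G"
  let ?J = "edge_monomials ?E" and ?n = "nu ?E"
  note Gd = chordal_graphD[OF G]
  obtain idx :: "'a \<Rightarrow> nat" where "inj_on idx ?V" using finite_imp_inj_to_nat_seg[OF Gd(1)] by blast
  then interpret ordered_vars ?V idx by (unfold_locales) (rule Gd(1))
  let ?hk = "hk_zero (free_piece ?V 1 (\<lambda>_. 0) :: ('a, 'k) pieces) (mono_piece ?V 1 (\<lambda>_. 0) ?J)"
  have hk0: "?hk i j" if "j > int i + int ?n" for i j
    by (rule hk_zero_edge_ideal[OF Gd(2) Gd(5) nu_ge[OF Gd(4)] that])
  let ?I = "edge_ideal G :: ('a, 'k) mpoly set"
  have tor: "tor_nonzero ?V (quot_module (poly_ring ?V) ?I) (quot_piece ?V ?I) i j \<longleftrightarrow> \<not> ?hk i j" for i j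
    by (rule tor_nonzero_iff[OF mono_ideal_edge_monomials _ hk0])
      (rule edge_ideal_eq_mono_span, use Gd in auto)
  have neg: "(free_piece ?V 1 (\<lambda>_. 0) d :: (nat \<Rightarrow> ('a, 'k) mpoly) set) = {0}" if d: "d < 0" for d
  proof -
    have "x l = 0" if "x \<in> free_piece ?V 1 (\<lambda>_. 0) d" for x :: "nat \<Rightarrow> ('a, 'k) mpoly" and l
      using that hom_piece_neg[OF d, of "x 0" ?V] by (cases "l = 0") (auto simp: free_piece_def)
    then have "x = 0" if "x \<in> free_piece ?V 1 (\<lambda>_. 0) d" for x :: "nat \<Rightarrow> ('a, 'k) mpoly"
      using that by (simp add: fun_eq_iff)
    then show ?thesis using graded_mod_zero[OF graded_mod_free_piece] by blast
  qed
  have low: "?hk i j" if "j < int i" for i j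
    by (rule hk_zero_below[OF neg graded_mod_free_piece graded_mod_mono_piece[OF mono_ideal_edge_monomials] that])
  obtain M where M: "induced_matching ?E M" "card M = ?n" using nu_ex[OF Gd(4)] by blast
  have "\<not> ?hk ?n (2 * int ?n)"
    using hk_nonzero_edge_ideal[OF Gd(2) M(1)] M Gd(3) unfolding induced_matching_def by (metis Union_least subsetD)
  then have mem: "int ?n \<in> {j - int i |i j. \<not> ?hk i j}"
    by (intro CollectI exI[of _ ?n] exI[of _ "2 * int ?n"]) simp
  have bounds: "x \<in> {0..int ?n}" if x: "x \<in> {j - int i |i j. \<not> ?hk i j}" for x
  proof -
    obtain i j where ij: "x = j - int i" "\<not> ?hk i j" using x by blast
    have "j \<le> int i + int ?n" using hk0[of i j] ij(2) by (metis not_le)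
    moreover have "int i \<le> j" using low[of j i] ij(2) by (metis not_le)
    ultimately show ?thesis using ij(1) by simp
  qed
  have "Max {j - int i |i j. \<not> ?hk i j} = int ?n"
  proof (rule Max_eqI)
    show "finite {j - int i |i j. \<not> ?hk i j}"
      by (rule finite_subset[of _ "{0..int ?n}"]) (use bounds in blast, simp)
    show "y \<le> int ?n" if "y \<in> {j - int i |i j. \<not> ?hk i j}" for y using bounds[OF that] by simp
  qed (rule mem)
  then show ?thesis unfolding edge_reg_def Let_def reg_def tor .
qed

section \<open>Induced matchings\<close>

lemma edge_eqI: "card e = 2 \<Longrightarrow> x \<in> e \<Longrightarrow> y \<in> e \<Longrightarrow> x \<noteq> y \<Longrightarrow> e = {x, y}"
  by (auto simp: card_2_iff)

lemma induced_matchingI: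
  assumes "M \<subseteq> E" "\<And>d e e' x y. d \<in> E \<Longrightarrow> e \<in> M \<Longrightarrow> e' \<in> M \<Longrightarrow> x \<in> d \<Longrightarrow> x \<in> e \<Longrightarrow> y \<in> d \<Longrightarrow> y \<in> e' \<Longrightarrow> e = e'"
  shows "induced_matching E M"
  unfolding induced_matching_def
proof (intro conjI ballI impI)
  fix d e e' assume "d \<in> E" "e \<in> M" "e' \<in> M" "d \<inter> e \<noteq> {}" "d \<inter> e' \<noteq> {}"
  then show "e = e'" using assms(2)[of d e e'] by blast
qed (rule assms(1))

lemma induced_matching_subset: "induced_matching E M \<Longrightarrow> M' \<subseteq> M \<Longrightarrow> induced_matching E M'"
  unfolding induced_matching_def by (meson subset_iff)

lemma induced_matching_restrict:
  assumes M: "induced_matching E M" and sub: "E' \<subseteq> E"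
  shows "induced_matching E' (M \<inter> E')"
proof (rule induced_matchingI)
  fix d e e' x y assume "d \<in> E'" "e \<in> M \<inter> E'" "e' \<in> M \<inter> E'" "x \<in> d" "x \<in> e" "y \<in> d" "y \<in> e'"
  then show "e = e'" using sub by (intro induced_matchingD(1)[OF M, of d e e' x y]) auto
qed simp

text \<open>An edge meeting two different members of \<open>M\<close> has both ends covered by
  \<open>M\<close>; if \<open>v\<close> is uncovered, that edge survives the deletion of
  \<open>v\<close>.\<close>

lemma induced_matching_del_edges:
  assumes "\<And>e. e \<in> E \<Longrightarrow> card e = 2"
  shows "induced_matching (del_edges E v) M \<longleftrightarrow> induced_matching E M \<and> v \<notin> \<Union> M"
proof
  assume M: "induced_matching (del_edges E v) M"
  have nv: "v \<notin> \<Union> M" using M by (auto simp: induced_matching_def del_edges_def)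
  have "induced_matching E M"
  proof (rule induced_matchingI)
    show "M \<subseteq> E" using M by (auto simp: induced_matching_def del_edges_def)
    fix d e e' x y assume *: "d \<in> E" "e \<in> M" "e' \<in> M" "x \<in> d" "x \<in> e" "y \<in> d" "y \<in> e'"
    show "e = e'"
    proof (cases "x = y")
      case True
      have "e \<in> del_edges E v" using M * induced_matchingD(2) by metis
      from induced_matchingD(1)[OF M this *(2,3)] show ?thesis using * True by blast
    next
      case False
      then have "d = {x, y}" using edge_eqI assms * by metis
      then have "d \<in> del_edges E v" using * nv by (auto simp: del_edges_def)
      then show ?thesis using induced_matchingD(1)[OF M _ *(2,3)] * by blast
    qed
  qed
  then show "induced_matching E M \<and> v \<notin> \<Union> M" using nv by (rule conjI)
next
  assume M: "induced_matching E M \<and> v \<notin> \<Union> M"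
  then have sub: "M \<subseteq> del_edges E v" using induced_matching_sub[of E M] by (auto simp: del_edges_def)
  then have "M \<inter> del_edges E v = M" by blast
  then show "induced_matching (del_edges E v) M"
    using induced_matching_restrict[OF conjunct1[OF M], of "del_edges E v"] by (auto simp: del_edges_def)
qed

lemma nu_del_edges_le:
  assumes "finite E" "\<And>e. e \<in> E \<Longrightarrow> card e = 2"
  shows "nu (del_edges E v) \<le> nu E"
proof (rule nu_leI)
  show "finite (del_edges E v)" using assms by (simp add: del_edges_def)
  show "card M \<le> nu E" if "induced_matching (del_edges E v) M" for M
    using that assms by (intro nu_ge) (auto simp: induced_matching_del_edges)
qed

text \<open>At most one member of a matching contains \<open>v\<close>, and dropping it leaves a
  matching of the smaller graph.\<close>

lemma nu_del_edges_ge: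
  assumes "finite E" "\<And>e. e \<in> E \<Longrightarrow> card e = 2"
  shows "nu E \<le> Suc (nu (del_edges E v))"
proof -
  obtain M where M: "induced_matching E M" "card M = nu E" using nu_ex[OF assms(1)] by blast
  have finM: "finite M" by (rule induced_matching_finite[OF assms(1) M(1)])
  have fin: "finite (del_edges E v)" using assms by (simp add: del_edges_def)
  show ?thesis
  proof (cases "\<exists>e\<in>M. v \<in> e")
    case True
    then obtain e where e: "e \<in> M" "v \<in> e" by auto
    have "v \<notin> \<Union> (M - {e})"
    proof
      assume "v \<in> \<Union> (M - {e})"
      then obtain e' where "e' \<in> M" "e' \<noteq> e" "v \<in> e'" by auto
      then show False using induced_matchingD(1)[OF M(1) induced_matchingD(2)[OF M(1) e(1)] e(1)] e by blast
    qed
    then have "induced_matching (del_edges E v) (M - {e})"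
      using assms induced_matching_subset[OF M(1)] by (simp add: induced_matching_del_edges)
    then have "card (M - {e}) \<le> nu (del_edges E v)" by (rule nu_ge[OF fin])
    then show ?thesis using M(2) e finM by simp
  next
    case False
    then have "induced_matching (del_edges E v) M" using M assms by (simp add: induced_matching_del_edges)
    then show ?thesis using nu_ge[OF fin] M(2) by fastforce
  qed
qed

definition closed_nbhd :: "'a set set \<Rightarrow> 'a set \<Rightarrow> 'a set" where
  "closed_nbhd E e = e \<union> {y. \<exists>p\<in>e. {p, y} \<in> E}"

text \<open>No edge connects the new member with an old one, because everything within reach of
  \<open>e1\<close> was already within reach of \<open>e0\<close>.\<close>

lemma induced_matching_exchange:
  assumes E: "finite E" "\<And>e. e \<in> E \<Longrightarrow> card e = 2" and M: "induced_matching E M" and e0: "e0 \<in> M" and e1: "e1 \<in> E"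
    and sub: "closed_nbhd E e1 \<subseteq> closed_nbhd E e0"
  shows "induced_matching E (insert e1 (M - {e0}))" "card (insert e1 (M - {e0})) = card M"
proof -
  have far: "y \<notin> closed_nbhd E e1" if e: "e \<in> M" "e \<noteq> e0" "y \<in> e" for e y
  proof
    assume "y \<in> closed_nbhd E e1"
    then have "y \<in> closed_nbhd E e0" using sub by blast
    then consider "y \<in> e0" | p where "p \<in> e0" "{p, y} \<in> E" by (auto simp: closed_nbhd_def)
    then show False
    proof cases
      case 1
      then show False using induced_matchingD(1)[OF M induced_matchingD(2)[OF M e0] e0 e(1)] e by blast
    next
      case 2
      then show False using induced_matchingD(1)[OF M 2(2) e0 e(1)] e by blast
    qed
  qed
  have far': "y \<notin> e" if "d \<in> E" "x \<in> d" "x \<in> e1" "y \<in> d" "e \<in> M" "e \<noteq> e0" for d x y e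
  proof
    assume "y \<in> e"
    have "y \<in> closed_nbhd E e1"
    proof (cases "x = y")
      case True
      then show ?thesis using that by (simp add: closed_nbhd_def)
    next
      case False
      then have "d = {x, y}" using edge_eqI E(2) that by metis
      then show ?thesis using that by (auto simp: closed_nbhd_def)
    qed
    with far \<open>y \<in> e\<close> that show False by blast
  qed
  show "induced_matching E (insert e1 (M - {e0}))"
  proof (rule induced_matchingI)
    show "insert e1 (M - {e0}) \<subseteq> E" using M e1 by (auto simp: induced_matching_def)
    fix d e e' x y assume *: "d \<in> E" "e \<in> insert e1 (M - {e0})" "e' \<in> insert e1 (M - {e0})"
      "x \<in> d" "x \<in> e" "y \<in> d" "y \<in> e'"
    show "e = e'"
    proof (cases "e = e1 \<or> e' = e1")
      case True
      then show ?thesis using * far' by blast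
    next
      case False
      then show ?thesis using induced_matchingD(1)[OF M *(1)] * by blast
    qed
  qed
  have "e1 \<notin> M - {e0}"
  proof
    assume "e1 \<in> M - {e0}"
    moreover obtain y where "y \<in> e1" using E(2)[OF e1] by fastforce
    ultimately show False using far[of e1 y] by (auto simp: closed_nbhd_def)
  qed
  then show "card (insert e1 (M - {e0})) = card M"
    using induced_matching_finite[OF E(1) M] e0 by (simp add: card_Suc_Diff1 del: card_Diff_insert)
qed

section \<open>Gluing along a common leaf\<close>

context
  fixes V1 V2 :: "'a set" and E1 E2 :: "'a set set" and f v1 v2 :: 'a
  assumes G1: "chordal_graph V1 E1" and G2: "chordal_graph V2 E2" and V12: "V1 \<inter> V2 = {f}"
    and leaf1: "{e \<in> E1. f \<in> e} = {{f, v1}}" and leaf2: "{e \<in> E2. f \<in> e} = {{f, v2}}"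
    and s1: "\<And>B. B \<subseteq> V1 \<Longrightarrow> B - {f} \<noteq> {} \<Longrightarrow> \<exists>w\<in>B - {f}. simplicial E1 B w"
    and s2: "\<And>B. B \<subseteq> V2 \<Longrightarrow> B - {f} \<noteq> {} \<Longrightarrow> \<exists>w\<in>B - {f}. simplicial E2 B w"
begin

lemmas G1d = chordal_graphD[OF G1] and G2d = chordal_graphD[OF G2]

lemma glue_card2: "e \<in> E1 \<union> E2 \<Longrightarrow> card e = 2"
  using G1d(2) G2d(2) by blast

text \<open>A vertex other than \<open>f\<close> has all its neighbours on its own side, so its
  simpliciality carries over to the union. Hence the context supplies simplicial vertices different
  from \<open>f\<close>, which is adjacent to both sides.\<close>

lemma chordal_glue: "chordal_graph (V1 \<union> V2) (E1 \<union> E2)"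
  unfolding chordal_graph_def
proof (intro conjI allI impI ballI)
  show "finite (V1 \<union> V2)" using G1d(1) G2d(1) by simp
  show "card e = 2" if "e \<in> E1 \<union> E2" for e using that by (rule glue_card2)
  show "e \<subseteq> V1 \<union> V2" if "e \<in> E1 \<union> E2" for e using that G1d(3) G2d(3) by blast
  fix B assume B: "B \<subseteq> V1 \<union> V2" "B \<noteq> {}"
  have lift: "simplicial (E1 \<union> E2) B w"
    if a: "chordal_graph Va Ea" "chordal_graph Vb Eb" "Va \<inter> Vb = {f}" "E1 \<union> E2 = Ea \<union> Eb"
      and w: "w \<in> Va" "w \<noteq> f" "simplicial Ea (B \<inter> Va) w"
    for w Va Vb Ea Eb
  proof -
    have "{w, x} \<in> Ea \<and> x \<in> Va" if x: "{w, x} \<in> E1 \<union> E2" for x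
    proof -
      have "{w, x} \<notin> Eb" using chordal_graphD(3)[OF a(2), of "{w, x}"] w a(3) by blast
      then have "{w, x} \<in> Ea" using x a(4) by blast
      then show ?thesis using chordal_graphD(3)[OF a(1), of "{w, x}"] by blast
    qed
    then show ?thesis using w(3) a(4) unfolding simplicial_def by (metis IntI UnI1)
  qed
  show "\<exists>w\<in>B. simplicial (E1 \<union> E2) B w"
  proof (cases "B \<subseteq> {f}")
    case True
    then have "B = {f}" using B(2) by auto
    then show ?thesis by (auto simp: simplicial_def)
  next
    case False
    then consider "B \<inter> V1 - {f} \<noteq> {}" | "B \<inter> V2 - {f} \<noteq> {}" using B(1) by blast
    then show ?thesis
    proof cases
      case 1
      then obtain w where "w \<in> B \<inter> V1 - {f}" "simplicial E1 (B \<inter> V1) w" using s1[of "B \<inter> V1"] by blast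
      then show ?thesis using lift[OF G1 G2 V12 refl, of w] by blast
    next
      case 2
      then obtain w where "w \<in> B \<inter> V2 - {f}" "simplicial E2 (B \<inter> V2) w" using s2[of "B \<inter> V2"] by blast
      moreover have "V2 \<inter> V1 = {f}" using V12 by blast
      ultimately show ?thesis using lift[OF G2 G1 _ Un_commute, of w] by blast
    qed
  qed
qed

lemma leaf_edge1: "e \<in> E1 \<Longrightarrow> f \<in> e \<Longrightarrow> e = {f, v1}" and leaf_edge2: "e \<in> E2 \<Longrightarrow> f \<in> e \<Longrightarrow> e = {f, v2}"
  using leaf1 leaf2 by blast+

lemma glue_E12: "E1 \<inter> E2 = {}"
proof -
  have False if "e \<in> E1" "e \<in> E2" for e
  proof -
    have "e \<subseteq> {f}" using that G1d(3) G2d(3) V12 by blast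
    then have "card e \<le> 1" by (metis card.empty card_insert_le_m1 finite.emptyI card_mono finite_insert is_singletonI is_singleton_altdef)
    then show False using G1d(2)[OF that(1)] by simp
  qed
  then show ?thesis by blast
qed

lemma induced_matching_parts:
  assumes M: "induced_matching (E1 \<union> E2) M"
  shows "induced_matching E1 (M \<inter> E1)" "induced_matching E2 (M \<inter> E2)" "card M = card (M \<inter> E1) + card (M \<inter> E2)"
proof -
  show "induced_matching E1 (M \<inter> E1)" "induced_matching E2 (M \<inter> E2)"
    by (rule induced_matching_restrict[OF M]; blast)+
  have "finite M" by (rule induced_matching_finite[OF _ M]) (simp add: G1d(4) G2d(4))
  moreover have "M = (M \<inter> E1) \<union> (M \<inter> E2)" using induced_matching_sub[OF M] by blast
  moreover have "(M \<inter> E1) \<inter> (M \<inter> E2) = {}" using glue_E12 by blast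
  ultimately show "card M = card (M \<inter> E1) + card (M \<inter> E2)"
    using card_Un_disjoint[of "M \<inter> E1" "M \<inter> E2"] by (metis finite_Int)
qed

lemma nu_glue_le: "nu (E1 \<union> E2) \<le> nu E1 + nu E2"
proof (rule nu_leI)
  fix M assume "induced_matching (E1 \<union> E2) M"
  note p = induced_matching_parts[OF this]
  show "card M \<le> nu E1 + nu E2"
    using nu_ge[OF G1d(4) p(1)] nu_ge[OF G2d(4) p(2)] p(3) by simp
qed (use G1d(4) G2d(4) in simp)

text \<open>An edge touching members from both sides passes through \<open>f\<close>. It is then the
  leaf edge of one side, and the member met on the other side is the other leaf edge or the roles
  are exchanged; a conflict requires \<open>v1\<close>, \<open>v2\<close> and \<open>f\<close> all
  to be covered.\<close>

lemma induced_matching_glue: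
  assumes M1: "induced_matching E1 M1" and M2: "induced_matching E2 M2"
    and sep: "f \<notin> \<Union> M1 \<and> f \<notin> \<Union> M2 \<or> v2 \<notin> \<Union> M2 \<or> v1 \<notin> \<Union> M1"
  shows "card M1 + card M2 \<le> nu (E1 \<union> E2)"
proof -
  have V: "e1 \<subseteq> V1" "e1 \<in> E1" if "e1 \<in> M1" for e1 using that M1 G1d(3) by (auto simp: induced_matching_def)
  have V': "e2 \<subseteq> V2" "e2 \<in> E2" if "e2 \<in> M2" for e2 using that M2 G2d(3) by (auto simp: induced_matching_def)
  have far: False if d: "d \<in> E1 \<union> E2" and e: "e1 \<in> M1" "e2 \<in> M2" and x: "x \<in> d" "x \<in> e1" and y: "y \<in> d" "y \<in> e2" for d e1 e2 x y
  proof (cases "d \<in> E1")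
    case True
    then have "y = f" using G1d(3)[OF True] V'(1)[OF e(2)] y V12 by blast
    then have "d = {f, v1}" "e2 = {f, v2}" using leaf_edge1[OF True] leaf_edge2[OF V'(2)[OF e(2)]] y by auto
    then show False using sep e x y \<open>y = f\<close> leaf_edge1[OF V(2)[OF e(1)]] by auto
  next
    case False
    then have d2: "d \<in> E2" using d by simp
    then have "x = f" using G2d(3)[OF d2] V(1)[OF e(1)] x V12 by blast
    then have "d = {f, v2}" "e1 = {f, v1}" using leaf_edge2[OF d2] leaf_edge1[OF V(2)[OF e(1)]] x by auto
    then show False using sep e x y \<open>x = f\<close> leaf_edge2[OF V'(2)[OF e(2)]] by auto
  qed
  have same1: "e = e'" if "d \<in> E1 \<union> E2" "e \<in> M1" "e' \<in> M1" "x \<in> d" "x \<in> e" "y \<in> d" "y \<in> e'" for d e e' x y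
  proof (cases "d \<in> E1")
    case True
    then show ?thesis using induced_matchingD(1)[OF M1 True] that by blast
  next
    case False
    then have "d \<in> E2" using that by simp
    then have "x = f" "y = f" using G2d(3)[of d] V(1)[of e] V(1)[of e'] that V12 by blast+
    then show ?thesis using leaf_edge1 V(2) that by metis
  qed
  have same2: "e = e'" if "d \<in> E1 \<union> E2" "e \<in> M2" "e' \<in> M2" "x \<in> d" "x \<in> e" "y \<in> d" "y \<in> e'" for d e e' x y
  proof (cases "d \<in> E2")
    case True
    then show ?thesis using induced_matchingD(1)[OF M2 True] that by blast
  next
    case False
    then have "d \<in> E1" using that by simp
    then have "x = f" "y = f" using G1d(3)[of d] V'(1)[of e] V'(1)[of e'] that V12 by blast+
    then show ?thesis using leaf_edge2 V'(2) that by metis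
  qed
  have "induced_matching (E1 \<union> E2) (M1 \<union> M2)"
  proof (rule induced_matchingI)
    show "M1 \<union> M2 \<subseteq> E1 \<union> E2" using V(2) V'(2) by blast
    fix d e e' x y assume "d \<in> E1 \<union> E2" "e \<in> M1 \<union> M2" "e' \<in> M1 \<union> M2" "x \<in> d" "x \<in> e" "y \<in> d" "y \<in> e'"
    then show "e = e'" using same1[of d e e' x y] same2[of d e e' x y] far[of d e e' x y] far[of d e' e y x] by blast
  qed
  moreover have "M1 \<inter> M2 = {}" using V(2) V'(2) glue_E12 by blast
  then have "card (M1 \<union> M2) = card M1 + card M2"
    using induced_matching_finite[OF G1d(4) M1] induced_matching_finite[OF G2d(4) M2] by (intro card_Un_disjoint)
  ultimately show ?thesis using nu_ge[of "E1 \<union> E2" "M1 \<union> M2"] G1d(4) G2d(4) by simp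
qed

lemma nu_glue_ge_v2: "nu E1 + nu (del_edges E2 v2) \<le> nu (E1 \<union> E2)"
  and nu_glue_ge_v1: "nu (del_edges E1 v1) + nu E2 \<le> nu (E1 \<union> E2)"
  and nu_glue_ge_f: "nu (del_edges E1 f) + nu (del_edges E2 f) \<le> nu (E1 \<union> E2)"
proof -
  have ex1: "\<exists>M. induced_matching E1 M \<and> x \<notin> \<Union> M \<and> card M = nu (del_edges E1 x)" for x
    using nu_ex[of "del_edges E1 x"] G1d(4) induced_matching_del_edges[OF G1d(2)] by (fastforce simp: del_edges_def)
  have ex2: "\<exists>M. induced_matching E2 M \<and> x \<notin> \<Union> M \<and> card M = nu (del_edges E2 x)" for x
    using nu_ex[of "del_edges E2 x"] G2d(4) induced_matching_del_edges[OF G2d(2)] by (fastforce simp: del_edges_def)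
  show "nu E1 + nu (del_edges E2 v2) \<le> nu (E1 \<union> E2)"
    using nu_ex[OF G1d(4)] ex2[of v2] induced_matching_glue by metis
  show "nu (del_edges E1 v1) + nu E2 \<le> nu (E1 \<union> E2)"
    using nu_ex[OF G2d(4)] ex1[of v1] induced_matching_glue by metis
  show "nu (del_edges E1 f) + nu (del_edges E2 f) \<le> nu (E1 \<union> E2)"
    using ex1[of f] ex2[of f] induced_matching_glue by metis
qed

text \<open>If the sum were reached, both parts would be maximum matchings and so cover
  \<open>v1\<close>, \<open>v2\<close> and, on one side, \<open>f\<close>. The leaf edge of the
  opposite side then meets two different members.\<close>

lemma nu_glue_less:
  assumes d1: "nu (del_edges E1 v1) < nu E1" and d2: "nu (del_edges E2 v2) < nu E2"
    and lf: "nu (del_edges E1 f) < nu E1 \<or> nu (del_edges E2 f) < nu E2"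
  shows "nu (E1 \<union> E2) < nu E1 + nu E2"
proof (rule ccontr)
  assume "\<not> ?thesis"
  moreover obtain M where M: "induced_matching (E1 \<union> E2) M" "card M = nu (E1 \<union> E2)"
    using nu_ex[of "E1 \<union> E2"] G1d(4) G2d(4) by auto
  note p = induced_matching_parts[OF M(1)]
  ultimately have c: "card (M \<inter> E1) = nu E1" "card (M \<inter> E2) = nu E2"
    using nu_ge[OF G1d(4) p(1)] nu_ge[OF G2d(4) p(2)] p(3) M(2) by auto
  have hit1: "x \<in> \<Union> (M \<inter> E1)" if "nu (del_edges E1 x) < nu E1" for x
  proof (rule ccontr)
    assume "x \<notin> \<Union> (M \<inter> E1)"
    then have "induced_matching (del_edges E1 x) (M \<inter> E1)" using p(1) induced_matching_del_edges[OF G1d(2)] by blast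
    then have "card (M \<inter> E1) \<le> nu (del_edges E1 x)" using G1d(4) by (intro nu_ge) (simp add: del_edges_def)
    then show False using c that by simp
  qed
  have hit2: "x \<in> \<Union> (M \<inter> E2)" if "nu (del_edges E2 x) < nu E2" for x
  proof (rule ccontr)
    assume "x \<notin> \<Union> (M \<inter> E2)"
    then have "induced_matching (del_edges E2 x) (M \<inter> E2)" using p(2) induced_matching_del_edges[OF G2d(2)] by blast
    then have "card (M \<inter> E2) \<le> nu (del_edges E2 x)" using G2d(4) by (intro nu_ge) (simp add: del_edges_def)
    then show False using c that by simp
  qed
  obtain e1 e2 where e: "e1 \<in> M" "e1 \<in> E1" "v1 \<in> e1" "e2 \<in> M" "e2 \<in> E2" "v2 \<in> e2"
    using hit1[OF d1] hit2[OF d2] by blast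
  from lf show False
  proof
    assume "nu (del_edges E1 f) < nu E1"
    then obtain e where "e \<in> M" "e \<in> E1" "f \<in> e" using hit1 by blast
    moreover have "{f, v2} \<in> E1 \<union> E2" using leaf2 by blast
    ultimately have "e = e2" using induced_matchingD(1)[OF M(1), of "{f, v2}" e e2 f v2] e by blast
    then show False using \<open>e \<in> E1\<close> e glue_E12 by blast
  next
    assume "nu (del_edges E2 f) < nu E2"
    then obtain e where "e \<in> M" "e \<in> E2" "f \<in> e" using hit2 by blast
    moreover have "{f, v1} \<in> E1 \<union> E2" using leaf1 by blast
    ultimately have "e = e1" using induced_matchingD(1)[OF M(1), of "{f, v1}" e e1 f v1] e by blast
    then show False using \<open>e \<in> E2\<close> e glue_E12 by blast
  qed
qed

end

section \<open>Fan graphs\<close>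

text \<open>\<open>\<A>\<close> consists of the attached cliques of all fans.  In \<open>last\<close>, \<open>L\<close> is the largest clique
  of the fan containing \<open>w\<close>, and \<open>a\<close> is the last vertex in the ordering of that fan.\<close>

locale fan_cliques =
  fixes C W :: "'a set" and \<A> :: "'a set set"
  assumes fin_C: "finite C" and fin_\<A>: "finite \<A>" "\<And>A. A \<in> \<A> \<Longrightarrow> finite A" and W: "W \<subseteq> C"
    and meet_C: "\<And>A. A \<in> \<A> \<Longrightarrow> A \<inter> C \<noteq> {}" and meet_W: "\<And>A. A \<in> \<A> \<Longrightarrow> A \<inter> C \<subseteq> W"
    and new: "\<And>A. A \<in> \<A> \<Longrightarrow> A - C \<noteq> {}"
    and new_disjoint: "\<And>A A' x. A \<in> \<A> \<Longrightarrow> A' \<in> \<A> \<Longrightarrow> x \<in> A \<Longrightarrow> x \<notin> C \<Longrightarrow> x \<in> A' \<Longrightarrow> A = A'"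
    and last: "\<And>w. w \<in> W \<Longrightarrow> \<exists>L\<in>\<A>. w \<in> L \<and> (\<exists>a\<in>L \<inter> C. \<forall>A\<in>\<A>. a \<in> A \<longrightarrow> A = L)"
begin

definition fan_edges :: "'a set set" where
  "fan_edges = complete_edges C \<union> (\<Union>A\<in>\<A>. complete_edges A)"

definition fan_verts :: "'a set" where
  "fan_verts = C \<union> \<Union> \<A>"

lemma complete_edges_iff: "{x, y} \<in> complete_edges A \<longleftrightarrow> x \<in> A \<and> y \<in> A \<and> x \<noteq> y"
  by (auto simp: complete_edges_def doubleton_eq_iff)

lemma fan_edges_iff: "{x, y} \<in> fan_edges \<longleftrightarrow> x \<noteq> y \<and> (x \<in> C \<and> y \<in> C \<or> (\<exists>A\<in>\<A>. x \<in> A \<and> y \<in> A))"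
  by (auto simp: fan_edges_def complete_edges_iff)

lemma fan_edges_new: "A \<in> \<A> \<Longrightarrow> x \<in> A \<Longrightarrow> x \<notin> C \<Longrightarrow> {x, y} \<in> fan_edges \<longleftrightarrow> y \<in> A \<and> x \<noteq> y"
  using new_disjoint by (auto simp: fan_edges_iff)

lemma fan_edges_old: "y \<in> C \<Longrightarrow> (\<And>A. A \<in> \<A> \<Longrightarrow> y \<notin> A) \<Longrightarrow> {y, z} \<in> fan_edges \<longleftrightarrow> z \<in> C \<and> y \<noteq> z"
  by (auto simp: fan_edges_iff)

text \<open>New vertices are simplicial, since their neighbours lie in one attached clique. In the
  delicate case only \<open>f\<close> lies outside \<open>C\<close>: take a vertex not adjacent to
  \<open>f\<close> if there is one, otherwise \<open>B\<close> is contained in a clique.\<close>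

lemma simplicial_avoiding:
  assumes B: "B \<subseteq> fan_verts" "B - {f} \<noteq> {}"
  shows "\<exists>w\<in>B - {f}. simplicial fan_edges B w"
proof (cases "B - {f} \<subseteq> C")
  case False
  then obtain x where x: "x \<in> B - {f}" "x \<notin> C" by blast
  then obtain A where A: "A \<in> \<A>" "x \<in> A" using B by (auto simp: fan_verts_def)
  have "simplicial fan_edges B x"
    unfolding simplicial_def fan_edges_new[OF A x(2)] using A by (auto simp: fan_edges_iff)
  with x show ?thesis by blast
next
  case True
  obtain w0 where w0: "w0 \<in> B - {f}" using B by blast
  show ?thesis
  proof (cases "f \<in> B \<and> f \<notin> C")
    case False
    then have "B \<subseteq> C" using True by auto
    then have "simplicial fan_edges B w0" unfolding simplicial_def by (auto simp: fan_edges_iff)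
    with w0 show ?thesis by blast
  next
    case f: True
    then obtain A where A: "A \<in> \<A>" "f \<in> A" using B by (auto simp: fan_verts_def)
    show ?thesis
    proof (cases "B \<subseteq> A")
      case True
      then have "simplicial fan_edges B w0" unfolding simplicial_def using A by (auto simp: fan_edges_iff)
      with w0 show ?thesis by blast
    next
      case False
      then obtain w where w: "w \<in> B" "w \<notin> A" by blast
      then have wf: "w \<noteq> f" using A by auto
      have "{w, f} \<notin> fan_edges" using fan_edges_new[OF A conjunct2[OF f], of w] w by (simp add: insert_commute)
      then have "x \<in> C" if "x \<in> B" "{w, x} \<in> fan_edges" for x using that True by (cases "x = f") auto
      then have "simplicial fan_edges B w" unfolding simplicial_def by (auto simp: fan_edges_iff)
      with w wf show ?thesis by blast
    qed
  qed
qed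

lemma chordal_fan: "chordal_graph fan_verts fan_edges"
  unfolding chordal_graph_def
proof (intro conjI allI impI ballI)
  show "finite fan_verts" using fin_C fin_\<A> by (auto simp: fan_verts_def)
  fix e assume "e \<in> fan_edges"
  then obtain A where A: "e \<in> complete_edges A" "A = C \<or> A \<in> \<A>" by (auto simp: fan_edges_def)
  then obtain x y where "e = {x, y}" "x \<in> A" "y \<in> A" "x \<noteq> y" by (auto simp: complete_edges_def)
  then show "card e = 2" "e \<subseteq> fan_verts" using A by (auto simp: fan_verts_def)
next
  fix B assume B: "B \<subseteq> fan_verts" "B \<noteq> {}"
  show "\<exists>w\<in>B. simplicial fan_edges B w"
  proof (cases "\<exists>f. B = {f}")
    case True
    then show ?thesis by (auto simp: simplicial_def)
  next
    case False
    then obtain f where "B - {f} \<noteq> {}" using B(2) by blast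
    then show ?thesis using simplicial_avoiding[OF B(1)] by blast
  qed
qed

section \<open>Leaves of a fan graph\<close>

context
  fixes f v
  assumes card_C: "card C \<ge> 2" and W_ne: "W \<noteq> {}" and f: "f \<in> fan_verts" and fv: "{e \<in> fan_edges. f \<in> e} = {{f, v}}"
begin

lemma f_nbr: "{f, y} \<in> fan_edges \<longleftrightarrow> y = v"
proof -
  have "{f, v} \<in> fan_edges" using fv by blast
  moreover have "y = v" if "{f, y} \<in> fan_edges"
  proof -
    have "{f, y} \<in> {e \<in> fan_edges. f \<in> e}" using that by simp
    then have "{f, y} = {f, v}" unfolding fv by simp
    then show ?thesis by (auto simp: doubleton_eq_iff)
  qed
  ultimately show ?thesis by blast
qed

text \<open>All other vertices of \<open>C\<close> are neighbours of \<open>f\<close>, so there is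
  just one. If \<open>f\<close> were in \<open>W\<close>, a new vertex of an attached clique would
  be a second neighbour.\<close>

lemma leaf_in_C:
  assumes fC: "f \<in> C"
  shows "C = {f, v}" "W = {v}" "f \<noteq> v"
proof -
  have 1: "c = v" if "c \<in> C" "c \<noteq> f" for c using f_nbr[of c] that fC by (auto simp: fan_edges_iff)
  have "C \<noteq> {f}" using card_C by auto
  then obtain c where "c \<in> C" "c \<noteq> f" using fC by blast
  then show C: "C = {f, v}" and "f \<noteq> v" using 1 fC by auto
  have "f \<notin> W"
  proof
    assume "f \<in> W"
    then obtain L where L: "L \<in> \<A>" "f \<in> L" using last by blast
    then obtain x where "x \<in> L" "x \<notin> C" using new by blast
    moreover have "v \<in> C" using C by blast
    ultimately show False using f_nbr[of x] L fC by (auto simp: fan_edges_iff)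
  qed
  then show "W = {v}" using W W_ne C by auto
qed

text \<open>The attached clique of \<open>f\<close> contains a vertex of \<open>C\<close>; being a
  neighbour of \<open>f\<close> it is \<open>v\<close>, and no third vertex is possible.\<close>

lemma leaf_not_in_C:
  assumes fC: "f \<notin> C"
  shows "{v, f} \<in> \<A>" "v \<in> C" "v \<in> W"
proof -
  obtain A where A: "A \<in> \<A>" "f \<in> A" using f fC by (auto simp: fan_verts_def)
  have 1: "y = v" if "y \<in> A" "y \<noteq> f" for y using f_nbr[of y] fan_edges_new[OF A fC, of y] that by auto
  obtain y where y: "y \<in> A" "y \<in> C" using meet_C[OF A(1)] by blast
  then have "y = v" using 1 fC by blast
  then show "v \<in> C" "v \<in> W" using y meet_W[OF A(1)] by auto
  have "A = {v, f}" using 1 A \<open>y = v\<close> y by auto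
  then show "{v, f} \<in> \<A>" using A by simp
qed

lemma nu_del_leaf_eq:
  assumes "card W = card C - 1"
  shows "nu (del_edges fan_edges f) = nu fan_edges"
proof -
  note G = chordal_graphD[OF chordal_fan]
  \<comment> \<open>The last property puts all neighbours of \<open>u\<close> in the closed
    neighbourhood of \<open>v\<close>, which makes \<open>{v, u}\<close> a legal replacement for
    \<open>{f, v}\<close>. If \<open>f\<close> is in \<open>C\<close>, take a new vertex of a clique
    at \<open>v\<close>; otherwise a vertex of \<open>C\<close> outside \<open>W\<close>.\<close>
  obtain u where u: "{v, u} \<in> fan_edges" "u \<noteq> f" "\<And>y. {u, y} \<in> fan_edges \<Longrightarrow> y = v \<or> {v, y} \<in> fan_edges"
  proof (cases "f \<in> C")
    case True
    note l = leaf_in_C[OF True]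
    obtain L where L: "L \<in> \<A>" "v \<in> L" using last[of v] l(2) by auto
    then obtain x where x: "x \<in> L" "x \<notin> C" using new by blast
    show ?thesis
    proof (rule that[of x])
      have "v \<in> C" using l(1) by blast
      then show "{v, x} \<in> fan_edges" using L x by (auto simp: fan_edges_iff)
      show "x \<noteq> f" using x True by auto
      show "y = v \<or> {v, y} \<in> fan_edges" if "{x, y} \<in> fan_edges" for y
        using that L unfolding fan_edges_new[OF L(1) x] by (auto simp: fan_edges_iff)
    qed
  next
    case False
    note l = leaf_not_in_C[OF False]
    have "W \<noteq> C" using assms card_C by auto
    then obtain u where u: "u \<in> C" "u \<notin> W" using W by blast
    have uA: "u \<notin> A" if "A \<in> \<A>" for A using meet_W[OF that] u by blast
    show ?thesis
    proof (rule that[of u])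
      show "{v, u} \<in> fan_edges" using u l by (auto simp: fan_edges_iff)
      show "u \<noteq> f" using u False by auto
      show "y = v \<or> {v, y} \<in> fan_edges" if "{u, y} \<in> fan_edges" for y
      proof -
        have "y \<in> C" using that fan_edges_old[OF u(1) uA] by blast
        then show ?thesis using l(2) by (cases "y = v") (simp_all add: fan_edges_iff)
      qed
    qed
  qed
  have "nu fan_edges \<le> nu (del_edges fan_edges f)"
  proof -
    obtain M where M: "induced_matching fan_edges M" "card M = nu fan_edges" using nu_ex[OF G(4)] by blast
    have fin: "finite (del_edges fan_edges f)" using G(4) by (simp add: del_edges_def)
    have "\<exists>M. induced_matching fan_edges M \<and> card M = nu fan_edges \<and> f \<notin> \<Union> M"
    proof (cases "f \<in> \<Union> M")
      case False
      then show ?thesis using M by blast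
    next
      case True
      then obtain e where e: "e \<in> M" "f \<in> e" by blast
      then have "e \<in> fan_edges" using induced_matching_sub[OF M(1)] by blast
      then have ev: "e = {f, v}" using fv e by blast
      have "closed_nbhd fan_edges {v, u} \<subseteq> closed_nbhd fan_edges e"
        unfolding closed_nbhd_def ev using u by (auto simp: insert_commute)
      note ex = induced_matching_exchange[OF G(4) G(2) M(1) e(1) u(1) this]
      have "f \<notin> \<Union> (M - {e})"
      proof
        assume "f \<in> \<Union> (M - {e})"
        then obtain e' where "e' \<in> M" "e' \<noteq> e" "f \<in> e'" by blast
        then show False using induced_matchingD(1)[OF M(1) \<open>e \<in> fan_edges\<close> e(1)] e by blast
      qed
      moreover have "f \<notin> {v, u}"
      proof -
        have "{f, v} \<in> fan_edges" using \<open>e \<in> fan_edges\<close> ev by simp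
        then show ?thesis using u(2) by (auto simp: fan_edges_iff)
      qed
      ultimately have "f \<notin> \<Union> (insert {v, u} (M - {e}))" by blast
      then show ?thesis using ex M(2) by metis
    qed
    then obtain M' where "induced_matching fan_edges M'" "card M' = nu fan_edges" "f \<notin> \<Union> M'" by blast
    then show ?thesis using nu_ge[OF fin, of M'] induced_matching_del_edges[OF G(2), where v = f and M = M'] by simp
  qed
  then show ?thesis using nu_del_edges_le[OF G(4) G(2), of f] by simp
qed

text \<open>Every maximum matching covers \<open>v\<close>. One that avoids \<open>f\<close>
  contains some \<open>{v, w}\<close>, whose closed neighbourhood includes \<open>C\<close> and an
  attached clique \<open>L\<close> through \<open>v\<close> or \<open>w\<close>. An edge of
  \<open>L\<close> from the last vertex \<open>a\<close> of the fan to a new vertex reaches no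
  further, and replacing \<open>{v, w}\<close> by it uncovers \<open>v\<close>, a
  contradiction.\<close>

lemma nu_del_leaf_less:
  assumes WC: "W = C" and less: "nu (del_edges fan_edges v) < nu fan_edges"
  shows "nu (del_edges fan_edges f) < nu fan_edges"
proof (rule ccontr)
  note G = chordal_graphD[OF chordal_fan]
  assume "\<not> ?thesis"
  moreover have fin: "finite (del_edges fan_edges x)" for x using G(4) by (simp add: del_edges_def)
  moreover obtain M where M: "induced_matching (del_edges fan_edges f) M" "card M = nu (del_edges fan_edges f)" using nu_ex[OF fin] by blast
  ultimately have Mf: "induced_matching fan_edges M" "f \<notin> \<Union> M" "card M \<ge> nu fan_edges"
    using induced_matching_del_edges[OF G(2), where v = f and M = M] by auto
  have no: "v \<in> \<Union> M'" if "induced_matching fan_edges M'" "card M' \<ge> nu fan_edges" for M'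
  proof (rule ccontr)
    assume "v \<notin> \<Union> M'"
    then have "card M' \<le> nu (del_edges fan_edges v)"
      using that induced_matching_del_edges[OF G(2), where v = v and M = M'] by (intro nu_ge[OF fin]) simp
    then show False using less that by simp
  qed
  obtain e0 where e0: "e0 \<in> M" "v \<in> e0" using no[OF Mf(1,3)] by blast
  have e0E: "e0 \<in> fan_edges" using induced_matching_sub[OF Mf(1)] e0 by blast
  obtain w where w: "e0 = {v, w}" using G(2)[OF e0E] e0(2) by (auto simp: card_2_iff)
  have vw: "{v, w} \<in> fan_edges" "w \<noteq> f" using e0E w Mf(2) e0 by auto
  have fC: "f \<notin> C" using leaf_in_C WC by auto
  note l = leaf_not_in_C[OF fC]
  \<comment> \<open>Use the fan of \<open>w\<close> if \<open>w\<close> is in \<open>C\<close>,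
    otherwise that of \<open>v\<close>. If its last vertex \<open>a\<close> were \<open>v\<close>,
    then \<open>{v, f}\<close> would be the only attached clique at \<open>v\<close>, leaving no
    room for \<open>w\<close>.\<close>
  have "\<exists>L\<in>\<A>. (v \<in> L \<or> w \<in> L) \<and> (\<exists>a\<in>L \<inter> C. a \<noteq> v \<and> (\<forall>A\<in>\<A>. a \<in> A \<longrightarrow> A = L))"
  proof (cases "w \<in> C")
    case True
    then obtain L a where L: "L \<in> \<A>" "w \<in> L" "a \<in> L \<inter> C" "\<forall>A\<in>\<A>. a \<in> A \<longrightarrow> A = L" using last[of w] WC by blast
    have "a \<noteq> v"
    proof
      assume "a = v"
      then have "{v, f} = L" using L(4)[rule_format, OF l(1)] by simp
      then show False using L(2) vw by (auto simp: fan_edges_iff)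
    qed
    then show ?thesis using L by blast
  next
    case False
    then obtain A where A: "A \<in> \<A>" "v \<in> A" "w \<in> A" using vw by (auto simp: fan_edges_iff)
    obtain L a where L: "L \<in> \<A>" "v \<in> L" "a \<in> L \<inter> C" "\<forall>A\<in>\<A>. a \<in> A \<longrightarrow> A = L" using last[OF l(3)] by blast
    have "a \<noteq> v"
    proof
      assume "a = v"
      then have "{v, f} = A" using L(4)[rule_format, OF l(1)] L(4)[rule_format, OF A(1)] A(2) by simp
      then show False using A(3) vw by (auto simp: fan_edges_iff)
    qed
    then show ?thesis using L by blast
  qed
  then obtain L a where L: "L \<in> \<A>" "v \<in> L \<or> w \<in> L" "a \<in> L" "a \<in> C" "a \<noteq> v" "\<And>A. A \<in> \<A> \<Longrightarrow> a \<in> A \<Longrightarrow> A = L" by blast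
  obtain x where x: "x \<in> L" "x \<notin> C" using new[OF L(1)] by blast
  have "a \<noteq> x" using L(4) x(2) by blast
  then have ax: "{a, x} \<in> fan_edges" unfolding fan_edges_iff using L(1,3) x(1) by blast
  \<comment> \<open>\<open>a\<close> lies in no attached clique but \<open>L\<close>, and all
    neighbours of the new vertex \<open>x\<close> are in \<open>L\<close>.\<close>
  have "closed_nbhd fan_edges {a, x} \<subseteq> C \<union> L"
  proof
    fix y assume "y \<in> closed_nbhd fan_edges {a, x}"
    then consider "y = a" | "y = x" | "{a, y} \<in> fan_edges" | "{x, y} \<in> fan_edges" by (auto simp: closed_nbhd_def)
    then show "y \<in> C \<union> L"
    proof cases
      case 3
      then show ?thesis using L(6) unfolding fan_edges_iff by blast
    next
      case 4
      then show ?thesis unfolding fan_edges_new[OF L(1) x] by blast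
    qed (use L(4) x(1) in auto)
  qed
  also have "\<dots> \<subseteq> closed_nbhd fan_edges e0"
  proof
    fix y assume y: "y \<in> C \<union> L"
    show "y \<in> closed_nbhd fan_edges e0"
    proof (cases "y \<in> C")
      case True
      then show ?thesis using l(2) by (auto simp: closed_nbhd_def w fan_edges_iff)
    next
      case False
      then show ?thesis using y L(1,2) by (auto simp: closed_nbhd_def w fan_edges_iff)
    qed
  qed
  finally have sub: "closed_nbhd fan_edges {a, x} \<subseteq> closed_nbhd fan_edges e0" .
  note ex = induced_matching_exchange[OF G(4) G(2) Mf(1) e0(1) ax sub]
  have "v \<in> \<Union> (insert {a, x} (M - {e0}))" using no[OF ex(1)] ex(2) Mf(3) by simp
  moreover have "v \<noteq> a" "v \<noteq> x" using L(5) x(2) l(2) by auto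
  ultimately obtain e where "e \<in> M" "e \<noteq> e0" "v \<in> e" by auto
  then show False using induced_matchingD(1)[OF Mf(1) e0E e0(1), of e v v] e0(2) by blast
qed

end

end

text \<open>Forgets the orderings and the partition into fans, retaining only what
  \<open>fan_cliques\<close> records.\<close>

lemma fan_graph_cliques:
  assumes "fan_graph k W C G"
  obtains \<A> where "fan_cliques C W \<A>" "verts G = fan_cliques.fan_verts C \<A>" "edges G = fan_cliques.fan_edges C \<A>"
    "k \<ge> 1 \<Longrightarrow> W \<noteq> {}"
proof -
  have finC: "finite C" and W: "W \<subseteq> C" using assms by (simp_all add: fan_graph_def)
  from assms[unfolded fan_graph_def, THEN conjunct2, THEN conjunct2]
  obtain Ws Bs where F: "length Ws = k \<and> length Bs = k \<and> \<Union> (set Ws) = W \<and> (\<forall>i<k. Ws ! i \<noteq> {}) \<and>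
        (\<forall>i<k. \<forall>j<k. i \<noteq> j \<longrightarrow> Ws ! i \<inter> Ws ! j = {}) \<and> (\<forall>i<k. fan_branch C (Ws ! i) (Bs ! i)) \<and>
        (\<forall>i<k. \<forall>j<k. i \<noteq> j \<longrightarrow> (\<Union> (set (Bs ! i)) - C) \<inter> (\<Union> (set (Bs ! j)) - C) = {}) \<and>
        verts G = C \<union> \<Union> (set (concat Bs)) \<and>
        edges G = complete_edges C \<union> (\<Union>A\<in>set (concat Bs). complete_edges A)"
    by (elim exE) (rule that)
  note len = F[THEN conjunct1] F[THEN conjunct2, THEN conjunct1]
  have WU: "\<Union> (set Ws) = W" and Wne: "\<And>i. i < k \<Longrightarrow> Ws ! i \<noteq> {}"
    and Wd: "\<And>i j. i < k \<Longrightarrow> j < k \<Longrightarrow> i \<noteq> j \<Longrightarrow> Ws ! i \<inter> Ws ! j = {}"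
    and br: "\<And>i. i < k \<Longrightarrow> fan_branch C (Ws ! i) (Bs ! i)"
    and Bd: "\<And>i j. i < k \<Longrightarrow> j < k \<Longrightarrow> i \<noteq> j \<Longrightarrow> (\<Union> (set (Bs ! i)) - C) \<inter> (\<Union> (set (Bs ! j)) - C) = {}"
    and VG: "verts G = C \<union> \<Union> (set (concat Bs))"
    and EG: "edges G = complete_edges C \<union> (\<Union>A\<in>set (concat Bs). complete_edges A)"
    using F by (simp_all del: set_concat)
  have "\<forall>i. \<exists>us. i < k \<longrightarrow> distinct us \<and> set us = Ws ! i \<and> length (Bs ! i) = length us \<and>
        (\<forall>j<length us. finite (Bs ! i ! j) \<and> card (Bs ! i ! j) > Suc j \<and> C \<inter> Bs ! i ! j = set (take (Suc j) us)) \<and>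
        (\<forall>j<length us. \<forall>l<length us. j \<noteq> l \<longrightarrow> (Bs ! i ! j - C) \<inter> (Bs ! i ! l - C) = {})"
    using br unfolding fan_branch_def by blast
  from choice[OF this] obtain us where us: "\<And>i. i < k \<Longrightarrow> distinct (us i) \<and> set (us i) = Ws ! i \<and> length (Bs ! i) = length (us i) \<and>
        (\<forall>j<length (us i). finite (Bs ! i ! j) \<and> card (Bs ! i ! j) > Suc j \<and> C \<inter> Bs ! i ! j = set (take (Suc j) (us i))) \<and>
        (\<forall>j<length (us i). \<forall>l<length (us i). j \<noteq> l \<longrightarrow> (Bs ! i ! j - C) \<inter> (Bs ! i ! l - C) = {})" by blast
  define \<A> where "\<A> = set (concat Bs)"
  have mem: "\<exists>i j. i < k \<and> j < length (us i) \<and> A = Bs ! i ! j" if A: "A \<in> \<A>" for A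
  proof -
    obtain B where B: "B \<in> set Bs" "A \<in> set B" using A unfolding \<A>_def set_concat by blast
    obtain i where i: "i < k" "B = Bs ! i" using B(1) len by (metis in_set_conv_nth)
    obtain j where "j < length B" "A = B ! j" using B(2) by (metis in_set_conv_nth)
    then show ?thesis using i us[OF i(1)] by auto
  qed
  have memI: "Bs ! i ! j \<in> \<A>" "Bs ! i ! j \<in> set (Bs ! i)" if "i < k" "j < length (us i)" for i j
  proof -
    have "Bs ! i \<in> set Bs" using that len by simp
    moreover show "Bs ! i ! j \<in> set (Bs ! i)" using that us[OF that(1)] by simp
    ultimately show "Bs ! i ! j \<in> \<A>" by (auto simp: \<A>_def)
  qed
  have cap: "C \<inter> Bs ! i ! j = set (take (Suc j) (us i))" if "i < k" "j < length (us i)" for i j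
    using us[OF that(1)] that(2) by blast
  have cl: "fan_cliques C W \<A>"
  proof
    show "finite C" by (rule finC)
    show "finite \<A>" by (simp add: \<A>_def)
    show "W \<subseteq> C" by (rule W)
    fix A assume "A \<in> \<A>"
    then obtain i j where ij: "i < k" "j < length (us i)" "A = Bs ! i ! j" using mem by blast
    have A: "finite A" "card A > Suc j" "C \<inter> A = set (take (Suc j) (us i))" using us[OF ij(1)] ij(2,3) by blast+
    show "finite A" by (rule A(1))
    show "A \<inter> C \<noteq> {}" using A(3) ij(2) by (cases "us i") auto
    have "set (take (Suc j) (us i)) \<subseteq> Ws ! i" using us[OF ij(1)] set_take_subset by metis
    moreover have "Ws ! i \<in> set Ws" using ij(1) len by simp
    ultimately show "A \<inter> C \<subseteq> W" using A(3) WU by blast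
    \<comment> \<open>\<open>A\<close> meets \<open>C\<close> in at most \<open>Suc j\<close>
      vertices but has more elements.\<close>
    show "A - C \<noteq> {}"
    proof
      assume "A - C = {}"
      then have "A = C \<inter> A" by blast
      then have "card A = card (set (take (Suc j) (us i)))" using A(3) by simp
      also have "\<dots> \<le> length (take (Suc j) (us i))" by (rule card_length)
      also have "\<dots> \<le> Suc j" by simp
      finally show False using A(2) by simp
    qed
  next
    fix A A' x assume *: "A \<in> \<A>" "A' \<in> \<A>" "x \<in> A" "x \<notin> C" "x \<in> A'"
    obtain i j where ij: "i < k" "j < length (us i)" "A = Bs ! i ! j" using mem *(1) by blast
    obtain i' j' where ij': "i' < k" "j' < length (us i')" "A' = Bs ! i' ! j'" using mem *(2) by blast
    have "i = i'"
    proof (rule ccontr)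
      assume "i \<noteq> i'"
      then show False using Bd[OF ij(1) ij'(1)] memI(2)[OF ij(1,2)] memI(2)[OF ij'(1,2)] * ij(3) ij'(3) by blast
    qed
    moreover have "j = j'" if "i = i'"
    proof (rule ccontr)
      assume "j \<noteq> j'"
      then have "(Bs ! i ! j - C) \<inter> (Bs ! i ! j' - C) = {}" using us[OF ij(1)] ij(2) ij'(2) that by blast
      then show False using * ij(3) ij'(3) that by blast
    qed
    ultimately show "A = A'" using ij(3) ij'(3) by simp
  next
    fix w assume "w \<in> W"
    then obtain i where i: "i < k" "w \<in> Ws ! i" using WU len by (metis UnionE in_set_conv_nth)
    have d: "distinct (us i)" and su: "set (us i) = Ws ! i" using us[OF i(1)] by blast+
    \<comment> \<open>The final index of the ordering: its clique meets \<open>C\<close> in all of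
      \<open>Ws ! i\<close>, and its vertex enters no earlier clique of the fan.\<close>
    define m where "m = length (us i) - 1"
    have "us i \<noteq> []" using su i(2) by auto
    then have m: "m < length (us i)" "Suc m = length (us i)" by (auto simp: m_def)
    let ?L = "Bs ! i ! m" and ?a = "us i ! m"
    have L: "C \<inter> ?L = Ws ! i" using cap[OF i(1) m(1)] m(2) su by simp
    have a: "?a \<in> Ws ! i" using m(1) su nth_mem by blast
    have "A = ?L" if A: "A \<in> \<A>" "?a \<in> A" for A
    proof -
      obtain i' j where ij: "i' < k" "j < length (us i')" "A = Bs ! i' ! j" using mem A(1) by blast
      have "?a \<in> C" using a L by blast
      then have at: "?a \<in> set (take (Suc j) (us i'))" using cap[OF ij(1,2)] A(2) ij(3) by blast
      then have "?a \<in> Ws ! i'" using us[OF ij(1)] in_set_takeD by metis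
      then have ii: "i' = i" using Wd[OF ij(1) i(1)] a by blast
      obtain q where q: "q < Suc j" "q < length (us i)" "us i ! q = ?a"
        using at unfolding ii by (auto simp: in_set_conv_nth)
      then have "q = m" using d m(1) nth_eq_iff_index_eq by blast
      then have "j = m" using q ij(2) m(2) ii by simp
      then show ?thesis using ij(3) ii by simp
    qed
    then show "\<exists>L\<in>\<A>. w \<in> L \<and> (\<exists>a\<in>L \<inter> C. \<forall>A\<in>\<A>. a \<in> A \<longrightarrow> A = L)"
      using memI(1)[OF i(1) m(1)] L i(2) a by (intro bexI[of _ ?L] conjI bexI[of _ ?a]) blast+
  qed
  show ?thesis
  proof (rule that[OF cl])
    show "verts G = fan_cliques.fan_verts C \<A>" unfolding fan_cliques.fan_verts_def[OF cl] unfolding VG \<A>_def ..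
    show "edges G = fan_cliques.fan_edges C \<A>" unfolding fan_cliques.fan_edges_def[OF cl] unfolding EG \<A>_def ..
    show "W \<noteq> {}" if "k \<ge> 1"
    proof -
      have "0 < k" using that by simp
      then have "Ws ! 0 \<subseteq> W" "Ws ! 0 \<noteq> {}" using WU len Wne nth_mem by blast+
      then show ?thesis by blast
    qed
  qed
qed

section \<open>Vertex deletion, and the leaf results restated for graphs\<close>

lemma chordal_del_edges:
  assumes "chordal_graph V E"
  shows "chordal_graph (V - {v}) (del_edges E v)"
  unfolding chordal_graph_def
proof (intro conjI ballI allI impI)
  note G = chordal_graphD[OF assms]
  show "finite (V - {v})" using G(1) by simp
  show "card e = 2" "e \<subseteq> V - {v}" if "e \<in> del_edges E v" for e
    using that G(2,3) by (auto simp: del_edges_def)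
  fix B assume B: "B \<subseteq> V - {v}" "B \<noteq> {}"
  then obtain w where w: "w \<in> B" "simplicial E B w" using G(5)[of B] by blast
  then have "simplicial (del_edges E v) B w" using B(1) by (auto simp: simplicial_def del_edges_def)
  with w show "\<exists>w\<in>B. simplicial (del_edges E v) B w" by blast
qed

lemma edge_reg_del_vert:
  assumes "chordal_graph (verts G) (edges G)"
  shows "edge_reg TYPE('k::field) (del_vert G v) = int (nu (del_edges (edges G) v))"
  using edge_reg_eq_nu[of "del_vert G v", where ?'k = 'k] chordal_del_edges[OF assms, of v]
  by (simp add: del_vert_def del_edges_def)

lemma leaf_star:
  assumes "leaf G f" "{f, v} \<in> edges G"
  shows "{e \<in> edges G. f \<in> e} = {{f, v}}"
proof -
  have "card {e \<in> edges G. f \<in> e} = 1" using assms by (simp add: leaf_def vdeg_def)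
  then obtain e where "{e \<in> edges G. f \<in> e} = {e}" by (rule card_1_singletonE)
  moreover have "{f, v} \<in> {e \<in> edges G. f \<in> e}" using assms by simp
  ultimately show ?thesis by simp
qed

lemma fan_graph_leaf:
  assumes fan: "fan_graph k W C G" and k: "k \<ge> 1" and C: "card C \<ge> 2" and f: "leaf G f" "{f, v} \<in> edges G"
  shows "chordal_graph (verts G) (edges G)"
    and "B \<subseteq> verts G \<Longrightarrow> B - {f} \<noteq> {} \<Longrightarrow> \<exists>w\<in>B - {f}. simplicial (edges G) B w"
    and "card W = card C - 1 \<Longrightarrow> nu (del_edges (edges G) f) = nu (edges G)"
    and "card W = card C \<Longrightarrow> nu (del_edges (edges G) v) < nu (edges G) \<Longrightarrow> nu (del_edges (edges G) f) < nu (edges G)"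
proof -
  obtain \<A> where cl: "fan_cliques C W \<A>" and VE: "verts G = fan_cliques.fan_verts C \<A>" "edges G = fan_cliques.fan_edges C \<A>"
    and W_ne: "W \<noteq> {}" using fan_graph_cliques[OF fan] k by metis
  interpret fan_cliques C W \<A> by (rule cl)
  have fan_verts: "f \<in> fan_verts" using f(1) VE by (simp add: leaf_def)
  have fv: "{e \<in> fan_edges. f \<in> e} = {{f, v}}" using leaf_star[OF f] VE by simp
  show "chordal_graph (verts G) (edges G)" using chordal_fan VE by simp
  show "B \<subseteq> verts G \<Longrightarrow> B - {f} \<noteq> {} \<Longrightarrow> \<exists>w\<in>B - {f}. simplicial (edges G) B w"
    using simplicial_avoiding VE by simp
  show "card W = card C - 1 \<Longrightarrow> nu (del_edges (edges G) f) = nu (edges G)"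
    using nu_del_leaf_eq[OF C W_ne fan_verts fv] VE by simp
  assume "card W = card C" and less: "nu (del_edges (edges G) v) < nu (edges G)"
  then have "W = C" using card_subset_eq[OF fin_C] W by blast
  then show "nu (del_edges (edges G) f) < nu (edges G)"
    using nu_del_leaf_less[OF C W_ne fan_verts fv] less VE by simp
qed

section \<open>Renaming vertices\<close>

text \<open>Gluing renames the leaf of the second graph, so what is known of that graph must be
  transported along an injective map.\<close>

context
  fixes V :: "'a set" and E :: "'a set set" and h :: "'a \<Rightarrow> 'b"
  assumes inj: "inj_on h V" and EV: "\<And>e. e \<in> E \<Longrightarrow> e \<subseteq> V"
begin

lemma image_edge_iff:
  assumes e: "e \<subseteq> V"
  shows "h ` e \<in> (`) h ` E \<longleftrightarrow> e \<in> E"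
proof
  assume "h ` e \<in> (`) h ` E"
  then obtain e' where e': "e' \<in> E" "h ` e = h ` e'" by blast
  then have "e = e'" using inj_on_image_eq_iff[OF inj e EV[OF e'(1)]] by simp
  then show "e \<in> E" using e' by simp
qed blast

lemma simplicial_image:
  assumes "B \<subseteq> V" "w \<in> B" "simplicial E B w"
  shows "simplicial ((`) h ` E) (h ` B) (h w)"
  unfolding simplicial_def
proof (intro ballI impI)
  fix x y assume xy: "x \<in> h ` B" "y \<in> h ` B" "{h w, x} \<in> (`) h ` E" "{h w, y} \<in> (`) h ` E" "x \<noteq> y"
  then obtain p q where pq: "p \<in> B" "q \<in> B" "x = h p" "y = h q" by blast
  then have "h ` {w, p} \<in> (`) h ` E" "h ` {w, q} \<in> (`) h ` E" "p \<noteq> q" using xy by auto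
  then have "{w, p} \<in> E" "{w, q} \<in> E" using image_edge_iff[of "{w, p}"] image_edge_iff[of "{w, q}"] assms pq by blast+
  then have "{p, q} \<in> E" using assms pq \<open>p \<noteq> q\<close> unfolding simplicial_def by blast
  then have "h ` {p, q} \<in> (`) h ` E" by (rule imageI)
  then show "{x, y} \<in> (`) h ` E" by (simp add: pq)
qed

lemma simplicial_avoiding_image:
  assumes ex: "\<And>B. B \<subseteq> V \<Longrightarrow> B - {f} \<noteq> {} \<Longrightarrow> \<exists>w\<in>B - {f}. simplicial E B w" and f: "f \<in> V"
    and B': "B' \<subseteq> h ` V" "B' - {h f} \<noteq> {}"
  shows "\<exists>w\<in>B' - {h f}. simplicial ((`) h ` E) B' w"
proof -
  obtain B where B: "B \<subseteq> V" "B' = h ` B" using B'(1) by (meson subset_imageE)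
  have "B - {f} \<noteq> {}" using B'(2) B(2) by blast
  then obtain w where w: "w \<in> B" "w \<noteq> f" "simplicial E B w" using ex[OF B(1)] by blast
  then have "h w \<noteq> h f" using inj_onD[OF inj, of w f] B(1) f by blast
  then show ?thesis using simplicial_image[OF B(1) w(1,3)] w(1) B(2) by blast
qed

lemma chordal_image:
  assumes "chordal_graph V E" shows "chordal_graph (h ` V) ((`) h ` E)"
  unfolding chordal_graph_def
proof (intro conjI ballI allI impI)
  note G = chordal_graphD[OF assms]
  show "finite (h ` V)" using G(1) by simp
  fix e assume "e \<in> (`) h ` E"
  then obtain e0 where e0: "e0 \<in> E" "e = h ` e0" by blast
  show "card e = 2" using card_image[OF inj_on_subset[OF inj EV[OF e0(1)]]] G(2)[OF e0(1)] e0(2) by simp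
  show "e \<subseteq> h ` V" using EV[OF e0(1)] e0(2) by blast
next
  fix B' assume B': "B' \<subseteq> h ` V" "B' \<noteq> {}"
  then obtain B where B: "B \<subseteq> V" "B' = h ` B" by (meson subset_imageE)
  then obtain w where w: "w \<in> B" "simplicial E B w" using chordal_graphD(5)[OF assms B(1)] B'(2) by blast
  then show "\<exists>w\<in>B'. simplicial ((`) h ` E) B' w" using simplicial_image[OF B(1) w] B(2) by blast
qed

lemma nu_image_ge:
  assumes fin: "finite E"
  shows "nu E \<le> nu ((`) h ` E)"
proof -
  obtain M where M: "induced_matching E M" "card M = nu E" using nu_ex[OF fin] by blast
  have ME: "M \<subseteq> E" by (rule induced_matching_sub[OF M(1)])
  have "induced_matching ((`) h ` E) ((`) h ` M)"
  proof (rule induced_matchingI)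
    show "(`) h ` M \<subseteq> (`) h ` E" using ME by blast
    fix d e e' x y assume *: "d \<in> (`) h ` E" "e \<in> (`) h ` M" "e' \<in> (`) h ` M" "x \<in> d" "x \<in> e" "y \<in> d" "y \<in> e'"
    then obtain d0 e0 e0' where 0: "d0 \<in> E" "e0 \<in> M" "e0' \<in> M" "d = h ` d0" "e = h ` e0" "e' = h ` e0'" by blast
    have common: "\<exists>p. p \<in> d0 \<and> p \<in> c" if c: "c \<in> M" "z \<in> h ` d0" "z \<in> h ` c" for c z
    proof -
      obtain p q where pq: "p \<in> d0" "q \<in> c" "h p = h q" using c by (metis imageE)
      then have "p = q" using inj_onD[OF inj, of p q] EV[OF 0(1)] EV[of c] ME c(1) by blast
      then show ?thesis using pq by blast
    qed
    obtain p where p: "p \<in> d0" "p \<in> e0" using common[OF 0(2), of x] * 0 by blast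
    obtain q where q: "q \<in> d0" "q \<in> e0'" using common[OF 0(3), of y] * 0 by blast
    have "e0 = e0'" by (rule induced_matchingD(1)[OF M(1) 0(1,2,3) p q])
    then show "e = e'" using 0 by simp
  qed
  moreover have "inj_on ((`) h) M"
    by (rule inj_on_subset[OF inj_on_image_Pow[OF inj]]) (use ME EV in blast)
  then have "card ((`) h ` M) = card M" by (rule card_image)
  ultimately show ?thesis using nu_ge[of "(`) h ` E" "(`) h ` M"] fin M(2) by simp
qed

lemma del_edges_image:
  assumes "v \<in> V"
  shows "del_edges ((`) h ` E) (h v) = (`) h ` del_edges E v"
proof -
  have "h v \<in> h ` e \<longleftrightarrow> v \<in> e" if "e \<in> E" for e
    using inj_on_image_mem_iff[OF inj assms EV[OF that]] .
  then show ?thesis by (auto simp: del_edges_def)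
qed

end

text \<open>One inequality is \<open>nu_image_ge\<close> for \<open>h\<close>, the other is
  \<open>nu_image_ge\<close> for its inverse.\<close>

lemma nu_image:
  assumes inj: "inj_on h V" and EV: "\<And>e. e \<in> E \<Longrightarrow> e \<subseteq> V" and fin: "finite E"
  shows "nu ((`) h ` E) = nu E"
proof (rule antisym)
  let ?g = "inv_into V h"
  have "nu ((`) h ` E) \<le> nu ((`) ?g ` (`) h ` E)"
    by (rule nu_image_ge[of ?g "h ` V"]) (use EV fin in \<open>auto intro: inj_on_inv_into\<close>)
  also have "(`) ?g ` (`) h ` E = E"
  proof -
    have "?g ` h ` e = e" if "e \<in> E" for e using inv_into_image_cancel[OF inj EV[OF that]] .
    then show ?thesis by (simp add: image_image)
  qed
  finally show "nu ((`) h ` E) \<le> nu E" .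
  show "nu E \<le> nu ((`) h ` E)" by (rule nu_image_ge[OF inj EV fin])
qed

theorem theorem3p10:
  fixes G :: "nat \<Rightarrow> 'a graph"
    and C W :: "nat \<Rightarrow> 'a set"
    and n k :: "nat \<Rightarrow> nat"
    and f v :: "nat \<Rightarrow> 'a"
    and t :: nat
    and H :: "'a graph"
  assumes n: "\<And>i. i \<in> {1, 2} \<Longrightarrow> n i \<ge> 2 \<and> card (C i) = n i"
    and k: "\<And>i. i \<in> {1, 2} \<Longrightarrow> k i \<ge> 1"
    and fan: "\<And>i. i \<in> {1, 2} \<Longrightarrow> fan_graph (k i) (W i) (C i) (G i)"
    and leaf: "\<And>i. i \<in> {1, 2} \<Longrightarrow> leaf (G i) (f i)"
    and neighbor: "\<And>i. i \<in> {1, 2} \<Longrightarrow> {f i, v i} \<in> edges (G i) \<and> vdeg (G i) (v i) \<ge> 2"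
    and disjoint: "verts (G 1) \<inter> verts (G 2) = {}"
    and H: "H = star_glue (G 1) (f 1) (G 2) (f 2)"
    and t: "t = card {i \<in> {1, 2}. edge_reg TYPE('k::field) (del_vert (G i) (v i))
                                \<noteq> edge_reg TYPE('k) (G i)}"
  shows "(t \<le> 1 \<longrightarrow>
            edge_reg TYPE('k) H = edge_reg TYPE('k) (G 1) + edge_reg TYPE('k) (G 2)) \<and>
         (t = 2 \<and> (\<forall>i\<in>{1, 2}. card (W i) = n i - 1) \<longrightarrow>
            edge_reg TYPE('k) H = edge_reg TYPE('k) (G 1) + edge_reg TYPE('k) (G 2)) \<and>
         (t = 2 \<and> (\<exists>i\<in>{1, 2}. card (W i) = n i) \<longrightarrow>
            edge_reg TYPE('k) H = edge_reg TYPE('k) (G 1) + edge_reg TYPE('k) (G 2) - 1)"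
proof -
  define E where "E i = edges (G i)" for i
  define V where "V i = verts (G i)" for i
  have i12: "1 \<in> {1, 2 :: nat}" "2 \<in> {1, 2 :: nat}" by simp_all
  have facts: "chordal_graph (V i) (E i)" "{e \<in> E i. f i \<in> e} = {{f i, v i}}"
    "B \<subseteq> V i \<Longrightarrow> B - {f i} \<noteq> {} \<Longrightarrow> \<exists>w\<in>B - {f i}. simplicial (E i) B w"
    "card (W i) = n i - 1 \<Longrightarrow> nu (del_edges (E i) (f i)) = nu (E i)"
    "card (W i) = n i \<Longrightarrow> nu (del_edges (E i) (v i)) < nu (E i) \<Longrightarrow> nu (del_edges (E i) (f i)) < nu (E i)"
    "f i \<in> V i" "v i \<in> V i" "f i \<noteq> v i" if i: "i \<in> {1, 2}" for i B
  proof -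
    have C: "card (C i) \<ge> 2" "card (C i) = n i" using n[OF i] by auto
    have e: "{f i, v i} \<in> edges (G i)" using neighbor[OF i] by blast
    note F = fan_graph_leaf[OF fan[OF i] k[OF i] C(1) leaf[OF i] e]
    show "chordal_graph (V i) (E i)" unfolding V_def E_def by (rule F(1))
    show "{e \<in> E i. f i \<in> e} = {{f i, v i}}" unfolding E_def by (rule leaf_star[OF leaf[OF i] e])
    show "B \<subseteq> V i \<Longrightarrow> B - {f i} \<noteq> {} \<Longrightarrow> \<exists>w\<in>B - {f i}. simplicial (E i) B w" unfolding V_def E_def by (rule F(2))
    show "card (W i) = n i - 1 \<Longrightarrow> nu (del_edges (E i) (f i)) = nu (E i)" unfolding E_def using F(3) C(2) by simp
    show "card (W i) = n i \<Longrightarrow> nu (del_edges (E i) (v i)) < nu (E i) \<Longrightarrow> nu (del_edges (E i) (f i)) < nu (E i)"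
      unfolding E_def using F(4) C(2) by simp
    show "f i \<in> V i" "v i \<in> V i" "f i \<noteq> v i"
      using chordal_graphD(2,3)[OF F(1) e] by (auto simp: V_def)
  qed
  \<comment> \<open>The renaming performed by \<open>star_glue\<close>; it is injective on
    \<open>V 2\<close> because \<open>f 1\<close> is not a vertex there.\<close>
  define h where "h u = (if u = f 2 then f 1 else u)" for u
  define E2 where "E2 = (`) h ` E 2"
  note G1 = facts(1)[OF i12(1)] and G2 = facts(1)[OF i12(2)]
  have f1V2: "f 1 \<notin> V 2" using facts(6)[OF i12(1)] disjoint by (auto simp: V_def)
  have inj: "inj_on h (V 2)" using f1V2 by (auto simp: inj_on_def h_def)
  have EV: "\<And>e. e \<in> E 2 \<Longrightarrow> e \<subseteq> V 2" by (rule chordal_graphD(3)[OF G2])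
  have fin2: "finite (E 2)" by (rule chordal_graphD(4)[OF G2])
  have hf: "h (f 2) = f 1" by (simp add: h_def)
  have "V 1 \<inter> h ` V 2 = {f 1}"
    using facts(6)[OF i12(1)] facts(6)[OF i12(2)] disjoint by (auto simp: h_def V_def)
  moreover have "{e \<in> E2. f 1 \<in> e} = {{f 1, h (v 2)}}"
  proof -
    have "f 1 \<in> h ` e \<longleftrightarrow> f 2 \<in> e" if "e \<in> E 2" for e
      using inj_on_image_mem_iff[OF inj facts(6)[OF i12(2)] EV[OF that]] by (simp add: hf)
    then have "{e \<in> E2. f 1 \<in> e} = (`) h ` {e \<in> E 2. f 2 \<in> e}" by (auto simp: E2_def)
    then show ?thesis by (simp add: facts(2)[OF i12(2)] hf)
  qed
  moreover have "\<exists>w\<in>B - {f 1}. simplicial E2 B w" if "B \<subseteq> h ` V 2" "B - {f 1} \<noteq> {}" for B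
    using simplicial_avoiding_image[OF inj EV facts(3)[OF i12(2)] facts(6)[OF i12(2)], of B] that
    by (simp add: hf E2_def)
  moreover have "chordal_graph (h ` V 2) E2" unfolding E2_def by (rule chordal_image[OF inj EV G2])
  ultimately have glue: "chordal_graph (V 1 \<union> h ` V 2) (E 1 \<union> E2)" "nu (E 1 \<union> E2) \<le> nu (E 1) + nu E2"
    "nu (E 1) + nu (del_edges E2 (h (v 2))) \<le> nu (E 1 \<union> E2)" "nu (del_edges (E 1) (v 1)) + nu E2 \<le> nu (E 1 \<union> E2)"
    "nu (del_edges (E 1) (f 1)) + nu (del_edges E2 (f 1)) \<le> nu (E 1 \<union> E2)"
    "nu (del_edges (E 1) (v 1)) < nu (E 1) \<Longrightarrow> nu (del_edges E2 (h (v 2))) < nu E2 \<Longrightarrow>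
      nu (del_edges (E 1) (f 1)) < nu (E 1) \<or> nu (del_edges E2 (f 1)) < nu E2 \<Longrightarrow> nu (E 1 \<union> E2) < nu (E 1) + nu E2"
    using facts(2)[OF i12(1)] facts(3)[OF i12(1)] G1
      chordal_glue[of "V 1" "E 1" "h ` V 2" E2 "f 1" "v 1" "h (v 2)"] nu_glue_le[of "V 1" "E 1" "h ` V 2" E2 "f 1" "v 1" "h (v 2)"]
      nu_glue_ge_v2[of "V 1" "E 1" "h ` V 2" E2 "f 1" "v 1" "h (v 2)"] nu_glue_ge_v1[of "V 1" "E 1" "h ` V 2" E2 "f 1" "v 1" "h (v 2)"]
      nu_glue_ge_f[of "V 1" "E 1" "h ` V 2" E2 "f 1" "v 1" "h (v 2)"] nu_glue_less[of "V 1" "E 1" "h ` V 2" E2 "f 1" "v 1" "h (v 2)"]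
    by blast+
  have nu2: "nu E2 = nu (E 2)" unfolding E2_def by (rule nu_image[OF inj EV fin2])
  have nu2d: "nu (del_edges E2 (h x)) = nu (del_edges (E 2) x)" if "x \<in> V 2" for x
  proof -
    have "del_edges E2 (h x) = (`) h ` del_edges (E 2) x" unfolding E2_def by (rule del_edges_image[OF inj EV that])
    moreover have "nu ((`) h ` del_edges (E 2) x) = nu (del_edges (E 2) x)"
      by (rule nu_image[OF inj]) (use EV fin2 in \<open>auto simp: del_edges_def\<close>)
    ultimately show ?thesis by simp
  qed
  note nu2v = nu2d[OF facts(7)[OF i12(2)]] and nu2f = nu2d[OF facts(6)[OF i12(2)], unfolded hf]
  note gl = glue(2-6)[unfolded nu2 nu2v nu2f]
  have "verts H = V 1 \<union> h ` V 2" "edges H = E 1 \<union> E2"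
    by (simp_all add: H star_glue_def Let_def V_def E_def E2_def h_def[abs_def])
  then have rH: "edge_reg TYPE('k) H = int (nu (E 1 \<union> E2))"
    using edge_reg_eq_nu[of H, where ?'k = 'k] glue(1) by simp
  have r: "edge_reg TYPE('k) (G i) = int (nu (E i))" "edge_reg TYPE('k) (del_vert (G i) (v i)) = int (nu (del_edges (E i) (v i)))"
    if "i \<in> {1, 2}" for i
    using edge_reg_eq_nu[of "G i", where ?'k = 'k] edge_reg_del_vert[of "G i" "v i", where ?'k = 'k] facts(1)[OF that]
    by (simp_all add: V_def E_def)
  \<comment> \<open>Deletion never raises \<open>nu\<close>, so \<open>c i\<close> is the same as a
    change of regularity, and \<open>t\<close> counts the \<open>i\<close> with
    \<open>c i\<close>.\<close>
  define c where "c i \<longleftrightarrow> nu (del_edges (E i) (v i)) < nu (E i)" for i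
  have le: "nu (del_edges (E i) (v i)) \<le> nu (E i)" "nu (E i) \<le> Suc (nu (del_edges (E i) (v i)))" if "i \<in> {1, 2}" for i
    using nu_del_edges_le[OF chordal_graphD(4,2)[OF facts(1)[OF that]]] nu_del_edges_ge[OF chordal_graphD(4,2)[OF facts(1)[OF that]]]
    by blast+
  have "edge_reg TYPE('k) (del_vert (G i) (v i)) \<noteq> edge_reg TYPE('k) (G i) \<longleftrightarrow> c i" if "i \<in> {1, 2}" for i
    unfolding r[OF that] c_def using le(1)[OF that] by auto
  then have "{i \<in> {1, 2}. edge_reg TYPE('k) (del_vert (G i) (v i)) \<noteq> edge_reg TYPE('k) (G i)} = {i \<in> {1, 2}. c i}"
    by blast
  then have tc: "t = card {i \<in> {1, 2 :: nat}. c i}" using t by simp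
  have "{i \<in> {1, 2 :: nat}. c i} = (if c 1 then {1} else {}) \<union> (if c 2 then {2} else {})" by auto
  then have t_le: "t \<le> 1 \<longleftrightarrow> \<not> (c 1 \<and> c 2)" and t_eq: "t = 2 \<longleftrightarrow> c 1 \<and> c 2" by (auto simp: tc)
  \<comment> \<open>Some side has a maximum matching avoiding \<open>v i\<close>, which combines
    with any maximum matching of the other side.\<close>
  have 1: "nu (E 1 \<union> E2) = nu (E 1) + nu (E 2)" if "t \<le> 1"
    using that le[OF i12(1)] le[OF i12(2)] gl(1,2,3) unfolding t_le c_def by linarith
  \<comment> \<open>Both sides have maximum matchings avoiding the common leaf, and these
    combine.\<close>
  have 2: "nu (E 1 \<union> E2) = nu (E 1) + nu (E 2)" if "\<forall>i\<in>{1, 2}. card (W i) = n i - 1"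
    using that facts(4)[OF i12(1)] facts(4)[OF i12(2)] gl(1,4) by simp
  \<comment> \<open>On one side every maximum matching covers the leaf, so the sum is missed;
    deleting \<open>v 2\<close> loses at most 1, so it is missed by exactly 1.\<close>
  have 3: "Suc (nu (E 1 \<union> E2)) = nu (E 1) + nu (E 2)" if "t = 2" "\<exists>i\<in>{1, 2}. card (W i) = n i"
  proof -
    have c: "nu (del_edges (E 1) (v 1)) < nu (E 1)" "nu (del_edges (E 2) (v 2)) < nu (E 2)"
      using that(1) unfolding t_eq c_def by auto
    have "nu (del_edges (E 1) (f 1)) < nu (E 1) \<or> nu (del_edges (E 2) (f 2)) < nu (E 2)"
      using that(2) facts(5)[OF i12(1)] facts(5)[OF i12(2)] c by auto
    then have "nu (E 1 \<union> E2) < nu (E 1) + nu (E 2)" using gl(5) c by blast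
    moreover have "nu (E 1) + nu (E 2) \<le> Suc (nu (E 1 \<union> E2))" using gl(2) le(2)[OF i12(2)] by linarith
    ultimately show ?thesis by linarith
  qed
  show ?thesis
    unfolding rH r(1)[OF i12(1)] r(1)[OF i12(2)] using 1 2 3 by force
qed

end
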